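(* Let $\varphi:R\to S$ be a homomorphism of commutative coherent rings. For $M,N\in\mathrm{mod}\,R$ and $n\ge1$, $$N\in\mathrm{Filt}_n(\mathrm{gen}_R(M))\ \Longrightarrow\ S\otimes_RN\in\mathrm{Filt}_n(\mathrm{gen}_S(S\otimes_RM)).$$ Moreover, $$b_S(S\otimes_RM)\le b_R(M).$$ If $\varphi$ is faithfully flat, the implication above is an equivalence and this inequality is an equality.
   Context: All rings are commutative with identity. A ring is coherent if each of its finitely generated ideals is finitely presented as a module. $\mathrm{mod}\,R$ is the category of finitely presented $R$-modules, abelian for coherent $R$. $\mathrm{Ann}_RM=\{r\in R:rM=0\}$. $\mathrm{gen}_R(M)$ is the full subcategory of $\mathrm{mod}\,R$ of quotient objects (in $\mathrm{mod}\,R$) of finite direct sums of copies of $M$. For a subcategory $\mathcal A\subseteq\mathrm{mod}\,R$ containing $0$ and $n\ge1$, $\mathrm{Filt}_n(\mathcal A)$ consists of the $N\in\mathrm{mod}\,R$ admitting a filtration $0=N_0\subseteq N_1\subseteq\cdots\subseteq N_m=N$ in $\mathrm{mod}\,R$ with $m\le n$ and all $N_i/N_{i-1}\in\mathcal A$. Define $$b_R(M)=\min\{m\ge1:R/\mathrm{Ann}_RM\in\mathrm{Filt}_m(\mathrm{gen}_R(M))\},$$ with $b_R(M)=\infty$ if the set is empty. The same notation is used over $S$. *)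

theory Defs
  imports
    "HOL-Algebra.Module"
    "HOL-Algebra.RingHom"
    "HOL-Algebra.Generated_Groups"
    "HOL-Algebra.Free_Abelian_Groups"
    "HOL-Library.Extended_Nat"
begin

text \<open>
  Modules are the records of \<^theory>\<open>HOL-Algebra.Module\<close>. These records carry the ring-only fields
  \<open>mult\<close> and \<open>one\<close>, which the locale \<open>module\<close> ignores; except for the regular module they are
  left undefined in the constructions below.
\<close>

subsection \<open>Modules and linear maps\<close>

definition module_homs :: "'r ring \<Rightarrow> ('r, 'a) module \<Rightarrow> ('r, 'b) module \<Rightarrow> ('a \<Rightarrow> 'b) set" where
  "module_homs R A B =
     {f \<in> carrier A \<rightarrow> carrier B.
        (\<forall>x\<in>carrier A. \<forall>y\<in>carrier A. f (x \<oplus>\<^bsub>A\<^esub> y) = f x \<oplus>\<^bsub>B\<^esub> f y) \<and>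
        (\<forall>r\<in>carrier R. \<forall>x\<in>carrier A. f (r \<odot>\<^bsub>A\<^esub> x) = r \<odot>\<^bsub>B\<^esub> f x)}"

definition exact_at ::
  "('r, 'a) module \<Rightarrow> ('a \<Rightarrow> 'b) \<Rightarrow> ('r, 'b) module \<Rightarrow> ('b \<Rightarrow> 'c) \<Rightarrow> ('r, 'c) module \<Rightarrow> bool" where
  "exact_at A f B g C \<longleftrightarrow> f ` carrier A = a_kernel B C g"

definition regular_module :: "'r ring \<Rightarrow> ('r, 'r) module" where
  "regular_module R =
     \<lparr>carrier = carrier R,
      monoid.mult = monoid.mult R,
      monoid.one = \<one>\<^bsub>R\<^esub>,
      ring.zero = \<zero>\<^bsub>R\<^esub>,
      ring.add = ring.add R,
      smult = monoid.mult R\<rparr>"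

text \<open>The direct sum of \<open>k\<close> copies of a module.\<close>

definition power_module :: "('r, 'a) module \<Rightarrow> nat \<Rightarrow> ('r, nat \<Rightarrow> 'a) module" where
  "power_module M k =
     \<lparr>carrier = {..<k} \<rightarrow>\<^sub>E carrier M,
      monoid.mult = undefined,
      monoid.one = undefined,
      ring.zero = (\<lambda>i\<in>{..<k}. \<zero>\<^bsub>M\<^esub>),
      ring.add = (\<lambda>x y. \<lambda>i\<in>{..<k}. x i \<oplus>\<^bsub>M\<^esub> y i),
      smult = (\<lambda>r x. \<lambda>i\<in>{..<k}. r \<odot>\<^bsub>M\<^esub> x i)\<rparr>"

text \<open>The quotient of \<open>M\<close> by a submodule \<open>H\<close>; the scalar action is \<open>r (H + x) = H + r x\<close>.\<close>

definition quotient_module :: "('r, 'a) module \<Rightarrow> 'a set \<Rightarrow> ('r, 'a set) module" where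
  "quotient_module M H =
     \<lparr>carrier = a_rcosets\<^bsub>M\<^esub> H,
      monoid.mult = undefined,
      monoid.one = undefined,
      ring.zero = H,
      ring.add = set_add M,
      smult = (\<lambda>r X. \<Union>x\<in>X. H +>\<^bsub>M\<^esub> (r \<odot>\<^bsub>M\<^esub> x))\<rparr>"

definition annihilator :: "'r ring \<Rightarrow> ('r, 'a) module \<Rightarrow> 'r set" where
  "annihilator R M = {r \<in> carrier R. \<forall>x\<in>carrier M. r \<odot>\<^bsub>M\<^esub> x = \<zero>\<^bsub>M\<^esub>}"


subsection \<open>Finite presentation and coherence\<close>

text \<open>Existence of an exact sequence \<open>R\<^sup>p \<rightarrow> R\<^sup>q \<rightarrow> M \<rightarrow> 0\<close>.\<close>

definition finitely_presented :: "'r ring \<Rightarrow> ('r, 'a) module \<Rightarrow> bool" where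
  "finitely_presented R M \<longleftrightarrow>
     Module.module R M \<and>
     (\<exists>p q. \<exists>g \<in> module_homs R (power_module (regular_module R) p) (power_module (regular_module R) q).
            \<exists>f \<in> module_homs R (power_module (regular_module R) q) M.
        exact_at (power_module (regular_module R) p) g (power_module (regular_module R) q) f M \<and>
        f ` carrier (power_module (regular_module R) q) = carrier M)"

definition coherent_ring :: "'r ring \<Rightarrow> bool" where
  "coherent_ring R \<longleftrightarrow>
     cring R \<and>
     (\<forall>A. finite A \<and> A \<subseteq> carrier R \<longrightarrow>
        finitely_presented R ((regular_module R)\<lparr>carrier := genideal R A\<rparr>))"


subsection \<open>Generation, filtrations and the invariant b\<close>

text \<open>
  A subcategory of finitely presented modules is represented by its set of objects. HOL sets are
  typed, so \<open>gen R M\<close> is polymorphic in the carrier type \<open>'a\<close> of its members; membership is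
  invariant under isomorphism. Similarly, the subquotients of a module with carrier type \<open>'a\<close> have
  carrier type \<open>'a set\<close>, which explains the type of \<open>Filt\<close>.
\<close>

definition gen :: "'r ring \<Rightarrow> ('r, 'm) module \<Rightarrow> ('r, 'a) module set" where
  "gen R M =
     {N. finitely_presented R N \<and>
         (\<exists>k. \<exists>f \<in> module_homs R (power_module M k) N.
            f ` carrier (power_module M k) = carrier N)}"

definition Filt :: "'r ring \<Rightarrow> nat \<Rightarrow> ('r, 'a set) module set \<Rightarrow> ('r, 'a) module set" where
  "Filt R n \<A> =
     {N. finitely_presented R N \<and>
         (\<exists>m F. m \<le> n \<and> F 0 = {\<zero>\<^bsub>N\<^esub>} \<and> F m = carrier N \<and>
            (\<forall>i\<le>m. submodule (F i) R N \<and> finitely_presented R (N\<lparr>carrier := F i\<rparr>)) \<and>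
            (\<forall>i<m. F i \<subseteq> F (Suc i) \<and>
                   quotient_module (N\<lparr>carrier := F (Suc i)\<rparr>) (F i) \<in> \<A>))}"

text \<open>The infimum of the empty set in \<^typ>\<open>enat\<close> is \<open>\<infinity>\<close>.\<close>

definition b_inv :: "'r ring \<Rightarrow> ('r, 'm) module \<Rightarrow> enat" where
  "b_inv R M =
     Inf {enat m | m. 1 \<le> m \<and>
            quotient_module (regular_module R) (annihilator R M) \<in> Filt R m (gen R M)}"


subsection \<open>Base change\<close>

text \<open>
  For \<open>\<phi> : R \<rightarrow> S\<close> and an \<open>R\<close>-module \<open>N\<close>, the tensor product of \<open>S\<close> and \<open>N\<close> over \<open>R\<close> is the free
  abelian group on \<open>S \<times> N\<close> modulo the subgroup generated by the bilinearity and balancing relations;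
  \<open>t \<in> S\<close> acts by \<open>t (s \<otimes> x) = t s \<otimes> x\<close>. Elements of the tensor product are cosets, and
  an endomorphism or homomorphism given on the free groups is applied to a coset elementwise, its
  image then being enlarged to a full coset.
\<close>

definition tensor_relations ::
  "'r ring \<Rightarrow> 's ring \<Rightarrow> ('r \<Rightarrow> 's) \<Rightarrow> ('r, 'a) module \<Rightarrow> ('s \<times> 'a \<Rightarrow>\<^sub>0 int) set" where
  "tensor_relations R S \<phi> N =
     {frag_of (s \<oplus>\<^bsub>S\<^esub> t, x) - frag_of (s, x) - frag_of (t, x) | s t x.
        s \<in> carrier S \<and> t \<in> carrier S \<and> x \<in> carrier N} \<union>
     {frag_of (s, x \<oplus>\<^bsub>N\<^esub> y) - frag_of (s, x) - frag_of (s, y) | s x y.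
        s \<in> carrier S \<and> x \<in> carrier N \<and> y \<in> carrier N} \<union>
     {frag_of (s \<otimes>\<^bsub>S\<^esub> \<phi> r, x) - frag_of (s, r \<odot>\<^bsub>N\<^esub> x) | s r x.
        s \<in> carrier S \<and> r \<in> carrier R \<and> x \<in> carrier N}"

definition tensor_free :: "'s ring \<Rightarrow> ('r, 'a) module \<Rightarrow> ('s \<times> 'a \<Rightarrow>\<^sub>0 int) monoid" where
  "tensor_free S N = free_Abelian_group (carrier S \<times> carrier N)"

definition tensor_null ::
  "'r ring \<Rightarrow> 's ring \<Rightarrow> ('r \<Rightarrow> 's) \<Rightarrow> ('r, 'a) module \<Rightarrow> ('s \<times> 'a \<Rightarrow>\<^sub>0 int) set" where
  "tensor_null R S \<phi> N = generate (tensor_free S N) (tensor_relations R S \<phi> N)"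

definition base_change ::
  "'r ring \<Rightarrow> 's ring \<Rightarrow> ('r \<Rightarrow> 's) \<Rightarrow> ('r, 'a) module \<Rightarrow> ('s, ('s \<times> 'a \<Rightarrow>\<^sub>0 int) set) module" where
  "base_change R S \<phi> N =
     (let G = tensor_free S N; K = tensor_null R S \<phi> N in
      \<lparr>carrier = carrier (G Mod K),
       monoid.mult = undefined,
       monoid.one = undefined,
       ring.zero = monoid.one (G Mod K),
       ring.add = monoid.mult (G Mod K),
       smult = (\<lambda>t X. K <#>\<^bsub>G\<^esub> frag_extend (\<lambda>(s, x). frag_of (t \<otimes>\<^bsub>S\<^esub> s, x)) ` X)\<rparr>)"

definition base_change_map ::
  "'r ring \<Rightarrow> 's ring \<Rightarrow> ('r \<Rightarrow> 's) \<Rightarrow> ('r, 'b) module \<Rightarrow> ('a \<Rightarrow> 'b) \<Rightarrow>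
   ('s \<times> 'a \<Rightarrow>\<^sub>0 int) set \<Rightarrow> ('s \<times> 'b \<Rightarrow>\<^sub>0 int) set" where
  "base_change_map R S \<phi> B f X =
     tensor_null R S \<phi> B <#>\<^bsub>tensor_free S B\<^esub> frag_extend (\<lambda>(s, x). frag_of (s, f x)) ` X"

text \<open>
  \<open>S\<close> is faithfully flat over \<open>R\<close> if a sequence \<open>A \<rightarrow> B \<rightarrow> C\<close> of \<open>R\<close>-modules is exact if and only
  if its base change to \<open>S\<close> is. A HOL formula cannot range over modules of all carrier types, so
  the test modules have carrier type \<open>(nat \<Rightarrow> 'r) set\<close>. Up to isomorphism these include all
  countably generated modules (the quotients of the module of finitely supported sequences over \<open>R\<close>),
  in particular all finitely generated modules.
  This is no restriction: flatness is detected on the inclusions of finitely generated ideals into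
  \<open>R\<close>, and faithfulness of a flat module is detected on cyclic modules.
\<close>

definition faithfully_flat :: "'r ring \<Rightarrow> 's ring \<Rightarrow> ('r \<Rightarrow> 's) \<Rightarrow> bool" where
  "faithfully_flat R S \<phi> \<longleftrightarrow>
     (\<forall>(A :: ('r, (nat \<Rightarrow> 'r) set) module) (B :: ('r, (nat \<Rightarrow> 'r) set) module)
       (C :: ('r, (nat \<Rightarrow> 'r) set) module) f g.
        Module.module R A \<and> Module.module R B \<and> Module.module R C \<and>
        f \<in> module_homs R A B \<and> g \<in> module_homs R B C \<longrightarrow>
        (exact_at A f B g C \<longleftrightarrow>
         exact_at (base_change R S \<phi> A) (base_change_map R S \<phi> B f) (base_change R S \<phi> B)
                  (base_change_map R S \<phi> C g) (base_change R S \<phi> C)))"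

end

theory Submission
  imports Defs
begin

text \<open>
  The trace of \<open>M\<close> in a module is its largest submodule generated by \<open>M\<close>.  Dividing by the trace again and
  again filters a module greedily: the quotients are generated by \<open>M\<close>, and the terms of any other
  filtration with this property are contained in those of the greedy one.  Over a coherent ring
  all modules that occur are finitely presented, so \<open>N\<close> lies in \<open>Filt\<^sub>n(gen M)\<close> if and only if its \<open>n\<close>-th
  iterated trace is everything (\<open>Filt_gen_iff_trace\<close>).  Choose presentations of \<open>M\<close> and \<open>N\<close> by \<open>m\<close> and \<open>q\<close>
  generators.  The iterated traces become submodules of \<open>R\<^sup>q\<close>, and the maps from \<open>M\<close> that form them become
  the \<open>m \<times> q\<close> matrices that send the relations of \<open>M\<close> into a given submodule, called admissible.

  Base change keeps the matrices of the presentations (\<open>base_change_presentation\<close>), and \<open>\<phi>\<close> takes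
  admissible matrices over \<open>R\<close> to admissible matrices over \<open>S\<close>.  Hence the iterated traces over \<open>R\<close> map into
  those over \<open>S\<close>, which is the first implication.  If \<open>\<phi>\<close> is flat, the admissible matrices over \<open>S\<close>, as
  solutions of a linear system with coefficients in \<open>R\<close>, are \<open>S\<close>-combinations of those over \<open>R\<close>
  (\<open>flat_kernel\<close>, \<open>flat_trace\<close>).  So the traces over \<open>R\<close> span the traces over \<open>S\<close>, and faithfulness shows that the
  former are everything if the latter are (\<open>faithful_span\<close>).

  The invariant \<open>b\<close> is governed by the cyclic module \<open>R / Ann M\<close>.  Its relations are again the
  solutions of a linear system read off from a presentation of \<open>M\<close> (\<open>annihilator_presentation\<close>).  They map
  into the relations of \<open>S / Ann (S \<otimes> M)\<close>, and span them in the flat case, so the same comparison of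
  traces applies although \<open>S / Ann (S \<otimes> M)\<close> is in general a proper quotient of the base change of
  \<open>R / Ann M\<close>.
\<close>

section \<open>Linear maps, generated submodules and quotients\<close>

lemma module_homsD:
  assumes "f \<in> module_homs R A B"
  shows "x \<in> carrier A \<Longrightarrow> f x \<in> carrier B"
    and "x \<in> carrier A \<Longrightarrow> y \<in> carrier A \<Longrightarrow> f (x \<oplus>\<^bsub>A\<^esub> y) = f x \<oplus>\<^bsub>B\<^esub> f y"
    and "r \<in> carrier R \<Longrightarrow> x \<in> carrier A \<Longrightarrow> f (r \<odot>\<^bsub>A\<^esub> x) = r \<odot>\<^bsub>B\<^esub> f x"
  using assms by (auto simp: module_homs_def)

lemma module_homsI:
  assumes "\<And>x. x \<in> carrier A \<Longrightarrow> f x \<in> carrier B"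
    and "\<And>x y. x \<in> carrier A \<Longrightarrow> y \<in> carrier A \<Longrightarrow> f (x \<oplus>\<^bsub>A\<^esub> y) = f x \<oplus>\<^bsub>B\<^esub> f y"
    and "\<And>r x. r \<in> carrier R \<Longrightarrow> x \<in> carrier A \<Longrightarrow> f (r \<odot>\<^bsub>A\<^esub> x) = r \<odot>\<^bsub>B\<^esub> f x"
  shows "f \<in> module_homs R A B"
  using assms by (auto simp: module_homs_def)

lemma module_homs_comp:
  assumes "f \<in> module_homs R A B" "g \<in> module_homs R B C"
  shows "(\<lambda>x. g (f x)) \<in> module_homs R A C"
  using assms by (intro module_homsI) (simp_all add: module_homsD)

lemma module_hom_zero:
  assumes "Module.module R A" "Module.module R B" "f \<in> module_homs R A B"
  shows "f \<zero>\<^bsub>A\<^esub> = \<zero>\<^bsub>B\<^esub>"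
proof -
  interpret A: Module.module R A by fact
  interpret B: Module.module R B by fact
  have "f (\<zero>\<^bsub>R\<^esub> \<odot>\<^bsub>A\<^esub> \<zero>\<^bsub>A\<^esub>) = \<zero>\<^bsub>R\<^esub> \<odot>\<^bsub>B\<^esub> f \<zero>\<^bsub>A\<^esub>"
    using assms(3) by (rule module_homsD) auto
  then show ?thesis using module_homsD(1)[OF assms(3)] by simp
qed

lemma (in Module.module) minus_eq_smult:
  "x \<in> carrier M \<Longrightarrow> \<ominus>\<^bsub>M\<^esub> x = (\<ominus> \<one>) \<odot>\<^bsub>M\<^esub> x"
  by (simp add: smult_l_minus)

lemma module_hom_minus:
  assumes "Module.module R A" "Module.module R B" "f \<in> module_homs R A B"
    and "x \<in> carrier A" "y \<in> carrier A"
  shows "f (x \<ominus>\<^bsub>A\<^esub> y) = f x \<ominus>\<^bsub>B\<^esub> f y"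
proof -
  interpret A: Module.module R A by fact
  interpret B: Module.module R B by fact
  show ?thesis
    using assms(4,5) module_homsD[OF assms(3)]
    by (simp add: A.M.minus_eq B.M.minus_eq A.minus_eq_smult B.minus_eq_smult)
qed

lemma module_homs_ident: "(\<lambda>x. x) \<in> module_homs R A A"
  by (rule module_homsI) (assumption | rule refl)+

lemma module_homs_minus:
  assumes A: "Module.module R A" and B: "Module.module R B"
    and f: "f \<in> module_homs R A B" and g: "g \<in> module_homs R A B"
  shows "(\<lambda>x. f x \<ominus>\<^bsub>B\<^esub> g x) \<in> module_homs R A B"
proof (rule module_homsI)
  interpret A: Module.module R A by fact
  interpret B: Module.module R B by fact
  note f = module_homsD[OF f] note g = module_homsD[OF g]
  fix x assume x: "x \<in> carrier A"
  then show "f x \<ominus>\<^bsub>B\<^esub> g x \<in> carrier B" using f g by simp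
  { fix r assume r: "r \<in> carrier R"
    show "f (r \<odot>\<^bsub>A\<^esub> x) \<ominus>\<^bsub>B\<^esub> g (r \<odot>\<^bsub>A\<^esub> x) = r \<odot>\<^bsub>B\<^esub> (f x \<ominus>\<^bsub>B\<^esub> g x)"
      using r x f g by (simp add: B.M.minus_eq B.smult_r_distr B.smult_r_minus) }
  fix y assume y: "y \<in> carrier A"
  show "f (x \<oplus>\<^bsub>A\<^esub> y) \<ominus>\<^bsub>B\<^esub> g (x \<oplus>\<^bsub>A\<^esub> y) = (f x \<ominus>\<^bsub>B\<^esub> g x) \<oplus>\<^bsub>B\<^esub> (f y \<ominus>\<^bsub>B\<^esub> g y)"
    using x y f g by (simp add: B.M.minus_eq B.M.minus_add B.M.a_ac)
qed

lemma image_Collect_comp: "f ` {x \<in> A. P (f x)} = {y \<in> f ` A. P y}"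
  by auto

lemma a_kernel_eq: "a_kernel A B f = {x \<in> carrier A. f x = \<zero>\<^bsub>B\<^esub>}"
  by (simp add: a_kernel_def kernel_def)

lemma submoduleD:
  assumes "Module.module R N" "submodule H R N"
  shows "H \<subseteq> carrier N" "x \<in> H \<Longrightarrow> x \<in> carrier N" "\<zero>\<^bsub>N\<^esub> \<in> H"
    and "x \<in> H \<Longrightarrow> y \<in> H \<Longrightarrow> x \<oplus>\<^bsub>N\<^esub> y \<in> H"
    and "x \<in> H \<Longrightarrow> y \<in> H \<Longrightarrow> x \<ominus>\<^bsub>N\<^esub> y \<in> H"
    and "r \<in> carrier R \<Longrightarrow> x \<in> H \<Longrightarrow> r \<odot>\<^bsub>N\<^esub> x \<in> H"
proof -
  interpret N: Module.module R N by fact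
  note E = N.submoduleE[OF assms(2)]
  show "H \<subseteq> carrier N" "x \<in> H \<Longrightarrow> x \<in> carrier N" using E(1) by auto
  show "\<zero>\<^bsub>N\<^esub> \<in> H" using subgroup.one_closed[OF submodule.axioms(1)[OF assms(2)]] by simp
  show "x \<in> H \<Longrightarrow> y \<in> H \<Longrightarrow> x \<oplus>\<^bsub>N\<^esub> y \<in> H" "r \<in> carrier R \<Longrightarrow> x \<in> H \<Longrightarrow> r \<odot>\<^bsub>N\<^esub> x \<in> H"
    "x \<in> H \<Longrightarrow> y \<in> H \<Longrightarrow> x \<ominus>\<^bsub>N\<^esub> y \<in> H"
    using E by (auto simp: N.M.minus_eq)
qed

lemma submodule_if_closed:
  assumes "Module.module R N" "H \<subseteq> carrier N" "\<zero>\<^bsub>N\<^esub> \<in> H"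
    and "\<And>x y. x \<in> H \<Longrightarrow> y \<in> H \<Longrightarrow> x \<oplus>\<^bsub>N\<^esub> y \<in> H"
    and "\<And>r x. r \<in> carrier R \<Longrightarrow> x \<in> H \<Longrightarrow> r \<odot>\<^bsub>N\<^esub> x \<in> H"
  shows "submodule H R N"
proof -
  interpret N: Module.module R N by fact
  show ?thesis
  proof (rule N.submoduleI)
    fix a assume "a \<in> H"
    then show "\<ominus>\<^bsub>N\<^esub> a \<in> H" using assms by (auto simp: N.minus_eq_smult)
  qed (use assms in auto)
qed

lemma module_carrier_update:
  assumes "Module.module R N" "submodule H R N"
  shows "Module.module R (N\<lparr>carrier := H\<rparr>)"
  using submodule.submodule_is_module[OF assms(2,1)] .

lemma module_homs_into_submodule:
  assumes "f \<in> module_homs R A B" "f ` carrier A \<subseteq> H"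
  shows "f \<in> module_homs R A (B\<lparr>carrier := H\<rparr>)"
  using assms by (intro module_homsI) (auto simp: module_homsD)

lemma module_homs_restrict:
  assumes "f \<in> module_homs R A B" "H \<subseteq> carrier A"
  shows "f \<in> module_homs R (A\<lparr>carrier := H\<rparr>) B"
  using assms by (intro module_homsI) (auto simp: module_homsD subsetD)

lemma submodule_preimage:
  assumes "Module.module R A" "Module.module R B" "f \<in> module_homs R A B" "submodule H R B"
  shows "submodule {x \<in> carrier A. f x \<in> H} R A"
proof -
  interpret A: Module.module R A by fact
  show ?thesis
    using module_homsD[OF assms(3)] submoduleD[OF assms(2,4)] module_hom_zero[OF assms(1-3)]
    by (intro submodule_if_closed) (auto simp: assms(1))
qed

lemma submodule_zero:
  assumes "Module.module R A"
  shows "submodule {\<zero>\<^bsub>A\<^esub>} R A"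
proof -
  interpret A: Module.module R A by fact
  show ?thesis by (rule submodule_if_closed) (auto simp: assms)
qed

lemma submodule_kernel:
  assumes "Module.module R A" "Module.module R B" "f \<in> module_homs R A B"
  shows "submodule (a_kernel A B f) R A"
  using submodule_preimage[OF assms submodule_zero[OF assms(2)]] by (simp add: a_kernel_eq)

lemma submodule_image:
  assumes "Module.module R A" "Module.module R B" "f \<in> module_homs R A B" "submodule H R A"
  shows "submodule (f ` H) R B"
proof (rule submodule_if_closed)
  note D = submoduleD[OF assms(1,4)] note h = module_homsD[OF assms(3)]
  show "f ` H \<subseteq> carrier B" using D h by auto
  show "\<zero>\<^bsub>B\<^esub> \<in> f ` H" using D module_hom_zero[OF assms(1-3)] by (metis imageI)
  fix x y r assume "x \<in> f ` H" 
  then obtain x' where x': "x' \<in> H" "x = f x'" by auto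
  { assume "y \<in> f ` H"
    then obtain y' where "y' \<in> H" "y = f y'" by auto
    then show "x \<oplus>\<^bsub>B\<^esub> y \<in> f ` H" using x' D by (intro image_eqI[of _ _ "x' \<oplus>\<^bsub>A\<^esub> y'"]) (auto simp: h) }
  { assume "r \<in> carrier R"
    then show "r \<odot>\<^bsub>B\<^esub> x \<in> f ` H" using x' D by (intro image_eqI[of _ _ "r \<odot>\<^bsub>A\<^esub> x'"]) (auto simp: h) }
qed (use assms in auto)

inductive_set mspan :: "'r ring \<Rightarrow> ('r, 'a) module \<Rightarrow> 'a set \<Rightarrow> 'a set"
  for R N X where
  zero: "\<zero>\<^bsub>N\<^esub> \<in> mspan R N X"
| incl: "x \<in> X \<Longrightarrow> x \<in> mspan R N X"
| add: "x \<in> mspan R N X \<Longrightarrow> y \<in> mspan R N X \<Longrightarrow> x \<oplus>\<^bsub>N\<^esub> y \<in> mspan R N X"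
| smult: "r \<in> carrier R \<Longrightarrow> x \<in> mspan R N X \<Longrightarrow> r \<odot>\<^bsub>N\<^esub> x \<in> mspan R N X"

lemma mspan_least:
  assumes "Module.module R N" "submodule H R N" "X \<subseteq> H"
  shows "mspan R N X \<subseteq> H"
proof
  fix x assume "x \<in> mspan R N X"
  then show "x \<in> H" by induction (use submoduleD[OF assms(1,2)] assms(3) in auto)
qed

lemma mspan_subset_carrier:
  assumes "Module.module R N" "X \<subseteq> carrier N"
  shows "mspan R N X \<subseteq> carrier N"
  using mspan_least[OF assms(1) module.carrier_is_submodule[OF assms(1)] assms(2)] .

lemma submodule_mspan:
  assumes "Module.module R N" "X \<subseteq> carrier N"
  shows "submodule (mspan R N X) R N"
  using mspan_subset_carrier[OF assms]
  by (intro submodule_if_closed[OF assms(1)]) (auto intro: mspan.zero mspan.add mspan.smult)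

lemma mspan_eqI:
  assumes "Module.module R N" "submodule H R N" "X \<subseteq> H" "H \<subseteq> mspan R N X"
  shows "H = mspan R N X"
  using mspan_least[OF assms(1-3)] assms(4) by auto

lemma mspan_mono: "X \<subseteq> Y \<Longrightarrow> mspan R N X \<subseteq> mspan R N Y"
proof
  fix x assume "X \<subseteq> Y" "x \<in> mspan R N X"
  from this(2,1) show "x \<in> mspan R N Y" by induction (auto intro: mspan.intros)
qed

lemma mspan_superset: "X \<subseteq> mspan R N X"
  by (auto intro: mspan.incl)

lemma mspan_subset_mspan:
  assumes "X \<subseteq> mspan R N Y"
  shows "mspan R N X \<subseteq> mspan R N Y"
proof
  fix x assume "x \<in> mspan R N X"
  then show "x \<in> mspan R N Y" by induction (use assms in \<open>auto intro: mspan.intros\<close>)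
qed

lemma mspan_submodule_eq:
  assumes "Module.module R N" "submodule H R N"
  shows "mspan R N H = H"
  by (rule equalityI[OF mspan_least[OF assms subset_refl] mspan_superset])

lemma hom_image_mspan:
  assumes "Module.module R A" "Module.module R B" "f \<in> module_homs R A B" "X \<subseteq> carrier A"
  shows "f ` mspan R A X = mspan R B (f ` X)"
proof
  have "mspan R A X \<subseteq> {x \<in> carrier A. f x \<in> mspan R B (f ` X)}"
  proof (rule mspan_least[OF assms(1)])
    have "f ` X \<subseteq> carrier B" using assms(4) module_homsD[OF assms(3)] by auto
    then show "submodule {x \<in> carrier A. f x \<in> mspan R B (f ` X)} R A"
      by (rule submodule_preimage[OF assms(1-3) submodule_mspan[OF assms(2)]])
  qed (use assms(4) in \<open>auto intro: mspan.incl\<close>)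
  then show "f ` mspan R A X \<subseteq> mspan R B (f ` X)" by auto
  show "mspan R B (f ` X) \<subseteq> f ` mspan R A X"
    by (rule mspan_least[OF assms(2) submodule_image[OF assms(1-3) submodule_mspan[OF assms(1,4)]]
          image_mono[OF mspan_superset]])
qed

lemma hom_eq_on_mspan:
  assumes "Module.module R A" "Module.module R B" "f \<in> module_homs R A B" "g \<in> module_homs R A B"
    and "X \<subseteq> carrier A" "\<And>x. x \<in> X \<Longrightarrow> f x = g x" "x \<in> mspan R A X"
  shows "f x = g x"
proof -
  note sub = mspan_subset_carrier[OF assms(1,5)]
  note f = module_homsD[OF assms(3)] note g = module_homsD[OF assms(4)]
  from assms(7) show ?thesis
    by induction (use assms(6) sub in \<open>auto simp: f g subsetD module_hom_zero[OF assms(1,2)] assms(3,4)\<close>)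
qed

lemma (in abelian_group) minus_eq_zero_iff:
  "x \<in> carrier G \<Longrightarrow> y \<in> carrier G \<Longrightarrow> x \<ominus> y = \<zero> \<longleftrightarrow> x = y"
  by (metis minus_eq add.inv_closed add.inv_inv minus_equality r_neg)

lemma hom_image_eq_iff:
  assumes "Module.module R A" "Module.module R B" "f \<in> module_homs R A B" "x \<in> carrier A" "y \<in> carrier A"
  shows "f x = f y \<longleftrightarrow> x \<ominus>\<^bsub>A\<^esub> y \<in> a_kernel A B f"
proof -
  interpret A: Module.module R A by fact
  interpret B: Module.module R B by fact
  show ?thesis
    using assms(4,5) module_homsD(1)[OF assms(3)]
    by (simp add: a_kernel_eq module_hom_minus[OF assms(1-3)] B.M.minus_eq_zero_iff)
qed

lemma hom_factor:
  assumes "Module.module R A" "Module.module R B" "Module.module R C"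
    and "p \<in> module_homs R A B" "p ` carrier A = carrier B" "u \<in> module_homs R A C"
    and "a_kernel A B p \<subseteq> a_kernel A C u"
  obtains g where "g \<in> module_homs R B C" "\<And>x. x \<in> carrier A \<Longrightarrow> g (p x) = u x"
proof -
  interpret A: Module.module R A by fact
  note p = module_homsD[OF assms(4)] note u = module_homsD[OF assms(6)]
  define g where "g y = u (SOME x. x \<in> carrier A \<and> p x = y)" for y
  have g: "g (p x) = u x" if x: "x \<in> carrier A" for x
  proof -
    have "\<exists>x'. x' \<in> carrier A \<and> p x' = p x" using x by auto
    from someI_ex[OF this]
    have *: "(SOME x'. x' \<in> carrier A \<and> p x' = p x) \<in> carrier A"
      "p (SOME x'. x' \<in> carrier A \<and> p x' = p x) = p x" by auto
    then show ?thesis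
      unfolding g_def using x assms(7) hom_image_eq_iff[OF assms(1,2,4)] hom_image_eq_iff[OF assms(1,3,6)]
      by (simp add: subset_iff)
  qed
  have "g \<in> module_homs R B C"
  proof (rule module_homsI)
    fix x assume "x \<in> carrier B"
    then obtain x' where x': "x' \<in> carrier A" "x = p x'" using assms(5) by auto
    then show "g x \<in> carrier C" by (simp add: g u)
    { fix r assume r: "r \<in> carrier R"
      then have "g (p (r \<odot>\<^bsub>A\<^esub> x')) = u (r \<odot>\<^bsub>A\<^esub> x')" using x' by (intro g) simp
      then show "g (r \<odot>\<^bsub>B\<^esub> x) = r \<odot>\<^bsub>C\<^esub> g x" using r x' by (simp add: g u p) }
    fix y assume "y \<in> carrier B"
    then obtain y' where y': "y' \<in> carrier A" "y = p y'" using assms(5) by auto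
    then have "g (p (x' \<oplus>\<^bsub>A\<^esub> y')) = u (x' \<oplus>\<^bsub>A\<^esub> y')" using x' by (intro g) simp
    then show "g (x \<oplus>\<^bsub>B\<^esub> y) = g x \<oplus>\<^bsub>C\<^esub> g y" using y' x' by (simp add: g u p)
  qed
  with g show ?thesis by (rule_tac that)
qed

lemma quotient_module:
  assumes "Module.module R N" "submodule H R N"
  shows "Module.module R (quotient_module N H)"
    and "(\<lambda>x. H +>\<^bsub>N\<^esub> x) \<in> module_homs R N (quotient_module N H)"
    and "(\<lambda>x. H +>\<^bsub>N\<^esub> x) ` carrier N = carrier (quotient_module N H)"
    and "a_kernel N (quotient_module N H) (\<lambda>x. H +>\<^bsub>N\<^esub> x) = H"
proof -
  interpret N: Module.module R N by fact
  interpret H: submodule H R N by fact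
  note D = submoduleD[OF assms]
  have sg: "subgroup H (add_monoid N)" by (rule submodule.axioms(1)[OF assms(2)])
  interpret A: abelian_subgroup H N
    by (rule abelian_subgroupI3) (auto intro: additive_subgroup.intro sg N.abelian_group_axioms)
  let ?Q = "quotient_module N H" let ?p = "\<lambda>x. H +>\<^bsub>N\<^esub> x"
  have carr: "carrier ?Q = ?p ` carrier N"
    by (auto simp: quotient_module_def A_RCOSETS_def')
  have addQ: "?p x \<oplus>\<^bsub>?Q\<^esub> ?p y = ?p (x \<oplus>\<^bsub>N\<^esub> y)" if "x \<in> carrier N" "y \<in> carrier N" for x y
    using A.a_rcos_sum that by (simp add: quotient_module_def)
  have coset_iff: "?p x = ?p y \<longleftrightarrow> x \<oplus>\<^bsub>N\<^esub> (\<ominus>\<^bsub>N\<^esub> y) \<in> H" if "x \<in> carrier N" "y \<in> carrier N" for x y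
    using A.a_rcos_module[of y x] A.a_repr_independence'[of x y] A.a_repr_independenceD[of x y] that
    by (metis A.a_rcos_self)
  have smQ: "r \<odot>\<^bsub>?Q\<^esub> ?p x = ?p (r \<odot>\<^bsub>N\<^esub> x)" if "r \<in> carrier R" "x \<in> carrier N" for r x
  proof -
    have "?p (r \<odot>\<^bsub>N\<^esub> y) = ?p (r \<odot>\<^bsub>N\<^esub> x)" if y: "y \<in> ?p x" for y
    proof -
      have yc: "y \<in> carrier N"
        using y N.M.a_r_coset_subset_G[OF D(1)] \<open>x \<in> carrier N\<close> by blast
      have "y \<oplus>\<^bsub>N\<^esub> (\<ominus>\<^bsub>N\<^esub> x) \<in> H" using y yc \<open>x \<in> carrier N\<close> A.a_rcos_module by auto
      then have "r \<odot>\<^bsub>N\<^esub> (y \<oplus>\<^bsub>N\<^esub> (\<ominus>\<^bsub>N\<^esub> x)) \<in> H" using \<open>r \<in> carrier R\<close> by (rule_tac D)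
      then show ?thesis
        using that yc \<open>x \<in> carrier N\<close> \<open>r \<in> carrier R\<close>
        by (simp add: coset_iff N.smult_r_distr N.smult_r_minus)
    qed
    moreover have "x \<in> ?p x" using that A.a_rcos_self by simp
    ultimately have "(\<Union>y\<in>?p x. ?p (r \<odot>\<^bsub>N\<^esub> y)) = ?p (r \<odot>\<^bsub>N\<^esub> x)"
      by blast
    then show ?thesis by (simp add: quotient_module_def)
  qed
  have zQ: "\<zero>\<^bsub>?Q\<^esub> = ?p \<zero>\<^bsub>N\<^esub>"
    using D(3) A.a_rcos_const by (simp add: quotient_module_def)
  have grp: "abelian_group ?Q"
    by (rule abelian_groupI) 
       (auto simp: carr addQ zQ N.M.a_ac N.M.r_neg intro!: bexI[of _ "\<ominus>\<^bsub>N\<^esub> x" for x])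
  show m: "Module.module R ?Q"
    by (rule moduleI[OF N.R.is_cring grp])
       (auto simp: carr smQ addQ N.smult_l_distr N.smult_r_distr N.smult_assoc1)
  show "?p \<in> module_homs R N ?Q"
    by (rule module_homsI) (auto simp: carr smQ addQ)
  show "?p ` carrier N = carrier ?Q" by (simp add: carr)
  have "?p x = H \<longleftrightarrow> x \<in> H" if "x \<in> carrier N" for x
    using coset_iff[of x "\<zero>\<^bsub>N\<^esub>"] that A.a_rcos_const[OF D(3)]
    by (simp add: N.minus_eq_smult)
  then show "a_kernel N ?Q ?p = H"
    using D(1) by (auto simp: a_kernel_eq quotient_module_def)
qed

section \<open>Finite products and free modules\<close>

definition product_module :: "('r, 'a) module \<Rightarrow> 'i set \<Rightarrow> ('r, 'i \<Rightarrow> 'a) module" where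
  "product_module M I =
     \<lparr>carrier = I \<rightarrow>\<^sub>E carrier M,
      monoid.mult = undefined,
      monoid.one = undefined,
      ring.zero = (\<lambda>i\<in>I. \<zero>\<^bsub>M\<^esub>),
      ring.add = (\<lambda>x y. \<lambda>i\<in>I. x i \<oplus>\<^bsub>M\<^esub> y i),
      smult = (\<lambda>r x. \<lambda>i\<in>I. r \<odot>\<^bsub>M\<^esub> x i)\<rparr>"

lemma power_module_eq_product: "power_module M k = product_module M {..<k}"
  by (simp add: power_module_def product_module_def)

lemma product_module_simps [simp]:
  "carrier (product_module M I) = I \<rightarrow>\<^sub>E carrier M"
  "\<zero>\<^bsub>product_module M I\<^esub> = (\<lambda>i\<in>I. \<zero>\<^bsub>M\<^esub>)"
  "x \<oplus>\<^bsub>product_module M I\<^esub> y = (\<lambda>i\<in>I. x i \<oplus>\<^bsub>M\<^esub> y i)"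
  "r \<odot>\<^bsub>product_module M I\<^esub> x = (\<lambda>i\<in>I. r \<odot>\<^bsub>M\<^esub> x i)"
  by (simp_all add: product_module_def)

lemma PiE_const_mem: "x \<in> I \<rightarrow>\<^sub>E C \<Longrightarrow> i \<in> I \<Longrightarrow> x i \<in> C"
  by (rule PiE_mem)

lemma restrict_eqI:
  assumes "y \<in> I \<rightarrow>\<^sub>E C" "\<And>i. i \<in> I \<Longrightarrow> f i = y i"
  shows "restrict f I = y"
  using assms by (auto simp: restrict_def PiE_def extensional_def)

lemma module_product_module:
  assumes "Module.module R M"
  shows "Module.module R (product_module M I)"
proof -
  interpret M: Module.module R M by fact
  have "abelian_group (product_module M I)"
  proof (rule abelian_groupI)
    fix x assume x: "x \<in> carrier (product_module M I)"
    then show "\<exists>y\<in>carrier (product_module M I). y \<oplus>\<^bsub>product_module M I\<^esub> x = \<zero>\<^bsub>product_module M I\<^esub>"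
      by (intro bexI[of _ "\<lambda>i\<in>I. \<ominus>\<^bsub>M\<^esub> x i"]) (auto simp: M.M.l_neg PiE_const_mem intro!: restrict_ext)
    show "\<zero>\<^bsub>product_module M I\<^esub> \<oplus>\<^bsub>product_module M I\<^esub> x = x"
      using x by (intro PiE_ext[of _ I "\<lambda>_. carrier M"]) (auto simp: PiE_const_mem)
  qed (auto simp: PiE_const_mem M.M.a_ac intro!: restrict_ext)
  then show ?thesis
  proof (rule moduleI[OF M.R.is_cring])
    fix x assume x: "x \<in> carrier (product_module M I)"
    show "\<one>\<^bsub>R\<^esub> \<odot>\<^bsub>product_module M I\<^esub> x = x"
      using x unfolding product_module_simps by (intro restrict_eqI) (auto simp: PiE_const_mem)
  qed (auto simp: PiE_const_mem M.smult_l_distr M.smult_r_distr M.smult_assoc1 intro!: restrict_ext)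
qed

lemma proj_module_hom:
  "i \<in> I \<Longrightarrow> (\<lambda>v. v i) \<in> module_homs R (product_module M I) M"
  by (rule module_homsI) (auto simp: PiE_const_mem)

lemma tuple_module_hom:
  assumes "\<And>i. i \<in> I \<Longrightarrow> f i \<in> module_homs R A M"
  shows "(\<lambda>x. \<lambda>i\<in>I. f i x) \<in> module_homs R A (product_module M I)"
  by (rule module_homsI) (auto simp: module_homsD[OF assms] intro!: restrict_ext)

definition coord_incl :: "('r, 'a) module \<Rightarrow> 'i set \<Rightarrow> 'i \<Rightarrow> 'a \<Rightarrow> 'i \<Rightarrow> 'a" where
  "coord_incl M I i x = (\<lambda>j\<in>I. if j = i then x else \<zero>\<^bsub>M\<^esub>)"

lemma coord_incl_hom:
  assumes "Module.module R M"
  shows "coord_incl M I i \<in> module_homs R M (product_module M I)"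
proof -
  interpret M: Module.module R M by fact
  show ?thesis
    by (rule module_homsI) (auto simp: coord_incl_def intro!: restrict_ext)
qed

text \<open>
  A vector supported on a finite set of indices is assembled one coordinate at a time; over a finite
  index set this exhausts the product.
\<close>

lemma product_module_span:
  assumes M: "Module.module R M" and I: "finite I"
  shows "carrier (product_module M I) = mspan R (product_module M I) (\<Union>i\<in>I. coord_incl M I i ` carrier M)"
    (is "_ = mspan R ?P ?X")
proof
  interpret M: Module.module R M by fact
  note P = module_product_module[OF M, of I]
  have X: "?X \<subseteq> carrier ?P"
    by (intro UN_least image_subsetI module_homsD(1)[OF coord_incl_hom[OF M]])
  then show "mspan R ?P ?X \<subseteq> carrier ?P" by (rule mspan_subset_carrier[OF P])
  have "v \<in> mspan R ?P ?X"
    if "finite J" "J \<subseteq> I" "v \<in> carrier ?P" "\<forall>i\<in>I - J. v i = \<zero>\<^bsub>M\<^esub>" for J v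
    using that
  proof (induction J arbitrary: v)
    case empty
    then have v0: "\<zero>\<^bsub>?P\<^esub> = v" unfolding product_module_simps by (intro restrict_eqI) auto
    show ?case by (subst v0[symmetric]) (rule mspan.zero)
  next
    case (insert j J)
    let ?u = "\<lambda>i\<in>I. if i = j then \<zero>\<^bsub>M\<^esub> else v i"
    have v: "v i \<in> carrier M" if "i \<in> I" for i using insert.prems(2) that by (auto simp: PiE_const_mem)
    have "?u \<in> mspan R ?P ?X" using insert.prems v by (intro insert.IH) auto
    moreover have "coord_incl M I j (v j) \<in> mspan R ?P ?X"
      using insert.prems v by (intro mspan.incl) auto
    ultimately have "coord_incl M I j (v j) \<oplus>\<^bsub>?P\<^esub> ?u \<in> mspan R ?P ?X" by (rule_tac mspan.add)
    moreover have "coord_incl M I j (v j) \<oplus>\<^bsub>?P\<^esub> ?u = v"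
      using insert.prems v unfolding product_module_simps
      by (intro restrict_eqI) (auto simp: coord_incl_def)
    ultimately show ?case by simp
  qed
  from this[OF I subset_refl] show "carrier ?P \<subseteq> mspan R ?P ?X" by blast
qed

text \<open>
  The linear map out of a finite direct sum with the components \<open>g i\<close>.
\<close>

definition sum_hom :: "('r, 'b) module \<Rightarrow> 'i set \<Rightarrow> ('i \<Rightarrow> 'a \<Rightarrow> 'b) \<Rightarrow> ('i \<Rightarrow> 'a) \<Rightarrow> 'b" where
  "sum_hom N I g v = (\<Oplus>\<^bsub>N\<^esub>i\<in>I. g i (v i))"

lemma (in abelian_monoid) finsum_delta:
  assumes "finite I" "i \<in> I" "x \<in> carrier G"
  shows "(\<Oplus>j\<in>I. if j = i then x else \<zero>) = x"
proof -
  have "(\<Oplus>j\<in>I. if i = j then x else \<zero>) = x"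
    by (rule finsum_singleton[of i I "\<lambda>_. x"]) (use assms in auto)
  then show ?thesis by (simp add: eq_commute)
qed

lemma sum_hom:
  assumes "Module.module R M" "Module.module R N" "finite I"
    and "\<And>i. i \<in> I \<Longrightarrow> g i \<in> module_homs R M N"
  shows "sum_hom N I g \<in> module_homs R (product_module M I) N"
    and "\<And>i x. i \<in> I \<Longrightarrow> x \<in> carrier M \<Longrightarrow> sum_hom N I g (coord_incl M I i x) = g i x"
proof -
  interpret M: Module.module R M by fact
  interpret N: Module.module R N by fact
  note g = module_homsD[OF assms(4)]
  show "sum_hom N I g \<in> module_homs R (product_module M I) N"
  proof (rule module_homsI)
    fix v assume v: "v \<in> carrier (product_module M I)"
    then show "sum_hom N I g v \<in> carrier N"
      by (auto simp: sum_hom_def g PiE_const_mem intro!: N.M.finsum_closed)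
    { fix w assume "w \<in> carrier (product_module M I)"
      then have m: "g i (v i) \<in> carrier N" "g i (w i) \<in> carrier N" 
        "g i (v i \<oplus>\<^bsub>M\<^esub> w i) = g i (v i) \<oplus>\<^bsub>N\<^esub> g i (w i)" if "i \<in> I" for i
        using v that g[OF that] by (auto simp: PiE_const_mem)
      then have "sum_hom N I g (v \<oplus>\<^bsub>product_module M I\<^esub> w)
          = (\<Oplus>\<^bsub>N\<^esub>i\<in>I. g i (v i) \<oplus>\<^bsub>N\<^esub> g i (w i))"
        unfolding sum_hom_def by (intro N.M.finsum_cong') auto
      also have "\<dots> = sum_hom N I g v \<oplus>\<^bsub>N\<^esub> sum_hom N I g w"
        unfolding sum_hom_def using m by (intro N.M.finsum_addf) auto
      finally show "sum_hom N I g (v \<oplus>\<^bsub>product_module M I\<^esub> w) = sum_hom N I g v \<oplus>\<^bsub>N\<^esub> sum_hom N I g w" . }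
    { fix r assume "r \<in> carrier R"
      then show "sum_hom N I g (r \<odot>\<^bsub>product_module M I\<^esub> v) = r \<odot>\<^bsub>N\<^esub> sum_hom N I g v"
        using v unfolding sum_hom_def
        by (subst N.finsum_smult_ldistr) (auto simp: g PiE_const_mem assms(3) Pi_iff intro!: N.M.finsum_cong') }
  qed
  fix i x assume i: "i \<in> I" "x \<in> carrier M"
  have "sum_hom N I g (coord_incl M I i x) = (\<Oplus>\<^bsub>N\<^esub>j\<in>I. if j = i then g i x else \<zero>\<^bsub>N\<^esub>)"
    unfolding sum_hom_def coord_incl_def using i
    by (intro N.M.finsum_cong') (auto simp: g module_hom_zero[OF assms(1,2,4)])
  also have "\<dots> = g i x" by (rule N.M.finsum_delta) (use i g assms(3) in auto)
  finally show "sum_hom N I g (coord_incl M I i x) = g i x" .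
qed

lemma regular_module_simps [simp]:
  "carrier (regular_module R) = carrier R"
  "\<zero>\<^bsub>regular_module R\<^esub> = \<zero>\<^bsub>R\<^esub>"
  "x \<oplus>\<^bsub>regular_module R\<^esub> y = x \<oplus>\<^bsub>R\<^esub> y"
  "r \<odot>\<^bsub>regular_module R\<^esub> x = r \<otimes>\<^bsub>R\<^esub> x"
  by (simp_all add: regular_module_def)

lemma module_regular_module:
  assumes "cring R"
  shows "Module.module R (regular_module R)"
proof -
  interpret R: cring R by fact
  have "abelian_group (regular_module R)"
    by (rule abelian_groupI) (auto simp: R.a_ac intro!: bexI[of _ "\<ominus>\<^bsub>R\<^esub> x" for x] R.r_neg)
  then show ?thesis
    by (rule moduleI[OF assms]) (auto simp: R.l_distr R.r_distr R.m_assoc)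
qed

abbreviation free :: "'r ring \<Rightarrow> 'i set \<Rightarrow> ('r, 'i \<Rightarrow> 'r) module" where
  "free R I \<equiv> product_module (regular_module R) I"

abbreviation vecs :: "'r ring \<Rightarrow> nat \<Rightarrow> ('r, nat \<Rightarrow> 'r) module" where
  "vecs R n \<equiv> free R {..<n}"

definition unit_vec :: "'r ring \<Rightarrow> 'i set \<Rightarrow> 'i \<Rightarrow> 'i \<Rightarrow> 'r" where
  "unit_vec R I i = coord_incl (regular_module R) I i \<one>\<^bsub>R\<^esub>"

lemma module_free_module: "cring R \<Longrightarrow> Module.module R (free R I)"
  by (intro module_product_module module_regular_module)

lemma unit_vec_closed:
  assumes "cring R"
  shows "unit_vec R I i \<in> carrier (free R I)"
proof -
  interpret R: cring R by fact
  show ?thesis by (auto simp: unit_vec_def coord_incl_def)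
qed

lemma free_module_span:
  assumes R: "cring R" and I: "finite I"
  shows "carrier (free R I) = mspan R (free R I) (unit_vec R I ` I)"
proof
  interpret R: cring R by fact
  note P = module_free_module[OF R, of I]
  have "coord_incl (regular_module R) I i r \<in> mspan R (free R I) (unit_vec R I ` I)"
    if "i \<in> I" "r \<in> carrier R" for i r
  proof -
    have "r \<odot>\<^bsub>free R I\<^esub> unit_vec R I i \<in> mspan R (free R I) (unit_vec R I ` I)"
      using that by (intro mspan.smult mspan.incl) auto
    also have "r \<odot>\<^bsub>free R I\<^esub> unit_vec R I i = coord_incl (regular_module R) I i r"
      using that by (auto simp: unit_vec_def coord_incl_def intro!: restrict_ext)
    finally show ?thesis .
  qed
  then show "carrier (free R I) \<subseteq> mspan R (free R I) (unit_vec R I ` I)"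
    unfolding product_module_span[OF module_regular_module[OF R] I]
    by (intro mspan_subset_mspan) auto
  show "mspan R (free R I) (unit_vec R I ` I) \<subseteq> carrier (free R I)"
    by (intro mspan_subset_carrier P image_subsetI unit_vec_closed R)
qed

definition lincomb :: "('r, 'b) module \<Rightarrow> 'i set \<Rightarrow> ('i \<Rightarrow> 'b) \<Rightarrow> ('i \<Rightarrow> 'r) \<Rightarrow> 'b" where
  "lincomb N I w = sum_hom N I (\<lambda>i r. r \<odot>\<^bsub>N\<^esub> w i)"

lemma smult_module_hom:
  assumes "Module.module R N" "x \<in> carrier N"
  shows "(\<lambda>r. r \<odot>\<^bsub>N\<^esub> x) \<in> module_homs R (regular_module R) N"
proof -
  interpret N: Module.module R N by fact
  show ?thesis
    using assms(2) by (intro module_homsI) (auto simp: N.smult_l_distr N.smult_assoc1)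
qed

lemma lincomb:
  assumes N: "Module.module R N" and I: "finite I" and w: "\<And>i. i \<in> I \<Longrightarrow> w i \<in> carrier N"
  shows "lincomb N I w \<in> module_homs R (free R I) N"
    and "\<And>i. i \<in> I \<Longrightarrow> lincomb N I w (unit_vec R I i) = w i"
    and "lincomb N I w ` carrier (free R I) = mspan R N (w ` I)"
proof -
  interpret N: Module.module R N by fact
  have R: "cring R" by (rule N.R.is_cring)
  note s = sum_hom[OF module_regular_module[OF R] N I, of "\<lambda>i r. r \<odot>\<^bsub>N\<^esub> w i",
      OF smult_module_hom[OF N w], folded lincomb_def]
  show h: "lincomb N I w \<in> module_homs R (free R I) N"
    using s by blast
  show u: "lincomb N I w (unit_vec R I i) = w i" if "i \<in> I" for i
    using that s(2)[of i "\<one>\<^bsub>R\<^esub>"] w by (simp add: unit_vec_def)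
  have "unit_vec R I ` I \<subseteq> carrier (free R I)"
    by (intro image_subsetI unit_vec_closed R)
  from hom_image_mspan[OF module_free_module[OF R] N h this]
  have "lincomb N I w ` carrier (free R I) = mspan R N (lincomb N I w ` unit_vec R I ` I)"
    unfolding free_module_span[OF R I, symmetric] .
  also have "lincomb N I w ` unit_vec R I ` I = w ` I" by (simp add: u image_image cong: image_cong)
  finally show "lincomb N I w ` carrier (free R I) = mspan R N (w ` I)" .
qed

lemma free_hom_eqI:
  assumes "Module.module R N" "finite I"
    and "f \<in> module_homs R (free R I) N" "g \<in> module_homs R (free R I) N"
    and "\<And>i. i \<in> I \<Longrightarrow> f (unit_vec R I i) = g (unit_vec R I i)"
    and "v \<in> carrier (free R I)"
  shows "f v = g v"
proof -
  interpret N: Module.module R N by fact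
  have R: "cring R" by (rule N.R.is_cring)
  show ?thesis
  proof (rule hom_eq_on_mspan[OF module_free_module[OF R] assms(1,3,4)])
    show "unit_vec R I ` I \<subseteq> carrier (free R I)"
      by (intro image_subsetI unit_vec_closed R)
    show "v \<in> mspan R (free R I) (unit_vec R I ` I)"
      using assms(6) unfolding free_module_span[OF R assms(2)] .
  qed (auto simp: assms(5))
qed

text \<open>
  Free modules are projective: the values on unit vectors can be lifted one by one.
\<close>

lemma free_lift:
  assumes "Module.module R A" "Module.module R B" "finite I"
    and p: "p \<in> module_homs R A B" "p ` carrier A = carrier B"
    and g: "g \<in> module_homs R (free R I) B"
  obtains h where "h \<in> module_homs R (free R I) A"
    "\<And>v. v \<in> carrier (free R I) \<Longrightarrow> p (h v) = g v"
proof -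
  interpret A: Module.module R A by fact
  have R: "cring R" by (rule A.R.is_cring)
  have "\<forall>i. \<exists>a. a \<in> carrier A \<and> p a = g (unit_vec R I i)"
    using module_homsD(1)[OF g unit_vec_closed[OF R]] p(2) by (metis imageE)
  then obtain w where w: "\<And>i. w i \<in> carrier A" "\<And>i. p (w i) = g (unit_vec R I i)" by metis
  note l = lincomb[OF assms(1,3), of w, OF w(1)]
  show ?thesis
  proof (rule that[OF l(1)])
    fix v assume "v \<in> carrier (free R I)"
    then show "p (lincomb A I w v) = g v"
      by (rule free_hom_eqI[OF assms(2,3) module_homs_comp[OF l(1) p(1)] g, rotated]) (simp add: l(2) w)
  qed
qed

section \<open>Finite generation and finite presentation\<close>

definition fin_gen :: "'r ring \<Rightarrow> ('r, 'a) module \<Rightarrow> 'a set \<Rightarrow> bool" where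
  "fin_gen R N H \<longleftrightarrow> (\<exists>X. finite X \<and> X \<subseteq> carrier N \<and> H = mspan R N X)"

lemma fin_genI: "finite X \<Longrightarrow> X \<subseteq> carrier N \<Longrightarrow> fin_gen R N (mspan R N X)"
  by (auto simp: fin_gen_def)

lemma fin_gen_submodule: "Module.module R N \<Longrightarrow> fin_gen R N H \<Longrightarrow> submodule H R N"
  by (auto simp: fin_gen_def submodule_mspan)

lemma fin_gen_image:
  assumes "Module.module R A" "Module.module R B" "f \<in> module_homs R A B" "fin_gen R A H"
  shows "fin_gen R B (f ` H)"
proof -
  obtain X where X: "finite X" "X \<subseteq> carrier A" "H = mspan R A X" using assms(4) by (auto simp: fin_gen_def)
  have "f ` X \<subseteq> carrier B" using X(2) module_homsD(1)[OF assms(3)] by blast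
  then show ?thesis using X(1) unfolding X(3) hom_image_mspan[OF assms(1-3) X(2)] by (intro fin_genI) auto
qed

lemma fin_gen_free_module:
  assumes "cring R" "finite I"
  shows "fin_gen R (free R I) (carrier (free R I))"
  unfolding free_module_span[OF assms]
  by (intro fin_genI finite_imageI assms(2) image_subsetI unit_vec_closed assms(1))

lemma fin_gen_cover:
  assumes "Module.module R N" "fin_gen R N H"
  obtains d :: nat and h where "h \<in> module_homs R (vecs R d) N"
    "h ` carrier (vecs R d) = H"
proof -
  obtain X where X: "finite X" "X \<subseteq> carrier N" "H = mspan R N X" using assms(2) by (auto simp: fin_gen_def)
  obtain w where w: "bij_betw w {..<card X} X"
    using ex_bij_betw_nat_finite[OF X(1)] by (auto simp: atLeast0LessThan)
  then have wX: "w ` {..<card X} = X" by (rule bij_betw_imp_surj_on)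
  then have wc: "w i \<in> carrier N" if "i \<in> {..<card X}" for i using that X(2) by blast
  note l = lincomb[OF assms(1) finite_lessThan, of "card X" w, OF wc]
  show ?thesis using l(1,3) that[of "lincomb N {..<card X} w" "card X"] X(3) wX by simp
qed

text \<open>
  Two elements with the same image differ by an element of the kernel, so generators of the kernel
  together with lifts of generators of \<open>H\<close> generate the preimage.
\<close>

lemma fin_gen_preimage:
  assumes A: "Module.module R A" and B: "Module.module R B" and f: "f \<in> module_homs R A B"
    and ker: "fin_gen R A (a_kernel A B f)" and H: "fin_gen R B H" "H \<subseteq> f ` carrier A"
  shows "fin_gen R A {x \<in> carrier A. f x \<in> H}"
proof -
  interpret A: Module.module R A by fact
  interpret B: Module.module R B by fact
  obtain X where X: "finite X" "X \<subseteq> carrier A" "a_kernel A B f = mspan R A X"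
    using ker by (auto simp: fin_gen_def)
  obtain Y where Y: "finite Y" "Y \<subseteq> carrier B" "H = mspan R B Y" using H(1) by (auto simp: fin_gen_def)
  have "Y \<subseteq> f ` carrier A" using H(2) mspan_superset[of Y R B] unfolding Y(3) by (rule subset_trans[rotated])
  then obtain Z where Z: "finite Z" "Z \<subseteq> carrier A" "Y = f ` Z"
    using Y(1) by (meson finite_subset_image)
  have HZ: "H = f ` mspan R A Z" using hom_image_mspan[OF A B f Z(2)] Y(3) Z(3) by simp
  have sub: "submodule {x \<in> carrier A. f x \<in> H} R A"
    by (rule submodule_preimage[OF A B f fin_gen_submodule[OF B H(1)]])
  have XZ: "X \<subseteq> {x \<in> carrier A. f x \<in> H}"
  proof
    fix x assume x: "x \<in> X"
    then have "x \<in> a_kernel A B f" unfolding X(3) by (rule mspan.incl)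
    then show "x \<in> {x \<in> carrier A. f x \<in> H}"
      using submoduleD(3)[OF B fin_gen_submodule[OF B H(1)]] by (simp add: a_kernel_eq)
  qed
  have "{x \<in> carrier A. f x \<in> H} = mspan R A (X \<union> Z)"
  proof (rule mspan_eqI[OF A sub])
    show "X \<union> Z \<subseteq> {x \<in> carrier A. f x \<in> H}"
      using XZ Z(2) mspan_superset[of Z R A] unfolding HZ by auto
    show "{x \<in> carrier A. f x \<in> H} \<subseteq> mspan R A (X \<union> Z)"
    proof
      fix x assume "x \<in> {x \<in> carrier A. f x \<in> H}"
      then have x: "x \<in> carrier A" "f x \<in> f ` mspan R A Z" unfolding HZ by auto
      then obtain z where z: "z \<in> mspan R A Z" "f x = f z" by blast
      have zc: "z \<in> carrier A" using z(1) mspan_subset_carrier[OF A Z(2)] by blast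
      have "x \<ominus>\<^bsub>A\<^esub> z \<in> mspan R A X" using z(2) x(1) zc hom_image_eq_iff[OF A B f] X(3) by blast
      then have "(x \<ominus>\<^bsub>A\<^esub> z) \<oplus>\<^bsub>A\<^esub> z \<in> mspan R A (X \<union> Z)"
        using z(1) mspan_mono[of X "X \<union> Z" R A] mspan_mono[of Z "X \<union> Z" R A] by (intro mspan.add) auto
      moreover have "(x \<ominus>\<^bsub>A\<^esub> z) \<oplus>\<^bsub>A\<^esub> z = x"
        using x(1) zc by (simp add: A.M.minus_eq A.M.a_assoc A.M.l_neg)
      ultimately show "x \<in> mspan R A (X \<union> Z)" by simp
    qed
  qed
  then show ?thesis using X Z by (simp add: fin_genI)
qed

lemma fin_gen_singleton_zero:
  assumes "Module.module R N" shows "fin_gen R N {\<zero>\<^bsub>N\<^esub>}"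
proof -
  have "{\<zero>\<^bsub>N\<^esub>} = mspan R N {}"
    by (rule mspan_eqI[OF assms submodule_zero[OF assms]]) (auto intro: mspan.zero)
  then show ?thesis using fin_genI[of "{}" N R] by simp
qed

text \<open>
  The left map of a presentation only enters through its image, an arbitrary finitely generated
  submodule.
\<close>

lemma finitely_presented_iff:
  "finitely_presented R N \<longleftrightarrow> Module.module R N \<and>
     (\<exists>q::nat. \<exists>f\<in>module_homs R (vecs R q) N.
        f ` carrier (vecs R q) = carrier N \<and>
        fin_gen R (vecs R q) (a_kernel (vecs R q) N f))"
proof (cases "Module.module R N")
  case True
  interpret N: Module.module R N by fact
  have R: "cring R" by (rule N.R.is_cring)
  note F = module_free_module[OF R]
  have fg: "(\<exists>p::nat. \<exists>g\<in>module_homs R (vecs R p) (vecs R q).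
         g ` carrier (vecs R p) = H) \<longleftrightarrow> fin_gen R (vecs R q) H" for q :: nat and H
  proof
    assume "fin_gen R (vecs R q) H"
    from fin_gen_cover[OF F this] show "\<exists>p::nat. \<exists>g\<in>module_homs R (vecs R p) (vecs R q).
         g ` carrier (vecs R p) = H" by metis
  next
    assume "\<exists>p::nat. \<exists>g\<in>module_homs R (vecs R p) (vecs R q).
         g ` carrier (vecs R p) = H"
    then obtain p :: nat and g where g: "g\<in>module_homs R (vecs R p) (vecs R q)"
      "g ` carrier (vecs R p) = H" by blast
    from fin_gen_image[OF F F g(1) fin_gen_free_module[OF R]] g(2)
    show "fin_gen R (vecs R q) H" by (simp only: finite_lessThan)
  qed
  show ?thesis
    unfolding finitely_presented_def exact_at_def power_module_eq_product fg[symmetric] by blast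
qed (simp add: finitely_presented_def)

lemma finitely_presented_module: "finitely_presented R N \<Longrightarrow> Module.module R N"
  by (simp add: finitely_presented_def)

lemma finitely_presentedE:
  assumes "finitely_presented R N"
  obtains q f where "f \<in> module_homs R (vecs R q) N"
    "f ` carrier (vecs R q) = carrier N"
    "fin_gen R (vecs R q) (a_kernel (vecs R q) N f)"
  using assms unfolding finitely_presented_iff by blast

text \<open>
  Schanuel's argument: two presentations can be compared by lifting their identity map in both
  directions, so finite generation of the relations does not depend on the chosen generators.
\<close>

lemma finitely_presented_kernel:
  assumes N: "finitely_presented R N" and I: "finite I"
    and f': "f' \<in> module_homs R (free R I) N" "f' ` carrier (free R I) = carrier N"
  shows "fin_gen R (free R I) (a_kernel (free R I) N f')"
proof -
  have mN: "Module.module R N" by (rule finitely_presented_module[OF N])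
  interpret N: Module.module R N by fact
  have R: "cring R" by (rule N.R.is_cring)
  obtain q f where f: "f \<in> module_homs R (vecs R q) N"
    "f ` carrier (vecs R q) = carrier N"
    "fin_gen R (vecs R q) (a_kernel (vecs R q) N f)"
    by (rule finitely_presentedE[OF N])
  let ?A = "free R I" let ?B = "vecs R q"
  have A: "Module.module R ?A" and B: "Module.module R ?B" by (rule module_free_module[OF R])+
  interpret A: Module.module R ?A by fact
  obtain a where a: "a \<in> module_homs R ?A ?B" "\<And>v. v \<in> carrier ?A \<Longrightarrow> f (a v) = f' v"
    by (rule free_lift[OF B mN I f(1,2) f'(1)]) (rule that)
  obtain b where b: "b \<in> module_homs R ?B ?A" "\<And>v. v \<in> carrier ?B \<Longrightarrow> f' (b v) = f v"
    by (rule free_lift[OF A mN finite_lessThan f'(1,2) f(1)]) (rule that)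
  note ac = module_homsD(1)[OF a(1)] note bc = module_homsD(1)[OF b(1)]
  \<comment> \<open>\<open>c\<close> measures the failure of the two lifts to be inverse to each other; it takes values in the kernel.\<close>
  define c where "c v = v \<ominus>\<^bsub>?A\<^esub> b (a v)" for v
  have ba: "(\<lambda>v. b (a v)) \<in> module_homs R ?A ?A" by (rule module_homs_comp[OF a(1) b(1)])
  have c: "c \<in> module_homs R ?A ?A"
    unfolding c_def[abs_def] by (rule module_homs_minus[OF A A module_homs_ident ba])
  have "a_kernel ?A N f' = mspan R ?A (b ` a_kernel ?B N f \<union> c ` carrier ?A)"
  proof (rule mspan_eqI[OF A submodule_kernel[OF A mN f'(1)]])
    show "b ` a_kernel ?B N f \<union> c ` carrier ?A \<subseteq> a_kernel ?A N f'"
    proof (intro Un_least image_subsetI)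
      fix x assume "x \<in> a_kernel ?B N f"
      then show "b x \<in> a_kernel ?A N f'" unfolding a_kernel_eq using bc b(2) by auto
    next
      fix x assume x: "x \<in> carrier ?A"
      have "f' (b (a x)) = f' x" using x a(2) b(2) ac by simp
      then have "f' x = f' (b (a x))" by simp
      then show "c x \<in> a_kernel ?A N f'"
        unfolding c_def using hom_image_eq_iff[OF A mN f'(1) x bc[OF ac[OF x]]] by blast
    qed
    show "a_kernel ?A N f' \<subseteq> mspan R ?A (b ` a_kernel ?B N f \<union> c ` carrier ?A)"
    proof
      fix x assume "x \<in> a_kernel ?A N f'"
      then have x: "x \<in> carrier ?A" "f' x = \<zero>\<^bsub>N\<^esub>" unfolding a_kernel_eq by auto
      then have "a x \<in> a_kernel ?B N f" unfolding a_kernel_eq using ac a(2) by auto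
      then have "c x \<oplus>\<^bsub>?A\<^esub> b (a x) \<in> mspan R ?A (b ` a_kernel ?B N f \<union> c ` carrier ?A)"
        using x(1) by (intro mspan.add mspan.incl) auto
      moreover have "c x \<oplus>\<^bsub>?A\<^esub> b (a x) = x"
        unfolding c_def A.M.minus_eq using x(1) bc[OF ac[OF x(1)]]
        by (simp only: A.M.a_assoc A.M.l_neg A.M.r_zero A.M.a_inv_closed)
      ultimately show "x \<in> mspan R ?A (b ` a_kernel ?B N f \<union> c ` carrier ?A)" by (simp only:)
    qed
  qed
  moreover obtain X where X: "finite X" "X \<subseteq> carrier ?A" "b ` a_kernel ?B N f = mspan R ?A X"
    using fin_gen_image[OF B A b(1) f(3)] unfolding fin_gen_def by blast
  moreover obtain Y where Y: "finite Y" "Y \<subseteq> carrier ?A" "c ` carrier ?A = mspan R ?A Y"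
    using fin_gen_image[OF A A c fin_gen_free_module[OF R I]] unfolding fin_gen_def by blast
  moreover have "mspan R ?A (mspan R ?A X \<union> mspan R ?A Y) = mspan R ?A (X \<union> Y)"
  proof
    show "mspan R ?A (mspan R ?A X \<union> mspan R ?A Y) \<subseteq> mspan R ?A (X \<union> Y)"
      by (intro mspan_subset_mspan Un_least mspan_mono) auto
    show "mspan R ?A (X \<union> Y) \<subseteq> mspan R ?A (mspan R ?A X \<union> mspan R ?A Y)"
      by (intro mspan_mono Un_mono mspan_superset)
  qed
  ultimately show ?thesis using fin_genI[of "X \<union> Y" ?A R] by (simp only: finite_Un Un_least)
qed

lemma finitely_presentedI:
  assumes "Module.module R N" "f \<in> module_homs R (vecs R q) N"
    "f ` carrier (vecs R q) = carrier N"
    "fin_gen R (vecs R q) (a_kernel (vecs R q) N f)"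
  shows "finitely_presented R N"
  using assms unfolding finitely_presented_iff by blast

lemma finitely_presented_quotient:
  assumes N: "finitely_presented R N" and H: "fin_gen R N H"
  shows "finitely_presented R (quotient_module N H)"
proof -
  have mN: "Module.module R N" by (rule finitely_presented_module[OF N])
  interpret N: Module.module R N by fact
  have R: "cring R" by (rule N.R.is_cring)
  obtain q f where f: "f \<in> module_homs R (vecs R q) N"
    "f ` carrier (vecs R q) = carrier N"
    "fin_gen R (vecs R q) (a_kernel (vecs R q) N f)"
    by (rule finitely_presentedE[OF N])
  let ?A = "vecs R q"
  note Q = quotient_module[OF mN fin_gen_submodule[OF mN H]]
  have HN: "H \<subseteq> carrier N" by (rule submoduleD(1)[OF mN fin_gen_submodule[OF mN H]])
  show ?thesis
  proof (rule finitely_presentedI[OF Q(1) module_homs_comp[OF f(1) Q(2)]])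
    show "(\<lambda>x. H +>\<^bsub>N\<^esub> f x) ` carrier ?A = carrier (quotient_module N H)"
      using Q(3) f(2) by (metis image_image)
    have "a_kernel ?A (quotient_module N H) (\<lambda>x. H +>\<^bsub>N\<^esub> f x) = {x \<in> carrier ?A. f x \<in> H}"
      using Q(4) module_homsD(1)[OF f(1)] unfolding a_kernel_eq by blast
    then show "fin_gen R ?A (a_kernel ?A (quotient_module N H) (\<lambda>x. H +>\<^bsub>N\<^esub> f x))"
      using fin_gen_preimage[OF module_free_module[OF R] mN f(1,3) H] HN f(2) by (simp only:)
  qed
qed

section \<open>Coherent rings\<close>

text \<open>
  The preimage of the image of \<open>g\<close> under \<open>f\<close> is the projection of the kernel of \<open>(v, w) \<mapsto> f v - g w\<close>.
  In this way conditions modulo a finitely generated submodule become linear equations, at the cost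
  of more unknowns; the disjoint sum of index sets stands for the direct sum of free modules.
\<close>

definition left_part :: "'i set \<Rightarrow> ('i + 'j \<Rightarrow> 'r) \<Rightarrow> 'i \<Rightarrow> 'r" where
  "left_part I v = (\<lambda>i\<in>I. v (Inl i))"

definition right_part :: "'j set \<Rightarrow> ('i + 'j \<Rightarrow> 'r) \<Rightarrow> 'j \<Rightarrow> 'r" where
  "right_part J v = (\<lambda>j\<in>J. v (Inr j))"

lemma part_homs:
  "left_part I \<in> module_homs R (free R (I <+> J)) (free R I)"
  "right_part J \<in> module_homs R (free R (I <+> J)) (free R J)"
  unfolding left_part_def[abs_def] right_part_def[abs_def]
  by (intro tuple_module_hom proj_module_hom; auto)+

lemma parts_surj:
  assumes "v \<in> carrier (free R I)" "w \<in> carrier (free R J)"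
  obtains u where "u \<in> carrier (free R (I <+> J))" "left_part I u = v" "right_part J u = w"
proof
  let ?u = "\<lambda>k\<in>I <+> J. case k of Inl i \<Rightarrow> v i | Inr j \<Rightarrow> w j"
  show "?u \<in> carrier (free R (I <+> J))" using assms by (auto simp: PiE_const_mem)
  show "left_part I ?u = v" using assms(1) unfolding left_part_def product_module_simps
    by (intro restrict_eqI) auto
  show "right_part J ?u = w" using assms(2) unfolding right_part_def product_module_simps
    by (intro restrict_eqI) auto
qed

lemma preimage_eq_image_kernel:
  assumes "Module.module R B" "f \<in> module_homs R (free R I) B" "g \<in> module_homs R (free R J) B"
  shows "(\<lambda>v. f (left_part I v) \<ominus>\<^bsub>B\<^esub> g (right_part J v)) \<in> module_homs R (free R (I <+> J)) B" (is "?h \<in> _")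
    and "{v \<in> carrier (free R I). f v \<in> g ` carrier (free R J)} =
      left_part I ` a_kernel (free R (I <+> J)) B (\<lambda>v. f (left_part I v) \<ominus>\<^bsub>B\<^esub> g (right_part J v))"
    (is "?L = ?R")
proof -
  interpret B: Module.module R B by fact
  have R: "cring R" by (rule B.R.is_cring)
  show "?h \<in> module_homs R (free R (I <+> J)) B"
    by (intro module_homs_minus module_free_module R assms(1) module_homs_comp[OF part_homs(1) assms(2)]
        module_homs_comp[OF part_homs(2) assms(3)])
  show "?L = ?R"
  proof
    show "?L \<subseteq> ?R"
    proof
      fix v assume "v \<in> ?L"
      then obtain w where v: "v \<in> carrier (free R I)" and w: "w \<in> carrier (free R J)" "f v = g w"
        by blast
      obtain u where u: "u \<in> carrier (free R (I <+> J))" "left_part I u = v" "right_part J u = w"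
        using parts_surj[OF v w(1)] .
      have "?h u = \<zero>\<^bsub>B\<^esub>"
        using w u module_homsD(1)[OF assms(3) w(1)] by (simp add: B.M.minus_eq_zero_iff)
      then show "v \<in> ?R" using u unfolding a_kernel_eq by blast
    qed
    show "?R \<subseteq> ?L"
    proof (rule image_subsetI)
      fix u assume "u \<in> a_kernel (free R (I <+> J)) B ?h"
      then have u: "u \<in> carrier (free R (I <+> J))" "?h u = \<zero>\<^bsub>B\<^esub>" unfolding a_kernel_eq by auto
      have l: "left_part I u \<in> carrier (free R I)" and r: "right_part J u \<in> carrier (free R J)"
        using module_homsD(1)[OF part_homs(1) u(1)] module_homsD(1)[OF part_homs(2) u(1)] by auto
      have "f (left_part I u) = g (right_part J u)"
        using u(2) module_homsD(1)[OF assms(2) l] module_homsD(1)[OF assms(3) r] by (simp add: B.M.minus_eq_zero_iff)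
      then show "left_part I u \<in> ?L" using l r by blast
    qed
  qed
qed

lemma coherent_ring_cring: "coherent_ring R \<Longrightarrow> cring R"
  by (simp add: coherent_ring_def)

lemma submodule_regular_iff_ideal:
  assumes "cring R"
  shows "submodule H R (regular_module R) \<longleftrightarrow> ideal H R"
proof -
  interpret R: cring R by fact
  show ?thesis
  proof
    assume H: "submodule H R (regular_module R)"
    note D = submoduleD[OF module_regular_module[OF assms] H]
    show "ideal H R"
    proof (rule idealI)
      show "ring R" by (rule R.ring_axioms)
      show "subgroup H (add_monoid R)"
      proof (rule R.add.subgroupI)
        fix a assume "a \<in> H"
        then show "\<ominus>\<^bsub>R\<^esub> a \<in> H" using D(2,6)[of a] D(6)[of "\<ominus>\<^bsub>R\<^esub> \<one>\<^bsub>R\<^esub>" a]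
          by (simp add: R.l_minus)
      qed (use D in auto)
      fix a x assume "a \<in> H" "x \<in> carrier R"
      then show "x \<otimes>\<^bsub>R\<^esub> a \<in> H" "a \<otimes>\<^bsub>R\<^esub> x \<in> H" using D(2,6) by (auto simp: R.m_comm[of a x])
    qed
  next
    assume "ideal H R"
    then interpret H: ideal H R .
    show "submodule H R (regular_module R)"
      by (rule submodule_if_closed[OF module_regular_module[OF assms]])
        (auto simp: H.a_subset H.I_l_closed)
  qed
qed

lemma genideal_eq_mspan:
  assumes "cring R" "A \<subseteq> carrier R"
  shows "genideal R A = mspan R (regular_module R) A"
proof -
  interpret R: cring R by fact
  note M = module_regular_module[OF assms(1)]
  show ?thesis
  proof
    show "genideal R A \<subseteq> mspan R (regular_module R) A"
      using assms submodule_mspan[OF M, of A]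
      by (intro R.genideal_minimal mspan_superset) (simp_all add: submodule_regular_iff_ideal)
    show "mspan R (regular_module R) A \<subseteq> genideal R A"
      using assms R.genideal_ideal R.genideal_self
      by (intro mspan_least[OF M]) (simp_all add: submodule_regular_iff_ideal)
  qed
qed

text \<open>
  The image of the functional is a finitely generated ideal, so coherence makes its relations
  finitely generated.
\<close>

lemma coherent_functional_kernel:
  assumes "coherent_ring R" "finite I" and g: "g \<in> module_homs R (free R I) (regular_module R)"
  shows "fin_gen R (free R I) (a_kernel (free R I) (regular_module R) g)"
proof -
  have R: "cring R" by (rule coherent_ring_cring[OF assms(1)])
  interpret R: cring R by fact
  note M = module_regular_module[OF R] note F = module_free_module[OF R, of I]
  let ?w = "g ` unit_vec R I ` I"
  have u: "unit_vec R I ` I \<subseteq> carrier (free R I)" by (intro image_subsetI unit_vec_closed R)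
  have w: "?w \<subseteq> carrier R" using u module_homsD(1)[OF g] by (auto simp del: product_module_simps)
  have im: "g ` carrier (free R I) = genideal R ?w"
    unfolding genideal_eq_mspan[OF R w] hom_image_mspan[OF F M g u, symmetric] free_module_span[OF R assms(2), symmetric] ..
  have "finitely_presented R ((regular_module R)\<lparr>carrier := genideal R ?w\<rparr>)"
    using assms(1,2) w by (simp add: coherent_ring_def)
  moreover have "g \<in> module_homs R (free R I) ((regular_module R)\<lparr>carrier := genideal R ?w\<rparr>)"
    using im by (intro module_homs_into_submodule[OF g]) simp
  ultimately have "fin_gen R (free R I) (a_kernel (free R I) ((regular_module R)\<lparr>carrier := genideal R ?w\<rparr>) g)"
    using im by (intro finitely_presented_kernel assms(2)) simp_all
  then show ?thesis by (simp add: a_kernel_eq)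
qed

text \<open>
  Kernels of several maps are cut out one map at a time: each further map is restricted along a
  finite parametrisation of the joint kernel found so far.
\<close>

lemma fin_gen_joint_kernel:
  assumes A: "Module.module R A" and B: "Module.module R B" and J: "finite J"
    and ker: "\<And>d g. g \<in> module_homs R (vecs R d) B \<Longrightarrow>
                fin_gen R (vecs R d) (a_kernel (vecs R d) B g)"
    and fgA: "fin_gen R A (carrier A)" and h: "\<And>j. j \<in> J \<Longrightarrow> h j \<in> module_homs R A B"
  shows "fin_gen R A {v \<in> carrier A. \<forall>j\<in>J. h j v = \<zero>\<^bsub>B\<^esub>}"
  using J h
proof induction
  case empty
  then show ?case using fgA by simp
next
  case (insert j J)
  interpret A: Module.module R A by fact
  let ?Z = "{v \<in> carrier A. \<forall>j\<in>J. h j v = \<zero>\<^bsub>B\<^esub>}"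
  \<comment> \<open>The solutions found so far are parametrised by \<open>w\<close>; the new condition becomes a kernel on the parameters.\<close>
  have fgZ: "fin_gen R A ?Z" by (rule insert.IH) (simp add: insert.prems)
  obtain d :: nat and w where w: "w \<in> module_homs R (vecs R d) A"
    "w ` carrier (vecs R d) = ?Z" by (rule fin_gen_cover[OF A fgZ])
  have hj: "h j \<in> module_homs R A B" by (simp add: insert.prems)
  let ?F = "vecs R d"
  have "fin_gen R A (w ` a_kernel ?F B (\<lambda>v. h j (w v)))"
    by (rule fin_gen_image[OF module_free_module[OF A.R.is_cring] A w(1) ker[OF module_homs_comp[OF w(1) hj]]])
  moreover have "w ` a_kernel ?F B (\<lambda>v. h j (w v)) = {v \<in> ?Z. h j v = \<zero>\<^bsub>B\<^esub>}"
    unfolding a_kernel_eq w(2)[symmetric] by (rule image_Collect_comp)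
  moreover have "{v \<in> ?Z. h j v = \<zero>\<^bsub>B\<^esub>} = {v \<in> carrier A. \<forall>j\<in>insert j J. h j v = \<zero>\<^bsub>B\<^esub>}"
    by (simp add: conj_ac cong: conj_cong)
  ultimately show ?case by (simp only:)
qed

lemma coherent_free_kernel:
  assumes "coherent_ring R" "finite I" "finite J" and g: "g \<in> module_homs R (free R I) (free R J)"
  shows "fin_gen R (free R I) (a_kernel (free R I) (free R J) g)"
proof -
  have R: "cring R" by (rule coherent_ring_cring[OF assms(1)])
  have "fin_gen R (free R I) {v \<in> carrier (free R I). \<forall>j\<in>J. g v j = \<zero>\<^bsub>regular_module R\<^esub>}"
    by (intro fin_gen_joint_kernel module_free_module module_regular_module R assms(3)
        coherent_functional_kernel assms(1) finite_lessThan fin_gen_free_module assms(2)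
        module_homs_comp[OF g] proj_module_hom)
  moreover have "g v = \<zero>\<^bsub>free R J\<^esub> \<longleftrightarrow> (\<forall>j\<in>J. g v j = \<zero>\<^bsub>regular_module R\<^esub>)"
    if "v \<in> carrier (free R I)" for v
  proof
    assume *: "\<forall>j\<in>J. g v j = \<zero>\<^bsub>regular_module R\<^esub>"
    have "\<zero>\<^bsub>free R J\<^esub> = g v"
      using * module_homsD(1)[OF g that] unfolding product_module_simps by (intro restrict_eqI) auto
    then show "g v = \<zero>\<^bsub>free R J\<^esub>" by (rule sym)
  qed simp
  then have "a_kernel (free R I) (free R J) g = 
     {v \<in> carrier (free R I). \<forall>j\<in>J. g v j = \<zero>\<^bsub>regular_module R\<^esub>}"
    unfolding a_kernel_eq by blast
  ultimately show ?thesis by (simp only:)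
qed

text \<open>
  Lifted to a presentation of \<open>P\<close>, the condition \<open>g v = 0\<close> says that a vector lies in the finitely
  generated module of relations.
\<close>

lemma coherent_kernel:
  assumes coh: "coherent_ring R" and P: "finitely_presented R P" and I: "finite I"
    and g: "g \<in> module_homs R (free R I) P"
  shows "fin_gen R (free R I) (a_kernel (free R I) P g)"
proof -
  have R: "cring R" by (rule coherent_ring_cring[OF coh])
  have mP: "Module.module R P" by (rule finitely_presented_module[OF P])
  obtain q f where f: "f \<in> module_homs R (vecs R q) P"
    "f ` carrier (vecs R q) = carrier P"
    "fin_gen R (vecs R q) (a_kernel (vecs R q) P f)"
    by (rule finitely_presentedE[OF P])
  note F = module_free_module[OF R]
  obtain g' where g': "g' \<in> module_homs R (free R I) (vecs R q)"
    "\<And>v. v \<in> carrier (free R I) \<Longrightarrow> f (g' v) = g v"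
    by (rule free_lift[OF F mP I f(1,2) g]) (rule that)
  obtain d :: nat and w where w: "w \<in> module_homs R (vecs R d) (vecs R q)"
    "w ` carrier (vecs R d) = a_kernel (vecs R q) P f"
    by (rule fin_gen_cover[OF F f(3)])
  note pre = preimage_eq_image_kernel[OF F g'(1) w(1)]
  have "a_kernel (free R I) P g = {v \<in> carrier (free R I). g' v \<in> w ` carrier (vecs R d)}"
    unfolding w(2) a_kernel_eq using g'(2) module_homsD(1)[OF g'(1)] by auto
  also have "fin_gen R (free R I) \<dots>"
    unfolding pre(2)
    by (intro fin_gen_image[OF F F part_homs(1)[where J = "{..<d}"]] coherent_free_kernel coh finite_Plus I
        finite_lessThan pre(1))
  finally show ?thesis .
qed

lemma finitely_presented_submodule:
  assumes coh: "coherent_ring R" and N: "finitely_presented R N" and U: "fin_gen R N U"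
  shows "finitely_presented R (N\<lparr>carrier := U\<rparr>)"
proof -
  have R: "cring R" by (rule coherent_ring_cring[OF coh])
  have mN: "Module.module R N" by (rule finitely_presented_module[OF N])
  obtain d :: nat and w where w: "w \<in> module_homs R (vecs R d) N"
    "w ` carrier (vecs R d) = U" using fin_gen_cover[OF mN U] by metis
  show ?thesis
  proof (rule finitely_presentedI)
    show "Module.module R (N\<lparr>carrier := U\<rparr>)" by (rule module_carrier_update[OF mN fin_gen_submodule[OF mN U]])
    show "w \<in> module_homs R (vecs R d) (N\<lparr>carrier := U\<rparr>)"
      using w by (intro module_homs_into_submodule) (simp_all del: product_module_simps)
    show "w ` carrier (vecs R d) = carrier (N\<lparr>carrier := U\<rparr>)" using w by simp
    have "a_kernel (vecs R d) (N\<lparr>carrier := U\<rparr>) w = a_kernel (vecs R d) N w"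
      unfolding a_kernel_eq by simp
    then show "fin_gen R (vecs R d) (a_kernel (vecs R d) (N\<lparr>carrier := U\<rparr>) w)"
      using coherent_kernel[OF coh N finite_lessThan w(1)] by (simp only:)
  qed
qed

lemma finitely_presented_free_module:
  assumes "cring R"
  shows "finitely_presented R (vecs R q)"
proof (rule finitely_presentedI)
  note F = module_free_module[OF assms, of "{..<q}"]
  show "(\<lambda>v. v) \<in> module_homs R (vecs R q) (vecs R q)"
    by (rule module_homs_ident)
  have "a_kernel (vecs R q) (vecs R q) (\<lambda>v. v) = {\<zero>\<^bsub>vecs R q\<^esub>}"
    using submoduleD(2)[OF F submodule_zero[OF F]] unfolding a_kernel_eq by blast
  then show "fin_gen R (vecs R q) (a_kernel (vecs R q) (vecs R q) (\<lambda>v. v))"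
    using fin_gen_singleton_zero[OF F] by (simp only:)
qed (auto intro: module_free_module assms)

text \<open>
  The conditions \<open>L j v \<in> W\<close> say that \<open>v\<close> is killed by maps into the quotient by \<open>W\<close>, which is finitely
  presented.
\<close>

lemma coherent_preimage:
  fixes q :: nat
  defines "I \<equiv> {..<q}"
  assumes coh: "coherent_ring R" and A: "finite A" and J: "finite J"
    and L: "\<And>j. j \<in> J \<Longrightarrow> L j \<in> module_homs R (free R A) (free R I)"
    and W: "fin_gen R (free R I) W"
  shows "fin_gen R (free R A) {v \<in> carrier (free R A). \<forall>j\<in>J. L j v \<in> W}"
proof -
  have R: "cring R" by (rule coherent_ring_cring[OF coh])
  note F = module_free_module[OF R]
  let ?Q = "quotient_module (free R I) W" let ?p = "\<lambda>x. W +>\<^bsub>free R I\<^esub> x"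
  note Q = quotient_module[OF F fin_gen_submodule[OF F W]]
  have fpF: "finitely_presented R (free R I)"
    unfolding I_def by (rule finitely_presented_free_module[OF R])
  have "fin_gen R (free R A) {v \<in> carrier (free R A). \<forall>j\<in>J. ?p (L j v) = \<zero>\<^bsub>?Q\<^esub>}"
    by (intro fin_gen_joint_kernel F Q(1) J coherent_kernel coh finite_lessThan fin_gen_free_module R A
        finitely_presented_quotient[OF fpF W] module_homs_comp[OF L Q(2)])
  moreover have "?p x = \<zero>\<^bsub>?Q\<^esub> \<longleftrightarrow> x \<in> W" if "x \<in> carrier (free R I)" for x
    using Q(4) that unfolding a_kernel_eq by blast
  then have "{v \<in> carrier (free R A). \<forall>j\<in>J. ?p (L j v) = \<zero>\<^bsub>?Q\<^esub>} =
      {v \<in> carrier (free R A). \<forall>j\<in>J. L j v \<in> W}"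
    using module_homsD(1)[OF L] by (auto simp del: product_module_simps)
  ultimately show ?thesis by (simp only:)
qed

section \<open>Traces and filtrations\<close>

text \<open>
  From here on products are treated as abstract modules; unfolding their operations pointwise
  would hide the shape of the statements about linear maps.
\<close>

declare product_module_simps [simp del]

lemma mspan_carrier_update: "mspan R (N\<lparr>carrier := U\<rparr>) X = mspan R N X"
proof
  show "mspan R (N\<lparr>carrier := U\<rparr>) X \<subseteq> mspan R N X"
  proof
    fix x assume "x \<in> mspan R (N\<lparr>carrier := U\<rparr>) X"
    then show "x \<in> mspan R N X" by induction (auto intro: mspan.intros)
  qed
  show "mspan R N X \<subseteq> mspan R (N\<lparr>carrier := U\<rparr>) X"
  proof
    fix x assume "x \<in> mspan R N X"
    then show "x \<in> mspan R (N\<lparr>carrier := U\<rparr>) X"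
      by induction (use mspan.zero[where N = "N\<lparr>carrier := U\<rparr>" and R = R and X = X]
          mspan.incl[where N = "N\<lparr>carrier := U\<rparr>" and R = R and X = X]
          mspan.add[where N = "N\<lparr>carrier := U\<rparr>" and R = R and X = X]
          mspan.smult[where N = "N\<lparr>carrier := U\<rparr>" and R = R and X = X] in simp_all)
  qed
qed

lemma submodule_carrier_update:
  assumes "Module.module R N" "submodule U R N" "submodule H R N" "H \<subseteq> U"
  shows "submodule H R (N\<lparr>carrier := U\<rparr>)"
  using submoduleD[OF assms(1,3)] assms(4)
  by (intro submodule_if_closed[OF module_carrier_update[OF assms(1,2)]]) simp_all

lemma fin_gen_carrier_update:
  assumes "fin_gen R N H" "H \<subseteq> U"
  shows "fin_gen R (N\<lparr>carrier := U\<rparr>) H"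
proof -
  obtain X where X: "finite X" "H = mspan R N X" using assms(1) by (auto simp: fin_gen_def)
  then have "X \<subseteq> carrier (N\<lparr>carrier := U\<rparr>)" using mspan_superset[of X R N] assms(2) by simp
  then show ?thesis using fin_genI[OF X(1), of "N\<lparr>carrier := U\<rparr>" R] X(2) by (simp add: mspan_carrier_update)
qed

text \<open>
  Let \<open>M\<close> have \<open>m\<close> generators and the relations \<open>B\<close>.  A linear map from \<open>M\<close> to the quotient \<open>A / W\<close> lifts to a map
  \<open>h\<close> from \<open>R\<^sup>m\<close> to \<open>A\<close> that sends \<open>B\<close> into \<open>W\<close>; such maps are called admissible.  Hence \<open>trace_ext\<close> is the preimage in \<open>A\<close> of the trace of \<open>M\<close> in
  \<open>A / W\<close>, that is, of the sum of the images of all linear maps from \<open>M\<close>.  Working with lifts keeps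
  the iterated traces inside the fixed module \<open>A\<close>.
\<close>

definition trace_ext :: "'r ring \<Rightarrow> nat \<Rightarrow> (nat \<Rightarrow> 'r) set \<Rightarrow> ('r, 'a) module \<Rightarrow> 'a set \<Rightarrow> 'a set" where
  "trace_ext R m B A W =
     mspan R A (W \<union> (\<Union>h \<in> {h \<in> module_homs R (vecs R m) A. h ` B \<subseteq> W}. h ` carrier (vecs R m)))"

lemma trace_ext_closed:
  assumes "Module.module R A" "W \<subseteq> carrier A"
  shows "submodule (trace_ext R m B A W) R A"
  unfolding trace_ext_def
  by (intro submodule_mspan assms(1) Un_least assms(2) UN_least image_subsetI) (auto dest: module_homsD(1))

lemma trace_ext_superset: "W \<subseteq> trace_ext R m B A W"
  unfolding trace_ext_def by (rule subset_trans[OF Un_upper1 mspan_superset])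

lemma trace_ext_hom:
  assumes "h \<in> module_homs R (vecs R m) A" "h ` B \<subseteq> W" "v \<in> carrier (vecs R m)"
  shows "h v \<in> trace_ext R m B A W"
  unfolding trace_ext_def using assms by (intro mspan.incl) blast

lemma trace_ext_mono: "W \<subseteq> W' \<Longrightarrow> trace_ext R m B A W \<subseteq> trace_ext R m B A W'"
  unfolding trace_ext_def by (rule mspan_mono) blast

lemma trace_ext_least:
  assumes "Module.module R A" "submodule H R A" "W \<subseteq> H"
    and "\<And>h v. h \<in> module_homs R (vecs R m) A \<Longrightarrow> h ` B \<subseteq> W \<Longrightarrow>
           v \<in> carrier (vecs R m) \<Longrightarrow> h v \<in> H"
  shows "trace_ext R m B A W \<subseteq> H"
  unfolding trace_ext_def using assms by (intro mspan_least) blast+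

lemma trace_iter_subset:
  assumes "Module.module R A" "W \<subseteq> carrier A"
  shows "(trace_ext R m B A ^^ i) W \<subseteq> carrier A"
  using assms(2) by (induction i) (auto dest!: submoduleD(2)[OF assms(1) trace_ext_closed[OF assms(1)]])

lemma trace_iter_increasing:
  "i \<le> j \<Longrightarrow> (trace_ext R m B A ^^ i) W \<subseteq> (trace_ext R m B A ^^ j) W"
proof (induction j rule: dec_induct)
  case (step n)
  then show ?case using trace_ext_superset[of "(trace_ext R m B A ^^ n) W" R m B A] by simp
qed simp

lemma trace_iter_submodule:
  assumes "Module.module R A" "submodule W R A"
  shows "submodule ((trace_ext R m B A ^^ i) W) R A"
proof (cases i)
  case (Suc j)
  then show ?thesis
    using trace_ext_closed[OF assms(1) trace_iter_subset[OF assms(1) submoduleD(1)[OF assms]]] by simp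
qed (simp add: assms)

text \<open>
  Each of the \<open>k\<close> components of \<open>g\<close> lifts to a map from \<open>R\<^sup>m\<close> to \<open>U\<close> which sends the relations into the kernel of
  \<open>p\<close>, hence into \<open>W\<close>.  So the lifts are admissible, and together with \<open>W\<close> their images fill \<open>U\<close>.
\<close>

lemma generated_quotient_le_trace:
  assumes A: "Module.module R A" and M: "Module.module R M"
    and hM: "hM \<in> module_homs R (vecs R m) M" "hM ` carrier (vecs R m) = carrier M"
    and B: "\<And>b. b \<in> B \<Longrightarrow> b \<in> carrier (vecs R m) \<and> hM b = \<zero>\<^bsub>M\<^esub>"
    and U: "submodule U R A" and W: "submodule W R A"
    and Q: "Module.module R Q" and p: "p \<in> module_homs R (A\<lparr>carrier := U\<rparr>) Q" "p ` U = carrier Q"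
    and ker: "\<And>x. x \<in> U \<Longrightarrow> p x = \<zero>\<^bsub>Q\<^esub> \<Longrightarrow> x \<in> W"
    and g: "g \<in> module_homs R (power_module M k) Q" "g ` carrier (power_module M k) = carrier Q"
  shows "U \<subseteq> trace_ext R m B A W"
proof
  interpret A: Module.module R A by fact
  have R: "cring R" by (rule A.R.is_cring)
  let ?T = "trace_ext R m B A W" let ?AU = "A\<lparr>carrier := U\<rparr>" let ?F = "vecs R m"
  have AU: "Module.module R ?AU" by (rule module_carrier_update[OF A U])
  have T: "submodule ?T R A" by (rule trace_ext_closed[OF A submoduleD(1)[OF A W]])
  have TU: "submodule (?T \<inter> U) R ?AU"
    using submoduleD[OF A T] submoduleD[OF A U] by (intro submodule_if_closed[OF AU]) simp_all
  \<comment> \<open>It suffices that the image of the trace fills the quotient, since the kernel already lies in \<open>W\<close>.\<close>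
  define D where "D = p ` (?T \<inter> U)"
  have D: "submodule D R Q" unfolding D_def by (rule submodule_image[OF AU Q p(1) TU])
  have "g (coord_incl M {..<k} l x) \<in> D" if x: "x \<in> carrier M" for l x
  proof -
    have gl: "(\<lambda>v. g (coord_incl M {..<k} l (hM v))) \<in> module_homs R ?F Q"
      using g(1) unfolding power_module_eq_product
      by (rule module_homs_comp[OF module_homs_comp[OF hM(1) coord_incl_hom[OF M]]])
    have pU: "p ` carrier ?AU = carrier Q" using p(2) by simp
    obtain h where h: "h \<in> module_homs R ?F ?AU"
      "\<And>v. v \<in> carrier ?F \<Longrightarrow> p (h v) = g (coord_incl M {..<k} l (hM v))"
      by (rule free_lift[OF AU Q finite_lessThan p(1) pU gl]) (rule that)
    have hU: "h v \<in> U" if "v \<in> carrier ?F" for v using module_homsD(1)[OF h(1) that] by simp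
    have hA: "h \<in> module_homs R ?F A"
      using module_homsD[OF h(1)] submoduleD(2)[OF A U] by (intro module_homsI) simp_all
    have hB: "h ` B \<subseteq> W"
    proof (rule image_subsetI)
      fix b assume b: "b \<in> B"
      have "hM b = hM \<zero>\<^bsub>?F\<^esub>" using B[OF b] module_hom_zero[OF module_free_module[OF R] M hM(1)] by simp
      then have "p (h b) = p (h \<zero>\<^bsub>?F\<^esub>)"
        using h(2) B[OF b] submoduleD(3)[OF module_free_module[OF R] module.carrier_is_submodule[OF module_free_module[OF R]]]
        by metis
      also have "\<dots> = \<zero>\<^bsub>Q\<^esub>"
        using module_hom_zero[OF module_free_module[OF R] AU h(1)] module_hom_zero[OF AU Q p(1)] by simp
      finally show "h b \<in> W" using ker hU B[OF b] by blast
    qed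
    obtain v where v: "v \<in> carrier ?F" "x = hM v" using x hM(2) by blast
    have "h v \<in> ?T \<inter> U" using trace_ext_hom[OF hA hB v(1)] hU[OF v(1)] by blast
    then show ?thesis unfolding D_def v(2) h(2)[OF v(1), symmetric] by (rule imageI)
  qed
  then have incl: "g ` (\<Union>l\<in>{..<k}. coord_incl M {..<k} l ` carrier M) \<subseteq> D" by blast
  have P: "Module.module R (power_module M k)" unfolding power_module_eq_product by (rule module_product_module[OF M])
  have X: "(\<Union>l\<in>{..<k}. coord_incl M {..<k} l ` carrier M) \<subseteq> carrier (power_module M k)"
    unfolding power_module_eq_product by (intro UN_least image_subsetI module_homsD(1)[OF coord_incl_hom[OF M]])
  have "carrier Q = g ` mspan R (power_module M k) (\<Union>l\<in>{..<k}. coord_incl M {..<k} l ` carrier M)"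
    using g(2) product_module_span[OF M finite_lessThan, of k] unfolding power_module_eq_product by simp
  also have "\<dots> \<subseteq> D"
    unfolding hom_image_mspan[OF P Q g(1) X] by (rule mspan_least[OF Q D incl])
  finally have QD: "carrier Q \<subseteq> D" .
  fix x assume x: "x \<in> U"
  then have "p x \<in> D" using p(2) QD by blast
  then obtain t where t: "t \<in> ?T" "t \<in> U" "p x = p t" unfolding D_def by blast
  interpret AU: Module.module R ?AU by fact
  have "x \<ominus>\<^bsub>?AU\<^esub> t = x \<ominus>\<^bsub>A\<^esub> t"
    using x t(2) submoduleD(2)[OF A U] AU.minus_eq_smult[of t] A.minus_eq_smult[of t] 
    by (simp add: AU.M.minus_eq A.M.minus_eq)
  moreover have "x \<ominus>\<^bsub>?AU\<^esub> t \<in> a_kernel ?AU Q p" using hom_image_eq_iff[OF AU Q p(1), of x t] x t by simp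
  ultimately have "x \<ominus>\<^bsub>A\<^esub> t \<in> W" using ker unfolding a_kernel_eq by simp
  then have "x \<ominus>\<^bsub>A\<^esub> t \<in> ?T" by (rule subsetD[OF trace_ext_superset])
  from submoduleD(4)[OF A T this t(1)]
  show "x \<in> ?T" using x t(2) submoduleD(2)[OF A U] by (simp add: A.M.minus_eq A.M.a_assoc A.M.l_neg)
qed

text \<open>
  With \<open>b\<close> a relation of \<open>M\<close> and \<open>w i y\<close> the rows of a matrix \<open>y\<close>, this makes admissibility a linear condition
  on \<open>y\<close>.
\<close>

lemma lincomb_hom_in_vectors:
  assumes A: "Module.module R A" and N: "Module.module R N" and I: "finite I"
    and w: "\<And>i. i \<in> I \<Longrightarrow> w i \<in> module_homs R A N" and b: "b \<in> carrier (free R I)"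
  shows "(\<lambda>y. lincomb N I (\<lambda>i. w i y) b) \<in> module_homs R A N"
proof -
  interpret N: Module.module R N by fact
  have bi: "b i \<in> carrier R" if "i \<in> I" for i using b that by (auto simp: product_module_simps)
  have s: "(\<lambda>x. b i \<odot>\<^bsub>N\<^esub> x) \<in> module_homs R N N" if "i \<in> I" for i
    using bi[OF that] by (intro module_homsI) (auto simp: N.smult_r_distr N.smult_assoc1[symmetric] N.R.m_comm)
  have h: "(\<lambda>y. sum_hom N I (\<lambda>i x. b i \<odot>\<^bsub>N\<^esub> x) (\<lambda>i\<in>I. w i y)) \<in> module_homs R A N"
    by (rule module_homs_comp[OF tuple_module_hom[OF w] sum_hom(1)[OF N N I s]])
  have eq: "lincomb N I (\<lambda>i. w i y) b = sum_hom N I (\<lambda>i x. b i \<odot>\<^bsub>N\<^esub> x) (\<lambda>i\<in>I. w i y)"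
    if "y \<in> carrier A" for y
    unfolding lincomb_def sum_hom_def using module_homsD(1)[OF w that] bi
    by (intro N.M.finsum_cong') auto
  interpret A: Module.module R A by fact
  show ?thesis
    using module_homsD[OF h] by (intro module_homsI) (simp_all only: eq A.M.a_closed A.smult_closed)
qed

text \<open>
  Linear maps from \<open>R\<^sup>m\<close> to \<open>R\<^sup>q\<close> are given by matrices with \<open>m\<close> rows of length \<open>q\<close>, and matrices form a free
  module themselves.  So a condition on maps becomes a linear condition on vectors.
\<close>

definition matrix_row :: "nat \<Rightarrow> nat \<Rightarrow> (nat \<times> nat \<Rightarrow> 'r) \<Rightarrow> nat \<Rightarrow> 'r" where
  "matrix_row q c y = (\<lambda>i\<in>{..<q}. y (c, i))"

lemma matrix_row_hom:
  "c < m \<Longrightarrow> matrix_row q c \<in> module_homs R (free R ({..<m} \<times> {..<q})) (vecs R q)"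
  unfolding matrix_row_def[abs_def] by (intro tuple_module_hom proj_module_hom) auto

definition matrix_hom :: "'r ring \<Rightarrow> nat \<Rightarrow> nat \<Rightarrow> (nat \<times> nat \<Rightarrow> 'r) \<Rightarrow> (nat \<Rightarrow> 'r) \<Rightarrow> nat \<Rightarrow> 'r" where
  "matrix_hom R m q y = lincomb (vecs R q) {..<m} (\<lambda>c. matrix_row q c y)"

lemma matrix_hom:
  assumes "cring R" "y \<in> carrier (free R ({..<m} \<times> {..<q}))"
  shows "matrix_hom R m q y \<in> module_homs R (vecs R m) (vecs R q)"
    "c < m \<Longrightarrow> matrix_hom R m q y (unit_vec R {..<m} c) = matrix_row q c y"
  unfolding matrix_hom_def
  using lincomb(1,2)[OF module_free_module[OF assms(1)] finite_lessThan, of m "\<lambda>c. matrix_row q c y" "{..<q}"]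
    module_homsD(1)[OF matrix_row_hom assms(2)] by simp_all

lemma matrix_hom_in_matrix:
  assumes "cring R" "b \<in> carrier (vecs R m)"
  shows "(\<lambda>y. matrix_hom R m q y b) \<in> module_homs R (free R ({..<m} \<times> {..<q})) (vecs R q)"
  unfolding matrix_hom_def
  by (rule lincomb_hom_in_vectors) (use assms module_free_module matrix_row_hom in auto)

lemma matrix_hom_surj:
  assumes R: "cring R" and h: "h \<in> module_homs R (vecs R m) (vecs R q)"
  obtains y where "y \<in> carrier (free R ({..<m} \<times> {..<q}))"
    "\<And>v. v \<in> carrier (vecs R m) \<Longrightarrow> matrix_hom R m q y v = h v"
proof -
  define y where "y = (\<lambda>(c, i)\<in>{..<m} \<times> {..<q}. h (unit_vec R {..<m} c) i)"
  have hc: "h (unit_vec R {..<m} c) \<in> {..<q} \<rightarrow>\<^sub>E carrier R" for c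
    using module_homsD(1)[OF h unit_vec_closed[OF R]] by (simp add: product_module_simps)
  have y: "y \<in> carrier (free R ({..<m} \<times> {..<q}))"
    using PiE_const_mem[OF hc] by (auto simp: y_def product_module_simps)
  have row: "matrix_row q c y = h (unit_vec R {..<m} c)" if "c < m" for c
    unfolding matrix_row_def by (rule restrict_eqI[OF hc]) (simp add: y_def that)
  show ?thesis
  proof (rule that[OF y])
    fix v assume "v \<in> carrier (vecs R m)"
    then show "matrix_hom R m q y v = h v"
      by (rule free_hom_eqI[OF module_free_module[OF R] finite_lessThan matrix_hom(1)[OF R y] h, rotated])
        (simp add: matrix_hom(2)[OF R y] row)
  qed
qed

text \<open>
  Over a coherent ring finitely many maps suffice to form the trace: the admissible maps are the
  matrices \<open>y\<close> solving the linear conditions \<open>y b \<in> W\<close>.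
\<close>

lemma trace_ext_finite:
  assumes coh: "coherent_ring R" and B: "finite B" "B \<subseteq> carrier (vecs R m)"
    and W: "fin_gen R (vecs R q) W"
  obtains k :: nat and h where
    "\<And>l. l < k \<Longrightarrow> h l \<in> module_homs R (vecs R m) (vecs R q) \<and> h l ` B \<subseteq> W"
    "trace_ext R m B (vecs R q) W =
       mspan R (vecs R q) (W \<union> (\<Union>l<k. h l ` carrier (vecs R m)))"
proof -
  have R: "cring R" by (rule coherent_ring_cring[OF coh])
  note F = module_free_module[OF R]
  let ?A = "vecs R q" let ?Y = "free R ({..<m} \<times> {..<q})" let ?F = "vecs R m"
  let ?S = "{y \<in> carrier ?Y. \<forall>b\<in>B. matrix_hom R m q y b \<in> W}"
  have "fin_gen R ?Y ?S"
    by (intro coherent_preimage[where q = q, OF coh] B(1) matrix_hom_in_matrix R W finite_cartesian_product finite_lessThan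
        subsetD[OF B(2)])
  then obtain k :: nat and w where w: "w \<in> module_homs R (vecs R k) ?Y"
    "w ` carrier (vecs R k) = ?S" by (rule fin_gen_cover[OF F])
  let ?G = "vecs R k"
  define h where "h l = matrix_hom R m q (w (unit_vec R {..<k} l))" for l
  have wl: "w t \<in> ?S" if "t \<in> carrier ?G" for t using w(2) that by blast
  have h1: "h l \<in> module_homs R ?F ?A \<and> h l ` B \<subseteq> W" for l
    unfolding h_def using wl[OF unit_vec_closed[OF R]] matrix_hom(1)[OF R] by blast
  let ?X = "W \<union> (\<Union>l<k. h l ` carrier ?F)"
  have WA: "W \<subseteq> carrier ?A" by (rule submoduleD(1)[OF F fin_gen_submodule[OF F W]])
  have XA: "?X \<subseteq> carrier ?A"
    by (intro Un_least WA UN_least image_subsetI module_homsD(1)[OF conjunct1[OF h1]])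
  have X: "submodule (mspan R ?A ?X) R ?A" by (rule submodule_mspan[OF F XA])
  have "trace_ext R m B ?A W = mspan R ?A ?X"
  proof
    show "trace_ext R m B ?A W \<subseteq> mspan R ?A ?X"
    proof (rule trace_ext_least[OF F X])
      show "W \<subseteq> mspan R ?A ?X" using mspan_superset[of ?X R ?A] by blast
      fix g v assume g: "g \<in> module_homs R ?F ?A" "g ` B \<subseteq> W" and v: "v \<in> carrier ?F"
      obtain y where y: "y \<in> carrier ?Y" "\<And>v. v \<in> carrier ?F \<Longrightarrow> matrix_hom R m q y v = g v"
        by (rule matrix_hom_surj[OF R g(1)]) (rule that)
      have "y \<in> ?S" using y g(2) B(2) by (simp add: image_subset_iff subset_iff)
      then obtain t where t: "t \<in> carrier ?G" "y = w t" using w(2) by blast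
      \<comment> \<open>For a fixed vector \<open>v\<close> the value of a matrix at \<open>v\<close> is linear in the matrix, so generators of the module of admissible matrices suffice.\<close>
      have hom: "(\<lambda>t. matrix_hom R m q (w t) v) \<in> module_homs R ?G ?A"
        by (rule module_homs_comp[OF w(1) matrix_hom_in_matrix[OF R v]])
      have "g v \<in> (\<lambda>t. matrix_hom R m q (w t) v) ` carrier ?G"
        using t y(2)[OF v] by (intro image_eqI[of _ _ t]) simp_all
      also have "\<dots> = mspan R ?A ((\<lambda>t. matrix_hom R m q (w t) v) ` unit_vec R {..<k} ` {..<k})"
        unfolding free_module_span[OF R finite_lessThan]
        by (intro hom_image_mspan[OF F F hom] image_subsetI unit_vec_closed R)
      also have "\<dots> \<subseteq> mspan R ?A ?X"
        using v by (intro mspan_mono) (auto simp: h_def)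
      finally show "g v \<in> mspan R ?A ?X" .
    qed
    show "mspan R ?A ?X \<subseteq> trace_ext R m B ?A W"
      unfolding trace_ext_def using h1 by (intro mspan_mono) blast
  qed
  with h1 show ?thesis by (rule_tac that[of k h]) auto
qed

text \<open>
  Each of the finitely many maps contributes the images of the unit vectors.
\<close>

lemma trace_ext_fin_gen:
  assumes coh: "coherent_ring R" and B: "finite B" "B \<subseteq> carrier (vecs R m)"
    and W: "fin_gen R (vecs R q) W"
  shows "fin_gen R (vecs R q) (trace_ext R m B (vecs R q) W)"
proof -
  have R: "cring R" by (rule coherent_ring_cring[OF coh])
  note F = module_free_module[OF R]
  let ?A = "vecs R q" let ?F = "vecs R m"
  obtain k :: nat and h where
    h: "\<And>l. l < k \<Longrightarrow> h l \<in> module_homs R ?F ?A \<and> h l ` B \<subseteq> W"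
    and eq: "trace_ext R m B ?A W = mspan R ?A (W \<union> (\<Union>l<k. h l ` carrier ?F))"
    by (rule trace_ext_finite[OF assms]) (rule that)
  obtain X where X: "finite X" "X \<subseteq> carrier ?A" "W = mspan R ?A X" using W by (auto simp: fin_gen_def)
  let ?u = "unit_vec R {..<m} ` {..<m}"
  have u: "?u \<subseteq> carrier ?F" by (intro image_subsetI unit_vec_closed R)
  have im: "h l ` carrier ?F = mspan R ?A (h l ` ?u)" if "l < k" for l
    unfolding free_module_span[OF R finite_lessThan] using h[OF that] by (intro hom_image_mspan[OF F F _ u]) blast
  let ?Z = "X \<union> (\<Union>l<k. h l ` ?u)"
  have "trace_ext R m B ?A W = mspan R ?A ?Z"
  proof
    show "trace_ext R m B ?A W \<subseteq> mspan R ?A ?Z"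
    proof -
      have "h l ` carrier ?F \<subseteq> mspan R ?A ?Z" if "l < k" for l
        unfolding im[OF that] using that by (intro mspan_mono) blast
      moreover have "W \<subseteq> mspan R ?A ?Z" unfolding X(3) by (intro mspan_mono) blast
      ultimately show ?thesis unfolding eq by (intro mspan_subset_mspan Un_least UN_least) auto
    qed
    show "mspan R ?A ?Z \<subseteq> trace_ext R m B ?A W"
      unfolding eq unfolding X(3) by (intro mspan_mono Un_mono mspan_superset UN_mono image_mono u subset_refl)
  qed
  moreover have "?Z \<subseteq> carrier ?A"
  proof (intro Un_least X(2) UN_least image_subsetI)
    fix l v assume "l \<in> {..<k}" "v \<in> ?u"
    then show "h l v \<in> carrier ?A" using h u by (intro module_homsD(1)[where f = "h l" and R = R and A = ?F]) auto
  qed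
  ultimately show ?thesis using X(1) by (simp add: fin_genI)
qed

text \<open>
  The finitely many maps that form the trace send the relations of \<open>M\<close> into \<open>W\<close>, so modulo \<open>W\<close> they
  factor through \<open>M\<close>; their sum is a surjection from a finite power of \<open>M\<close>.
\<close>

lemma trace_quotient_generated:
  assumes coh: "coherent_ring R" and N: "finitely_presented R N" and M: "Module.module R M"
    and hM: "hM \<in> module_homs R (vecs R m) M" "hM ` carrier (vecs R m) = carrier M"
    and B: "finite B" "B \<subseteq> carrier (vecs R m)" "a_kernel (vecs R m) M hM = mspan R (vecs R m) B"
    and f: "f \<in> module_homs R (vecs R q) N"
    and W: "fin_gen R (vecs R q) W"
  shows "quotient_module (N\<lparr>carrier := f ` trace_ext R m B (vecs R q) W\<rparr>) (f ` W) \<in> gen R M"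
proof -
  have R: "cring R" by (rule coherent_ring_cring[OF coh])
  have mN: "Module.module R N" by (rule finitely_presented_module[OF N])
  let ?A = "vecs R q" let ?F = "vecs R m"
  note F = module_free_module[OF R]
  let ?T = "trace_ext R m B ?A W" let ?U = "f ` ?T"
  let ?NU = "N\<lparr>carrier := ?U\<rparr>" let ?V = "f ` W" let ?Q = "quotient_module ?NU ?V"
  let ?p = "\<lambda>x. ?V +>\<^bsub>?NU\<^esub> x"
  have T: "fin_gen R ?A ?T" by (rule trace_ext_fin_gen[OF coh B(1,2) W])
  have sT: "submodule ?T R ?A" by (rule fin_gen_submodule[OF F T])
  have fU: "fin_gen R N ?U" by (rule fin_gen_image[OF F mN f T])
  have NU: "finitely_presented R ?NU" by (rule finitely_presented_submodule[OF coh N fU])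
  have mNU: "Module.module R ?NU" by (rule finitely_presented_module[OF NU])
  have VU: "?V \<subseteq> ?U" by (intro image_mono trace_ext_superset)
  have fV: "fin_gen R ?NU ?V" by (rule fin_gen_carrier_update[OF fin_gen_image[OF F mN f W] VU])
  note Q = quotient_module[OF mNU fin_gen_submodule[OF mNU fV]]
  have Qfp: "finitely_presented R ?Q" by (rule finitely_presented_quotient[OF NU fV])
  let ?AT = "?A\<lparr>carrier := ?T\<rparr>"
  have AT: "Module.module R ?AT" by (rule module_carrier_update[OF F sT])
  have fT: "f \<in> module_homs R ?AT ?NU"
    by (rule module_homs_into_submodule[OF module_homs_restrict[OF f submoduleD(1)[OF F sT]]]) simp
  have pf: "(\<lambda>v. ?p (f v)) \<in> module_homs R ?AT ?Q" by (rule module_homs_comp[OF fT Q(2)])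
  have kill: "?p (f w) = \<zero>\<^bsub>?Q\<^esub>" if "w \<in> W" for w
    using Q(4) imageI[OF that, of f] unfolding a_kernel_eq by blast
  obtain k :: nat and h where
    h: "\<And>l. l < k \<Longrightarrow> h l \<in> module_homs R ?F ?A \<and> h l ` B \<subseteq> W"
    and eq: "?T = mspan R ?A (W \<union> (\<Union>l<k. h l ` carrier ?F))"
    by (rule trace_ext_finite[OF coh B(1,2) W]) (rule that)
  have "\<exists>g. g \<in> module_homs R M ?Q \<and> (\<forall>v\<in>carrier ?F. g (hM v) = ?p (f (h l v)))" if l: "l < k" for l
  proof -
    have hl: "h l \<in> module_homs R ?F ?A" "h l ` B \<subseteq> W" using h[OF l] by auto
    have hT: "h l \<in> module_homs R ?F ?AT"
      by (rule module_homs_into_submodule[OF hl(1)]) (rule image_subsetI, rule trace_ext_hom[OF hl])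
    have u: "(\<lambda>v. ?p (f (h l v))) \<in> module_homs R ?F ?Q" by (rule module_homs_comp[OF hT pf])
    have "a_kernel ?F M hM \<subseteq> a_kernel ?F ?Q (\<lambda>v. ?p (f (h l v)))"
      unfolding B(3)
    proof (rule mspan_least[OF F submodule_kernel[OF F Q(1) u]], rule subsetI)
      fix b assume "b \<in> B"
      then show "b \<in> a_kernel ?F ?Q (\<lambda>v. ?p (f (h l v)))"
        using B(2) kill hl(2) unfolding a_kernel_eq by blast
    qed
    from hom_factor[OF F M Q(1) hM u this] show ?thesis by metis
  qed
  then obtain g where g: "\<And>l. l < k \<Longrightarrow> g l \<in> module_homs R M ?Q"
    "\<And>l v. l < k \<Longrightarrow> v \<in> carrier ?F \<Longrightarrow> g l (hM v) = ?p (f (h l v))" by metis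
  let ?P = "product_module M {..<k}"
  have P: "Module.module R ?P" by (rule module_product_module[OF M])
  have gl: "l \<in> {..<k} \<Longrightarrow> g l \<in> module_homs R M ?Q" for l using g(1) by simp
  note G = sum_hom[OF M Q(1) finite_lessThan, of k g, OF gl]
  let ?G = "sum_hom ?Q {..<k} g"
  have G1: "?G \<in> module_homs R ?P ?Q" by (rule G(1))
  have G2: "?G (coord_incl M {..<k} l x) = g l x" if "l \<in> {..<k}" "x \<in> carrier M" for l x
    by (rule G(2)[OF _ that])
  let ?I = "?G ` carrier ?P"
  have I: "submodule ?I R ?Q" by (rule submodule_image[OF P Q(1) G1 module.carrier_is_submodule[OF P]])
  have "?T \<subseteq> {t \<in> carrier ?AT. ?p (f t) \<in> ?I}"
  proof -
    have "mspan R ?AT (W \<union> (\<Union>l<k. h l ` carrier ?F)) \<subseteq> {t \<in> carrier ?AT. ?p (f t) \<in> ?I}"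
    proof (rule mspan_least[OF AT submodule_preimage[OF AT Q(1) pf I]], intro Un_least UN_least image_subsetI subsetI)
      fix w assume w: "w \<in> W"
      have "w \<in> ?T" by (rule subsetD[OF trace_ext_superset w])
      then show "w \<in> {t \<in> carrier ?AT. ?p (f t) \<in> ?I}"
        using kill[OF w] submoduleD(3)[OF Q(1) I] by simp
    next
      fix l v assume l: "l \<in> {..<k}" and v: "v \<in> carrier ?F"
      have "h l v \<in> ?T" using l h v by (intro trace_ext_hom) auto
      moreover have hv: "hM v \<in> carrier M" by (rule module_homsD(1)[OF hM(1) v])
      have "?G (coord_incl M {..<k} l (hM v)) = ?p (f (h l v))" using G2[OF l hv] g(2) l v by simp
      then have "?p (f (h l v)) \<in> ?I"
        using imageI[OF module_homsD(1)[OF coord_incl_hom[OF M] hv, of "{..<k}" l], of ?G] by simp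
      ultimately show "h l v \<in> {t \<in> carrier ?AT. ?p (f t) \<in> ?I}" by simp
    qed
    then show ?thesis unfolding mspan_carrier_update eq[symmetric] .
  qed
  then have "?p ` ?U \<subseteq> ?I" by blast
  then have "carrier ?Q \<subseteq> ?I" using Q(3) by simp
  then have "?I = carrier ?Q" using submoduleD(1)[OF Q(1) I] by blast
  then show ?thesis unfolding gen_def power_module_eq_product using Qfp G1 by blast
qed

text \<open>
  Taking traces is the greedy way to filter: by induction every filtration with generated quotients
  stays inside the iterated traces, and over a coherent ring these form such a filtration
  themselves.  The traces are pulled back along a presentation of \<open>N\<close>, so they start at its kernel and
  live inside a free module.
\<close>

theorem Filt_gen_iff_trace:
  assumes coh: "coherent_ring R" and N: "finitely_presented R N" and M: "Module.module R M"
    and hM: "hM \<in> module_homs R (vecs R m) M" "hM ` carrier (vecs R m) = carrier M"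
    and B: "finite B" "B \<subseteq> carrier (vecs R m)" "a_kernel (vecs R m) M hM = mspan R (vecs R m) B"
    and f: "f \<in> module_homs R (vecs R q) N" "f ` carrier (vecs R q) = carrier N"
  shows "N \<in> Filt R n (gen R M) \<longleftrightarrow>
    (trace_ext R m B (vecs R q) ^^ n) (a_kernel (vecs R q) N f) = carrier (vecs R q)"
proof
  have R: "cring R" by (rule coherent_ring_cring[OF coh])
  have mN: "Module.module R N" by (rule finitely_presented_module[OF N])
  let ?A = "vecs R q" let ?F = "vecs R m"
  note F = module_free_module[OF R]
  let ?K = "a_kernel ?A N f"
  let ?T = "\<lambda>i. (trace_ext R m B ?A ^^ i) ?K"
  have K: "submodule ?K R ?A" by (rule submodule_kernel[OF F mN f(1)])
  have T: "submodule (?T i) R ?A" for i by (rule trace_iter_submodule[OF F K])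
  have Bk: "b \<in> carrier ?F \<and> hM b = \<zero>\<^bsub>M\<^esub>" if "b \<in> B" for b
    using mspan_superset[of B R ?F] that unfolding B(3)[symmetric] a_kernel_eq by blast
  {
    assume "N \<in> Filt R n (gen R M)"
    then have "\<exists>k G. k \<le> n \<and> G 0 = {\<zero>\<^bsub>N\<^esub>} \<and> G k = carrier N \<and>
        (\<forall>i\<le>k. submodule (G i) R N \<and> finitely_presented R (N\<lparr>carrier := G i\<rparr>)) \<and>
        (\<forall>i<k. G i \<subseteq> G (Suc i) \<and> quotient_module (N\<lparr>carrier := G (Suc i)\<rparr>) (G i) \<in> gen R M)"
      unfolding Filt_def mem_Collect_eq by (rule conjunct2)
    then obtain k G where k: "k \<le> n" and G: "G 0 = {\<zero>\<^bsub>N\<^esub>}" "G k = carrier N"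
      "\<And>i. i \<le> k \<Longrightarrow> submodule (G i) R N"
      "\<And>i. i < k \<Longrightarrow> G i \<subseteq> G (Suc i)"
      "\<And>i. i < k \<Longrightarrow> quotient_module (N\<lparr>carrier := G (Suc i)\<rparr>) (G i) \<in> gen R M"
      by (elim exE conjE) simp
    have "{v \<in> carrier ?A. f v \<in> G i} \<subseteq> ?T i" if "i \<le> k" for i
      using that
    proof (induction i)
      case 0
      then show ?case unfolding G(1) a_kernel_eq by simp
    next
      case (Suc i)
      then have i: "i < k" and IH: "{v \<in> carrier ?A. f v \<in> G i} \<subseteq> ?T i" by auto
      let ?U = "{v \<in> carrier ?A. f v \<in> G (Suc i)}" let ?N = "N\<lparr>carrier := G (Suc i)\<rparr>"
      let ?Q = "quotient_module ?N (G i)"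
      have GS: "submodule (G (Suc i)) R N" and Gi: "submodule (G i) R N" using G(3) i by auto
      have mN': "Module.module R ?N" by (rule module_carrier_update[OF mN GS])
      note Q = quotient_module[OF mN' submodule_carrier_update[OF mN GS Gi G(4)[OF i]]]
      have U: "submodule ?U R ?A" by (rule submodule_preimage[OF F mN f(1) GS])
      obtain l g where g: "g \<in> module_homs R (power_module M l) ?Q" "g ` carrier (power_module M l) = carrier ?Q"
        using G(5)[OF i] unfolding gen_def by blast
      have fU: "f \<in> module_homs R (?A\<lparr>carrier := ?U\<rparr>) ?N"
        by (rule module_homs_into_submodule[OF module_homs_restrict[OF f(1) submoduleD(1)[OF F U]]]) auto
      have imU: "f ` ?U = carrier ?N"
        using f(2) submoduleD(1)[OF mN GS] image_Collect_comp[of f "carrier ?A" "\<lambda>y. y \<in> G (Suc i)"] by auto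
      have "?U \<subseteq> trace_ext R m B ?A (?T i)"
      proof (rule generated_quotient_le_trace[OF F M hM Bk U T Q(1) module_homs_comp[OF fU Q(2)] _ _ g])
        show "(\<lambda>x. G i +>\<^bsub>?N\<^esub> f x) ` ?U = carrier ?Q" using Q(3) imU by (metis image_image)
        fix x assume x: "x \<in> ?U" "G i +>\<^bsub>?N\<^esub> f x = \<zero>\<^bsub>?Q\<^esub>"
        then have "f x \<in> a_kernel ?N ?Q (\<lambda>x. G i +>\<^bsub>?N\<^esub> x)" unfolding a_kernel_eq by simp
        then have "f x \<in> G i" unfolding Q(4) .
        then show "x \<in> ?T i" using IH x(1) by blast
      qed
      then show ?case by simp
    qed
    from this[OF order_refl] have "carrier ?A \<subseteq> ?T k" unfolding G(2) using module_homsD(1)[OF f(1)] by blast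
    also have "\<dots> \<subseteq> ?T n" by (rule trace_iter_increasing[OF k])
    finally show "?T n = carrier ?A" using submoduleD(1)[OF F T] by blast
  }
  assume full: "?T n = carrier ?A"
  have fgK: "fin_gen R ?A ?K" by (rule finitely_presented_kernel[OF N finite_lessThan f])
  have fgT: "fin_gen R ?A (?T i)" for i
    by (induction i) (simp_all add: fgK trace_ext_fin_gen[OF coh B(1,2)])
  have z: "\<zero>\<^bsub>?A\<^esub> \<in> ?K" by (rule submoduleD(3)[OF F K])
  have T0: "f ` ?T 0 = {\<zero>\<^bsub>N\<^esub>}" using z unfolding a_kernel_eq by auto
  have fgfT: "fin_gen R N (f ` ?T i)" for i by (rule fin_gen_image[OF F mN f(1) fgT])
  have gen: "quotient_module (N\<lparr>carrier := f ` ?T (Suc i)\<rparr>) (f ` ?T i) \<in> gen R M" for i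
    using trace_quotient_generated[OF coh N M hM B f(1) fgT[of i]] by simp
  have inc: "f ` ?T i \<subseteq> f ` ?T (Suc i)" for i by (rule image_mono[OF trace_iter_increasing]) simp
  have last: "f ` ?T n = carrier N" using full f(2) by simp
  have sub: "submodule (f ` ?T i) R N \<and> finitely_presented R (N\<lparr>carrier := f ` ?T i\<rparr>)" for i
    using fin_gen_submodule[OF mN fgfT] finitely_presented_submodule[OF coh N fgfT] by blast
  show "N \<in> Filt R n (gen R M)"
    unfolding Filt_def
  proof (intro CollectI conjI N exI[of _ n] exI[of _ "\<lambda>i. f ` ?T i"])
    show "f ` ?T 0 = {\<zero>\<^bsub>N\<^esub>}" by (rule T0)
  qed (use last sub inc gen in auto)
qed

section \<open>The tensor product\<close>

lemma keys_diff_subset: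
  "Poly_Mapping.keys a \<subseteq> X \<Longrightarrow> Poly_Mapping.keys b \<subseteq> X \<Longrightarrow> Poly_Mapping.keys (a - b) \<subseteq> X"
  by (meson Un_least keys_diff order_trans)

lemma keys_add_subset:
  "Poly_Mapping.keys a \<subseteq> X \<Longrightarrow> Poly_Mapping.keys b \<subseteq> X \<Longrightarrow> Poly_Mapping.keys (a + b) \<subseteq> X"
  by (meson Un_least keys_add order_trans)

lemma tensor_relationsI:
  "s \<in> carrier S \<Longrightarrow> t \<in> carrier S \<Longrightarrow> x \<in> carrier N \<Longrightarrow>
     frag_of (s \<oplus>\<^bsub>S\<^esub> t, x) - frag_of (s, x) - frag_of (t, x) \<in> tensor_relations R S \<phi> N"
  "s \<in> carrier S \<Longrightarrow> x \<in> carrier N \<Longrightarrow> y \<in> carrier N \<Longrightarrow>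
     frag_of (s, x \<oplus>\<^bsub>N\<^esub> y) - frag_of (s, x) - frag_of (s, y) \<in> tensor_relations R S \<phi> N"
  "s \<in> carrier S \<Longrightarrow> r \<in> carrier R \<Longrightarrow> x \<in> carrier N \<Longrightarrow>
     frag_of (s \<otimes>\<^bsub>S\<^esub> \<phi> r, x) - frag_of (s, r \<odot>\<^bsub>N\<^esub> x) \<in> tensor_relations R S \<phi> N"
  unfolding tensor_relations_def by blast+

lemma tensor_relationsE:
  assumes "c \<in> tensor_relations R S \<phi> N"
  obtains (add_left) s t x where "s \<in> carrier S" "t \<in> carrier S" "x \<in> carrier N"
      "c = frag_of (s \<oplus>\<^bsub>S\<^esub> t, x) - frag_of (s, x) - frag_of (t, x)"
    | (add_right) s x y where "s \<in> carrier S" "x \<in> carrier N" "y \<in> carrier N"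
      "c = frag_of (s, x \<oplus>\<^bsub>N\<^esub> y) - frag_of (s, x) - frag_of (s, y)"
    | (balanced) s r x where "s \<in> carrier S" "r \<in> carrier R" "x \<in> carrier N"
      "c = frag_of (s \<otimes>\<^bsub>S\<^esub> \<phi> r, x) - frag_of (s, r \<odot>\<^bsub>N\<^esub> x)"
  using assms unfolding tensor_relations_def by blast

locale ring_change =
  fixes R :: "'r ring" and S :: "'s ring" and \<phi> :: "'r \<Rightarrow> 's"
  assumes cring_R: "cring R" and cring_S: "cring S" and ring_hom: "\<phi> \<in> ring_hom R S"
begin

sublocale R: cring R by (rule cring_R)
sublocale S: cring S by (rule cring_S)

lemma phi_closed [simp]: "r \<in> carrier R \<Longrightarrow> \<phi> r \<in> carrier S"
  using ring_hom_closed[OF ring_hom] .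

lemma phi_simps [simp]:
  "r \<in> carrier R \<Longrightarrow> t \<in> carrier R \<Longrightarrow> \<phi> (r \<oplus>\<^bsub>R\<^esub> t) = \<phi> r \<oplus>\<^bsub>S\<^esub> \<phi> t"
  "r \<in> carrier R \<Longrightarrow> t \<in> carrier R \<Longrightarrow> \<phi> (r \<otimes>\<^bsub>R\<^esub> t) = \<phi> r \<otimes>\<^bsub>S\<^esub> \<phi> t"
  "\<phi> \<one>\<^bsub>R\<^esub> = \<one>\<^bsub>S\<^esub>"
  "\<phi> \<zero>\<^bsub>R\<^esub> = \<zero>\<^bsub>S\<^esub>"
  using ring_hom_add[OF ring_hom] ring_hom_mult[OF ring_hom] ring_hom_one[OF ring_hom]
    ring_hom_zero[OF ring_hom R.ring_axioms S.ring_axioms] by auto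

end

locale scalar_extension = ring_change R S \<phi>
  for R :: "'r ring" and S :: "'s ring" and \<phi> :: "'r \<Rightarrow> 's" +
  fixes N :: "('r, 'a) module"
  assumes module_N: "Module.module R N"
begin

sublocale N: Module.module R N by (rule module_N)

abbreviation "G \<equiv> tensor_free S N"
abbreviation "K \<equiv> tensor_null R S \<phi> N"
abbreviation "T \<equiv> base_change R S \<phi> N"

definition cls :: "('s \<times> 'a \<Rightarrow>\<^sub>0 int) \<Rightarrow> ('s \<times> 'a \<Rightarrow>\<^sub>0 int) set" where
  "cls c = K #>\<^bsub>G\<^esub> c"

definition tens :: "'s \<Rightarrow> 'a \<Rightarrow> ('s \<times> 'a \<Rightarrow>\<^sub>0 int) set" where
  "tens s x = cls (frag_of (s, x))"

sublocale G: comm_group G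
  unfolding tensor_free_def by (rule abelian_free_Abelian_group)

lemma carrier_G: "c \<in> carrier G \<longleftrightarrow> Poly_Mapping.keys c \<subseteq> carrier S \<times> carrier N"
  by (simp add: tensor_free_def)

lemma mult_G [simp]: "a \<otimes>\<^bsub>G\<^esub> b = a + b" and one_G [simp]: "\<one>\<^bsub>G\<^esub> = 0"
  by (simp_all add: tensor_free_def)

lemma inv_G: "a \<in> carrier G \<Longrightarrow> inv\<^bsub>G\<^esub> a = - a"
  by (simp add: tensor_free_def)

lemma frag_of_G [simp]: "frag_of (s, x) \<in> carrier G \<longleftrightarrow> s \<in> carrier S \<and> x \<in> carrier N"
  by (simp add: carrier_G)

lemma diff_G: "a \<in> carrier G \<Longrightarrow> b \<in> carrier G \<Longrightarrow> a - b \<in> carrier G"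
  by (simp add: carrier_G keys_diff_subset)

lemma relations_subset: "tensor_relations R S \<phi> N \<subseteq> carrier G"
  unfolding tensor_relations_def by (auto intro!: diff_G simp del: frag_of_in_free_Abelian_group)

lemma K_subgroup: "subgroup K G"
  unfolding tensor_null_def by (rule G.generate_is_subgroup[OF relations_subset])

lemma K_normal: "K \<lhd> G"
  using K_subgroup G.normal_iff_subgroup by blast

lemma K_add: "a \<in> K \<Longrightarrow> b \<in> K \<Longrightarrow> a + b \<in> K"
  using subgroup.m_closed[OF K_subgroup] by simp

lemma K_zero: "0 \<in> K"
  using subgroup.one_closed[OF K_subgroup] by simp

lemma cls_eqI:
  assumes "a \<in> carrier G" "b \<in> carrier G" "a - b \<in> K"
  shows "cls a = cls b"
proof -
  have "a \<in> K #>\<^bsub>G\<^esub> b" unfolding r_coset_def using assms(3) by (auto intro!: bexI[of _ "a - b"])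
  then show ?thesis unfolding cls_def by (rule G.repr_independence[OF _ assms(2) K_subgroup, symmetric])
qed

lemma cls_null: "k \<in> K \<Longrightarrow> cls k = \<zero>\<^bsub>T\<^esub>"
  unfolding cls_def using subgroup.mem_carrier[OF K_subgroup]
  by (simp add: base_change_def Let_def G.coset_join2 K_subgroup)

lemma carrier_T: "carrier T = cls ` carrier G"
  by (auto simp: base_change_def Let_def carrier_FactGroup cls_def)

lemma cls_add: "a \<in> carrier G \<Longrightarrow> b \<in> carrier G \<Longrightarrow> cls a \<oplus>\<^bsub>T\<^esub> cls b = cls (a + b)"
  using normal.rcos_sum[OF K_normal] by (simp add: base_change_def Let_def cls_def)

lemma cls_zero: "cls 0 = \<zero>\<^bsub>T\<^esub>"
  by (rule cls_null[OF K_zero])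

lemma abelian_group_T: "abelian_group T"
proof (rule abelian_groupI)
  fix x assume "x \<in> carrier T"
  then obtain a where a: "a \<in> carrier G" "x = cls a" unfolding carrier_T by blast
  have "- a \<in> carrier G" using a(1) by (simp add: carrier_G)
  then show "\<exists>y\<in>carrier T. y \<oplus>\<^bsub>T\<^esub> x = \<zero>\<^bsub>T\<^esub>"
    unfolding carrier_T using a by (auto simp: cls_add cls_zero intro!: bexI[of _ "- a"])
  show "\<zero>\<^bsub>T\<^esub> \<oplus>\<^bsub>T\<^esub> x = x" using a by (simp add: cls_zero[symmetric] cls_add carrier_G)
next
  show "\<zero>\<^bsub>T\<^esub> \<in> carrier T" unfolding carrier_T cls_zero[symmetric] by (auto simp: carrier_G)
qed (auto simp: carrier_T cls_add add_ac carrier_G keys_add_subset)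

text \<open>
  A map of free groups that respects the defining relations respects the subgroup generated by them.
  The target group is left abstract, as it is the free group of another module below.
\<close>

lemma additive_image_null:
  assumes H: "subgroup H G'" and mult: "\<And>a b. a \<otimes>\<^bsub>G'\<^esub> b = a + b"
    and inv: "\<And>a. a \<in> H \<Longrightarrow> inv\<^bsub>G'\<^esub> a = - a" and one: "\<one>\<^bsub>G'\<^esub> = 0"
    and rel: "\<And>c. c \<in> tensor_relations R S \<phi> N \<Longrightarrow> frag_extend f c \<in> H"
    and k: "k \<in> K"
  shows "frag_extend f k \<in> H"
  using k unfolding tensor_null_def
proof induction
  case one
  then show ?case using subgroup.one_closed[OF H] assms(4) by simp
next
  case (incl h)
  then show ?case by (rule rel)
next
  case (inv h)
  then have "inv\<^bsub>G\<^esub> h = - h" using inv_G relations_subset by blast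
  moreover have "- frag_extend f h \<in> H"
    using subgroup.m_inv_closed[OF H rel[OF inv]] assms(3)[OF rel[OF inv]] by simp
  ultimately show ?case by (simp add: frag_extend_minus)
next
  case (eng h1 h2)
  then show ?case using subgroup.m_closed[OF H, of "frag_extend f h1" "frag_extend f h2"]
    by (simp add: frag_extend_add mult)
qed

text \<open>Pure tensors generate \<open>T\<close> as an abelian group, hence additive maps out of \<open>T\<close> are
  determined by their values on them.\<close>

lemma additive_eqI:
  assumes C: "abelian_group C"
    and f: "\<And>x. x \<in> carrier T \<Longrightarrow> f x \<in> carrier C" "\<And>x y. x \<in> carrier T \<Longrightarrow> y \<in> carrier T \<Longrightarrow> f (x \<oplus>\<^bsub>T\<^esub> y) = f x \<oplus>\<^bsub>C\<^esub> f y"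
    and g: "\<And>x. x \<in> carrier T \<Longrightarrow> g x \<in> carrier C" "\<And>x y. x \<in> carrier T \<Longrightarrow> y \<in> carrier T \<Longrightarrow> g (x \<oplus>\<^bsub>T\<^esub> y) = g x \<oplus>\<^bsub>C\<^esub> g y"
    and eq: "\<And>s x. s \<in> carrier S \<Longrightarrow> x \<in> carrier N \<Longrightarrow> f (tens s x) = g (tens s x)"
    and z: "z \<in> carrier T"
  shows "f z = g z"
proof -
  interpret T: abelian_group T by (rule abelian_group_T)
  interpret C: abelian_group C by (rule C)
  have zero: "h \<zero>\<^bsub>T\<^esub> = \<zero>\<^bsub>C\<^esub>" if "\<And>x. x \<in> carrier T \<Longrightarrow> h x \<in> carrier C"
    "\<And>x y. x \<in> carrier T \<Longrightarrow> y \<in> carrier T \<Longrightarrow> h (x \<oplus>\<^bsub>T\<^esub> y) = h x \<oplus>\<^bsub>C\<^esub> h y" for h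
  proof -
    have "h \<zero>\<^bsub>T\<^esub> \<oplus>\<^bsub>C\<^esub> h \<zero>\<^bsub>T\<^esub> = h \<zero>\<^bsub>T\<^esub>" using that(2)[of "\<zero>\<^bsub>T\<^esub>" "\<zero>\<^bsub>T\<^esub>"] by simp
    then show ?thesis using that(1)[of "\<zero>\<^bsub>T\<^esub>"] by (simp add: C.add.r_cancel_one)
  qed
  obtain c where c: "c \<in> carrier G" "z = cls c" using z unfolding carrier_T by blast
  have "Poly_Mapping.keys c \<subseteq> carrier S \<times> carrier N" using c(1) by (simp add: carrier_G)
  then have "f (cls c) = g (cls c)"
  proof (rule free_Abelian_group_induct)
    show "f (cls 0) = g (cls 0)" unfolding cls_zero using zero[OF f] zero[OF g] by simp
    show "f (cls (frag_of a)) = g (cls (frag_of a))" if "a \<in> carrier S \<times> carrier N" for a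
      using that eq unfolding tens_def by (cases a) auto
    fix x y assume "Poly_Mapping.keys x \<subseteq> carrier S \<times> carrier N" "Poly_Mapping.keys y \<subseteq> carrier S \<times> carrier N"
      and IH: "f (cls x) = g (cls x)" "f (cls y) = g (cls y)"
    then have xy: "x \<in> carrier G" "y \<in> carrier G" by (auto simp: carrier_G)
    have d: "x - y \<in> carrier G" by (rule diff_G[OF xy])
    have m: "cls x \<in> carrier T" "cls y \<in> carrier T" "cls (x - y) \<in> carrier T"
      unfolding carrier_T using xy d by auto
    have "cls (x - y) \<oplus>\<^bsub>T\<^esub> cls y = cls x" using cls_add[OF d xy(2)] by simp
    then have "f (cls (x - y)) \<oplus>\<^bsub>C\<^esub> f (cls y) = g (cls (x - y)) \<oplus>\<^bsub>C\<^esub> f (cls y)"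
      using f(2)[OF m(3,2)] g(2)[OF m(3,2)] IH by simp
    then show "f (cls (x - y)) = g (cls (x - y))"
      using f(1) g(1) m by (simp add: C.add.right_cancel)
  qed
  then show ?thesis using c by simp
qed

lemma tens_closed: "s \<in> carrier S \<Longrightarrow> x \<in> carrier N \<Longrightarrow> tens s x \<in> carrier T"
  unfolding tens_def carrier_T by simp

lemma relation_null: "c \<in> tensor_relations R S \<phi> N \<Longrightarrow> c \<in> K"
  unfolding tensor_null_def by (rule generate.incl)

lemma tens_add_left:
  assumes "s \<in> carrier S" "t \<in> carrier S" "x \<in> carrier N"
  shows "tens (s \<oplus>\<^bsub>S\<^esub> t) x = tens s x \<oplus>\<^bsub>T\<^esub> tens t x"
proof -
  have "frag_of (s \<oplus>\<^bsub>S\<^esub> t, x) - frag_of (s, x) - frag_of (t, x) \<in> tensor_relations R S \<phi> N"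
    unfolding tensor_relations_def using assms by blast
  then have "frag_of (s \<oplus>\<^bsub>S\<^esub> t, x) - (frag_of (s, x) + frag_of (t, x)) \<in> K"
    using relation_null by (simp add: diff_diff_add)
  then show ?thesis unfolding tens_def using assms by (simp add: cls_add cls_eqI carrier_G keys_add_subset)
qed

lemma tens_add_right:
  assumes "s \<in> carrier S" "x \<in> carrier N" "y \<in> carrier N"
  shows "tens s (x \<oplus>\<^bsub>N\<^esub> y) = tens s x \<oplus>\<^bsub>T\<^esub> tens s y"
proof -
  have "frag_of (s, x \<oplus>\<^bsub>N\<^esub> y) - frag_of (s, x) - frag_of (s, y) \<in> tensor_relations R S \<phi> N"
    unfolding tensor_relations_def using assms by blast
  then have "frag_of (s, x \<oplus>\<^bsub>N\<^esub> y) - (frag_of (s, x) + frag_of (s, y)) \<in> K"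
    using relation_null by (simp add: diff_diff_add)
  then show ?thesis unfolding tens_def using assms by (simp add: cls_add cls_eqI carrier_G keys_add_subset)
qed

lemma tens_balanced:
  assumes "s \<in> carrier S" "r \<in> carrier R" "x \<in> carrier N"
  shows "tens s (r \<odot>\<^bsub>N\<^esub> x) = tens (s \<otimes>\<^bsub>S\<^esub> \<phi> r) x"
proof -
  have "frag_of (s \<otimes>\<^bsub>S\<^esub> \<phi> r, x) - frag_of (s, r \<odot>\<^bsub>N\<^esub> x) \<in> tensor_relations R S \<phi> N"
    unfolding tensor_relations_def using assms by blast
  then show ?thesis unfolding tens_def using assms relation_null by (intro cls_eqI[symmetric]) auto
qed

end

text \<open>
  Both the scalar action and the functoriality of the tensor product are defined by applying a map
  of free groups to all elements of a coset and enlarging the result.  On the coset of \<open>c\<close> this gives the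
  coset of the image of \<open>c\<close>.
\<close>

lemma frag_extend_coset:
  assumes X: "scalar_extension R S \<phi> A" and Y: "scalar_extension R S \<phi> B"
    and null: "\<And>k. k \<in> tensor_null R S \<phi> A \<Longrightarrow> frag_extend f k \<in> tensor_null R S \<phi> B"
  shows "tensor_null R S \<phi> B <#>\<^bsub>tensor_free S B\<^esub> frag_extend f ` (tensor_null R S \<phi> A #>\<^bsub>tensor_free S A\<^esub> c)
    = tensor_null R S \<phi> B #>\<^bsub>tensor_free S B\<^esub> frag_extend f c"
proof -
  interpret A: scalar_extension R S \<phi> A by (rule X)
  interpret B: scalar_extension R S \<phi> B by (rule Y)
  show ?thesis
  proof (intro equalityI subsetI)
    fix z assume "z \<in> B.K <#>\<^bsub>B.G\<^esub> frag_extend f ` (A.K #>\<^bsub>A.G\<^esub> c)"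
    then obtain h k where "h \<in> B.K" "k \<in> A.K" "z = h + (frag_extend f k + frag_extend f c)"
      unfolding set_mult_def r_coset_def by (auto simp: frag_extend_add)
    then show "z \<in> B.K #>\<^bsub>B.G\<^esub> frag_extend f c"
      unfolding r_coset_def using null B.K_add by (auto simp: add.assoc[symmetric])
  next
    fix z assume "z \<in> B.K #>\<^bsub>B.G\<^esub> frag_extend f c"
    then obtain h where "h \<in> B.K" "z = h + frag_extend f (0 + c)"
      unfolding r_coset_def by auto
    then show "z \<in> B.K <#>\<^bsub>B.G\<^esub> frag_extend f ` (A.K #>\<^bsub>A.G\<^esub> c)"
      unfolding set_mult_def r_coset_def using A.K_zero by force
  qed
qed

context scalar_extension
begin

lemma scale_null:
  assumes t: "t \<in> carrier S" and k: "k \<in> K"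
  shows "frag_extend (\<lambda>(s, x). frag_of (t \<otimes>\<^bsub>S\<^esub> s, x)) k \<in> K"
proof (rule additive_image_null[OF K_subgroup _ _ _ _ k])
  fix c assume "c \<in> tensor_relations R S \<phi> N"
  then have "frag_extend (\<lambda>(s, x). frag_of (t \<otimes>\<^bsub>S\<^esub> s, x)) c \<in> tensor_relations R S \<phi> N"
  proof (cases rule: tensor_relationsE)
    case (add_left s u x)
    then show ?thesis
      using tensor_relationsI(1)[of "t \<otimes>\<^bsub>S\<^esub> s" S "t \<otimes>\<^bsub>S\<^esub> u" x N R \<phi>] t
      by (simp add: frag_extend_diff S.r_distr)
  next
    case (add_right s x y)
    then show ?thesis
      using tensor_relationsI(2)[of "t \<otimes>\<^bsub>S\<^esub> s" S x N y R \<phi>] t by (simp add: frag_extend_diff)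
  next
    case (balanced s r x)
    then show ?thesis
      using tensor_relationsI(3)[of "t \<otimes>\<^bsub>S\<^esub> s" S r R x N \<phi>] t
      by (simp add: frag_extend_diff S.m_assoc)
  qed
  then show "frag_extend (\<lambda>(s, x). frag_of (t \<otimes>\<^bsub>S\<^esub> s, x)) c \<in> K" by (rule relation_null)
qed (auto intro: inv_G subgroup.mem_carrier[OF K_subgroup])

lemma smult_cls:
  assumes "t \<in> carrier S"
  shows "t \<odot>\<^bsub>T\<^esub> cls c = cls (frag_extend (\<lambda>(s, x). frag_of (t \<otimes>\<^bsub>S\<^esub> s, x)) c)"
  unfolding cls_def
  using frag_extend_coset[OF scalar_extension_axioms scalar_extension_axioms scale_null[OF assms]]
  by (simp add: base_change_def Let_def)

lemma scale_closed:
  assumes "t \<in> carrier S" "c \<in> carrier G"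
  shows "frag_extend (\<lambda>(s, x). frag_of (t \<otimes>\<^bsub>S\<^esub> s, x)) c \<in> carrier G"
  unfolding carrier_G using assms(2)
  by (intro order_trans[OF keys_frag_extend]) (auto simp: carrier_G assms(1) split: prod.splits)

lemma smult_tens:
  "t \<in> carrier S \<Longrightarrow> t \<odot>\<^bsub>T\<^esub> tens s x = tens (t \<otimes>\<^bsub>S\<^esub> s) x"
  unfolding tens_def by (simp add: smult_cls)

lemma smult_T_closed: "t \<in> carrier S \<Longrightarrow> z \<in> carrier T \<Longrightarrow> t \<odot>\<^bsub>T\<^esub> z \<in> carrier T"
  unfolding carrier_T by (auto simp: smult_cls scale_closed)

lemma smult_T_add:
  "t \<in> carrier S \<Longrightarrow> y \<in> carrier T \<Longrightarrow> z \<in> carrier T \<Longrightarrow> t \<odot>\<^bsub>T\<^esub> (y \<oplus>\<^bsub>T\<^esub> z) = t \<odot>\<^bsub>T\<^esub> y \<oplus>\<^bsub>T\<^esub> t \<odot>\<^bsub>T\<^esub> z"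
  unfolding carrier_T by (auto simp: smult_cls scale_closed cls_add frag_extend_add)

lemma module_T: "Module.module S T"
proof (rule moduleI[OF cring_S abelian_group_T smult_T_closed _ smult_T_add])
  interpret T: abelian_group T by (rule abelian_group_T)
  fix z assume z: "z \<in> carrier T"
  show "\<one>\<^bsub>S\<^esub> \<odot>\<^bsub>T\<^esub> z = z"
    by (rule additive_eqI[OF abelian_group_T _ _ _ _ _ z]) (auto simp: smult_T_closed smult_T_add smult_tens)
  fix a b assume ab: "a \<in> carrier S" "b \<in> carrier S"
  show "(a \<oplus>\<^bsub>S\<^esub> b) \<odot>\<^bsub>T\<^esub> z = a \<odot>\<^bsub>T\<^esub> z \<oplus>\<^bsub>T\<^esub> b \<odot>\<^bsub>T\<^esub> z"
    by (rule additive_eqI[OF abelian_group_T _ _ _ _ _ z])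
      (auto simp: smult_T_closed smult_T_add smult_tens ab T.a_ac S.l_distr tens_add_left)
  show "(a \<otimes>\<^bsub>S\<^esub> b) \<odot>\<^bsub>T\<^esub> z = a \<odot>\<^bsub>T\<^esub> (b \<odot>\<^bsub>T\<^esub> z)"
    by (rule additive_eqI[OF abelian_group_T _ _ _ _ _ z])
      (auto simp: smult_T_closed smult_T_add smult_tens ab S.m_assoc)
qed

text \<open>
  The additive extension of \<open>c\<close> to the free group kills the relations, hence factors through the
  cosets; linearity of the factor is checked on pure tensors.
\<close>

lemma tensor_universal:
  assumes P: "Module.module S P"
    and c: "\<And>s x. s \<in> carrier S \<Longrightarrow> x \<in> carrier N \<Longrightarrow> c s x \<in> carrier P"
    and addl: "\<And>s t x. s \<in> carrier S \<Longrightarrow> t \<in> carrier S \<Longrightarrow> x \<in> carrier N \<Longrightarrow> c (s \<oplus>\<^bsub>S\<^esub> t) x = c s x \<oplus>\<^bsub>P\<^esub> c t x"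
    and addr: "\<And>s x y. s \<in> carrier S \<Longrightarrow> x \<in> carrier N \<Longrightarrow> y \<in> carrier N \<Longrightarrow> c s (x \<oplus>\<^bsub>N\<^esub> y) = c s x \<oplus>\<^bsub>P\<^esub> c s y"
    and bal: "\<And>s r x. s \<in> carrier S \<Longrightarrow> r \<in> carrier R \<Longrightarrow> x \<in> carrier N \<Longrightarrow> c (s \<otimes>\<^bsub>S\<^esub> \<phi> r) x = c s (r \<odot>\<^bsub>N\<^esub> x)"
    and lin: "\<And>t s x. t \<in> carrier S \<Longrightarrow> s \<in> carrier S \<Longrightarrow> x \<in> carrier N \<Longrightarrow> c (t \<otimes>\<^bsub>S\<^esub> s) x = t \<odot>\<^bsub>P\<^esub> c s x"
  obtains h where "h \<in> module_homs S T P"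
    "\<And>s x. s \<in> carrier S \<Longrightarrow> x \<in> carrier N \<Longrightarrow> h (tens s x) = c s x"
proof -
  interpret P: Module.module S P by (rule P)
  have comm: "comm_group (add_monoid P)" by (rule P.M.a_comm_group)
  obtain h where h: "h \<in> hom (free_Abelian_group (carrier S \<times> carrier N)) (add_monoid P)"
    "\<And>p. p \<in> carrier S \<times> carrier N \<Longrightarrow> h (frag_of p) = (\<lambda>(s, x). c s x) p"
    by (rule comm_group.free_Abelian_group_universal[OF comm, of "\<lambda>(s, x). c s x" "carrier S \<times> carrier N"])
      (use c in auto)
  have hG: "h \<in> hom G (add_monoid P)" using h(1) by (simp add: tensor_free_def)
  have hof: "h (frag_of (s, x)) = c s x" if "s \<in> carrier S" "x \<in> carrier N" for s x
    using h(2)[of "(s, x)"] that by simp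
  interpret h: group_hom G "add_monoid P" h
    by (intro group_hom.intro group_hom_axioms.intro hG G.is_group comm_group.axioms(2)[OF comm])
  have hadd: "h (a + b) = h a \<oplus>\<^bsub>P\<^esub> h b" if "a \<in> carrier G" "b \<in> carrier G" for a b
    using h.hom_mult[OF that] by simp
  have hcl: "h a \<in> carrier P" if "a \<in> carrier G" for a using h.hom_closed[OF that] by simp
  have hdiff: "h (a - b) = h a \<ominus>\<^bsub>P\<^esub> h b" if "a \<in> carrier G" "b \<in> carrier G" for a b
  proof -
    have "h (a - b) \<oplus>\<^bsub>P\<^esub> h b = h a" using hadd[OF diff_G[OF that] that(2)] by simp
    then show ?thesis using hcl that diff_G[OF that] by (metis P.M.minus_eq P.M.add.inv_solve_right)
  qed
  have rel: "h k = \<zero>\<^bsub>P\<^esub>" if "k \<in> tensor_relations R S \<phi> N" for k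
  proof -
    have cancel: "p \<oplus>\<^bsub>P\<^esub> q \<ominus>\<^bsub>P\<^esub> p \<ominus>\<^bsub>P\<^esub> q = \<zero>\<^bsub>P\<^esub>" if "p \<in> carrier P" "q \<in> carrier P" for p q
    proof -
      have "p \<oplus>\<^bsub>P\<^esub> q \<ominus>\<^bsub>P\<^esub> p \<ominus>\<^bsub>P\<^esub> q = (p \<oplus>\<^bsub>P\<^esub> q) \<oplus>\<^bsub>P\<^esub> (\<ominus>\<^bsub>P\<^esub> (p \<oplus>\<^bsub>P\<^esub> q))"
        using that by (simp add: P.M.minus_eq P.M.minus_add P.M.a_assoc)
      then show ?thesis using that by (simp add: P.M.r_neg)
    qed
    from that show ?thesis
      by (cases rule: tensor_relationsE)
        (simp_all add: hdiff diff_G hof addl addr bal c cancel P.M.minus_eq_zero_iff)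
  qed
  have "tensor_relations R S \<phi> N \<subseteq> kernel G (add_monoid P) h"
    unfolding kernel_def using rel relations_subset by auto
  then have K: "K \<subseteq> kernel G (add_monoid P) h"
    unfolding tensor_null_def by (rule G.generate_subgroup_incl[OF _ h.subgroup_kernel])
  have heq: "h a = h b" if "a \<in> carrier G" "b \<in> carrier G" "K #>\<^bsub>G\<^esub> a = K #>\<^bsub>G\<^esub> b" for a b
  proof -
    have "a \<in> K #>\<^bsub>G\<^esub> b" using G.rcos_self[OF that(1) K_subgroup] that(3) by simp
    then obtain k where k: "k \<in> K" "a = k + b" unfolding r_coset_def by auto
    then have "h k = \<zero>\<^bsub>P\<^esub>" "k \<in> carrier G" using K unfolding kernel_def by auto
    then show ?thesis using k(2) hadd that(2) hcl by simp
  qed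
  obtain g where g: "g \<in> hom (G Mod K) (add_monoid P)" "\<And>a. a \<in> carrier G \<Longrightarrow> g (K #>\<^bsub>G\<^esub> a) = h a"
    by (rule FactGroup_universal[OF hG K_normal heq]; (assumption | (rule that; assumption)))
  have g_tens: "g (tens s x) = c s x" if "s \<in> carrier S" "x \<in> carrier N" for s x
    unfolding tens_def cls_def using that g(2) hof by simp
  have g_closed: "g z \<in> carrier P" if "z \<in> carrier T" for z
    using that g(2) hcl unfolding carrier_T by (auto simp: cls_def)
  have g_add: "g (y \<oplus>\<^bsub>T\<^esub> z) = g y \<oplus>\<^bsub>P\<^esub> g z" if yz: "y \<in> carrier T" "z \<in> carrier T" for y z
  proof -
    obtain a b where ab: "a \<in> carrier G" "y = cls a" "b \<in> carrier G" "z = cls b"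
      using yz unfolding carrier_T by blast
    have "a + b \<in> carrier G" using ab by (simp add: carrier_G keys_add_subset)
    then show ?thesis
      unfolding ab(2,4) cls_add[OF ab(1,3)] using ab g(2) hadd by (simp add: cls_def)
  qed
  have "g \<in> module_homs S T P"
  proof (rule module_homsI[OF g_closed g_add])
    fix t z assume t: "t \<in> carrier S" and z: "z \<in> carrier T"
    show "g (t \<odot>\<^bsub>T\<^esub> z) = t \<odot>\<^bsub>P\<^esub> g z"
      by (rule additive_eqI[OF P.M.abelian_group_axioms _ _ _ _ _ z])
        (auto simp: t g_closed g_add g_tens smult_T_closed smult_T_add smult_tens lin P.smult_r_distr)
  qed
  then show ?thesis using g_tens by (rule that)
qed

text \<open>
  The projection modulo \<open>H\<close> and the zero map agree on pure tensors.
\<close>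

lemma submodule_containing_tensors:
  assumes H: "submodule H S T" and tens: "\<And>s x. s \<in> carrier S \<Longrightarrow> x \<in> carrier N \<Longrightarrow> tens s x \<in> H"
  shows "H = carrier T"
proof
  note Q = quotient_module[OF module_T H]
  interpret Q: Module.module S "quotient_module T H" by (rule Q(1))
  show "H \<subseteq> carrier T" by (rule submoduleD(1)[OF module_T H])
  show "carrier T \<subseteq> H"
  proof
    fix z assume z: "z \<in> carrier T"
    have "H +>\<^bsub>T\<^esub> z = \<zero>\<^bsub>quotient_module T H\<^esub>"
    proof (rule additive_eqI[OF Q.M.abelian_group_axioms _ _ _ _ _ z])
      show "H +>\<^bsub>T\<^esub> tens s x = \<zero>\<^bsub>quotient_module T H\<^esub>" if "s \<in> carrier S" "x \<in> carrier N" for s x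
        using Q(4) tens[OF that] unfolding a_kernel_eq by blast
    qed (use module_homsD[OF Q(2)] in auto)
    then show "z \<in> H" using Q(4) z unfolding a_kernel_eq by blast
  qed
qed

end

lemma base_change_map_tens:
  assumes X: "scalar_extension R S \<phi> A" and Y: "scalar_extension R S \<phi> B" and f: "f \<in> module_homs R A B"
  shows "base_change_map R S \<phi> B f \<in> module_homs S (base_change R S \<phi> A) (base_change R S \<phi> B)"
    and "base_change_map R S \<phi> B f (scalar_extension.tens R S \<phi> A s x) = scalar_extension.tens R S \<phi> B s (f x)"
proof -
  interpret A: scalar_extension R S \<phi> A by (rule X)
  interpret B: scalar_extension R S \<phi> B by (rule Y)
  let ?F = "frag_extend (\<lambda>(s, x). frag_of (s, f x))"
  note f' = module_homsD[OF f]
  have null: "?F k \<in> B.K" if k: "k \<in> A.K" for k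
  proof (rule A.additive_image_null[OF B.K_subgroup _ _ _ _ k])
    fix c assume "c \<in> tensor_relations R S \<phi> A"
    then have "?F c \<in> tensor_relations R S \<phi> B"
    proof (cases rule: tensor_relationsE)
      case (add_left s u x)
      then show ?thesis
        using tensor_relationsI(1)[of s S u "f x" B R \<phi>] by (simp add: frag_extend_diff f')
    next
      case (add_right s x y)
      then show ?thesis
        using tensor_relationsI(2)[of s S "f x" B "f y" R \<phi>] by (simp add: frag_extend_diff f')
    next
      case (balanced s r x)
      then show ?thesis
        using tensor_relationsI(3)[of s S r R "f x" B \<phi>] by (simp add: frag_extend_diff f')
    qed
    then show "?F c \<in> B.K" by (rule B.relation_null)
  qed (auto intro: B.inv_G subgroup.mem_carrier[OF B.K_subgroup])
  have cls: "base_change_map R S \<phi> B f (A.cls c) = B.cls (?F c)" for c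
    unfolding A.cls_def B.cls_def base_change_map_def by (rule frag_extend_coset[OF X Y null])
  show tens: "base_change_map R S \<phi> B f (A.tens s x) = B.tens s (f x)" for s x
    unfolding A.tens_def B.tens_def cls by simp
  have Fcl: "?F c \<in> carrier B.G" if "c \<in> carrier A.G" for c
    unfolding B.carrier_G using that
    by (intro order_trans[OF keys_frag_extend]) (auto simp: A.carrier_G f' split: prod.splits)
  have cl: "base_change_map R S \<phi> B f z \<in> carrier B.T" if "z \<in> carrier A.T" for z
    using that unfolding A.carrier_T B.carrier_T by (auto simp: cls Fcl)
  have add: "base_change_map R S \<phi> B f (y \<oplus>\<^bsub>A.T\<^esub> z) = base_change_map R S \<phi> B f y \<oplus>\<^bsub>B.T\<^esub> base_change_map R S \<phi> B f z"
    if "y \<in> carrier A.T" "z \<in> carrier A.T" for y z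
    using that unfolding A.carrier_T by (auto simp: A.cls_add B.cls_add cls Fcl frag_extend_add)
  show "base_change_map R S \<phi> B f \<in> module_homs S A.T B.T"
  proof (rule module_homsI[OF cl add])
    fix t z assume t: "t \<in> carrier S" and z: "z \<in> carrier A.T"
    show "base_change_map R S \<phi> B f (t \<odot>\<^bsub>A.T\<^esub> z) = t \<odot>\<^bsub>B.T\<^esub> base_change_map R S \<phi> B f z"
      by (rule A.additive_eqI[OF B.abelian_group_T _ _ _ _ _ z])
        (auto simp: t A.smult_T_closed B.smult_T_closed A.smult_T_add B.smult_T_add cl add A.smult_tens B.smult_tens tens)
  qed
qed

section \<open>Base change of free modules and of presentations\<close>

text \<open>
  Semilinear maps into an \<open>S\<close>-module \<open>B\<close> are the linear maps into \<open>restrict_scalars \<phi> B\<close>; so the results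
  on linear maps apply to them.
\<close>

definition restrict_scalars :: "('r \<Rightarrow> 's) \<Rightarrow> ('s, 'a) module \<Rightarrow> ('r, 'a) module" where
  "restrict_scalars \<phi> B =
     \<lparr>carrier = carrier B, monoid.mult = undefined, monoid.one = undefined,
      ring.zero = \<zero>\<^bsub>B\<^esub>, ring.add = ring.add B, smult = (\<lambda>r. smult B (\<phi> r))\<rparr>"

lemma restrict_scalars_simps [simp]:
  "carrier (restrict_scalars \<phi> B) = carrier B"
  "\<zero>\<^bsub>restrict_scalars \<phi> B\<^esub> = \<zero>\<^bsub>B\<^esub>"
  "x \<oplus>\<^bsub>restrict_scalars \<phi> B\<^esub> y = x \<oplus>\<^bsub>B\<^esub> y"
  "r \<odot>\<^bsub>restrict_scalars \<phi> B\<^esub> x = \<phi> r \<odot>\<^bsub>B\<^esub> x"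
  by (simp_all add: restrict_scalars_def)

context ring_change
begin

definition vec_map :: "'i set \<Rightarrow> ('i \<Rightarrow> 'r) \<Rightarrow> 'i \<Rightarrow> 's" where
  "vec_map I v = (\<lambda>i\<in>I. \<phi> (v i))"

lemma module_restrict_scalars:
  assumes "Module.module S B"
  shows "Module.module R (restrict_scalars \<phi> B)"
proof -
  interpret B: Module.module S B by (rule assms)
  have "abelian_group (restrict_scalars \<phi> B)"
    by (rule abelian_groupI) (auto simp: B.M.a_ac B.M.r_neg intro!: bexI[of _ "\<ominus>\<^bsub>B\<^esub> x" for x])
  then show ?thesis
    by (rule moduleI[OF cring_R]) (auto simp: B.smult_l_distr B.smult_r_distr B.smult_assoc1)
qed

lemma submodule_restrict_scalars:
  assumes "Module.module S B" "submodule H S B"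
  shows "submodule H R (restrict_scalars \<phi> B)"
  using submoduleD[OF assms] by (intro submodule_if_closed module_restrict_scalars assms(1)) auto

lemma restrict_scalars_hom:
  "f \<in> module_homs S A B \<Longrightarrow> f \<in> module_homs R (restrict_scalars \<phi> A) (restrict_scalars \<phi> B)"
  by (rule module_homsI) (auto simp: module_homsD)

lemma vec_map_hom: "vec_map I \<in> module_homs R (free R I) (restrict_scalars \<phi> (free S I))"
  unfolding vec_map_def
  by (rule module_homsI) (auto simp: product_module_simps PiE_const_mem intro!: restrict_ext)

lemmas vec_map_homD = module_homsD[OF vec_map_hom, simplified]

lemma vec_map_unit: "vec_map I (unit_vec R I i) = unit_vec S I i"
  by (auto simp: vec_map_def unit_vec_def coord_incl_def intro!: restrict_ext)

lemma vec_map_zero: "vec_map I \<zero>\<^bsub>free R I\<^esub> = \<zero>\<^bsub>free S I\<^esub>"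
  using module_hom_zero[OF module_free_module[OF cring_R] module_restrict_scalars[OF module_free_module[OF cring_S]] vec_map_hom]
  by simp

lemma vec_map_image: "X \<subseteq> carrier (free R I) \<Longrightarrow> vec_map I ` X \<subseteq> carrier (free S I)"
  using vec_map_homD(1) by blast

abbreviation ext_span :: "'i set \<Rightarrow> ('i \<Rightarrow> 'r) set \<Rightarrow> ('i \<Rightarrow> 's) set" where
  "ext_span I X \<equiv> mspan S (free S I) (vec_map I ` X)"

lemma mspan_vec_map:
  assumes "X \<subseteq> carrier (free R I)"
  shows "ext_span I (mspan R (free R I) X) = ext_span I X"
proof
  note FR = module_free_module[OF cring_R, of I] note FS = module_free_module[OF cring_S, of I]
  have H: "submodule (ext_span I X) S (free S I)"
    by (rule submodule_mspan[OF FS vec_map_image[OF assms]])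
  have "mspan R (free R I) X \<subseteq> {v \<in> carrier (free R I). vec_map I v \<in> ext_span I X}"
    using assms mspan_superset[of "vec_map I ` X" S "free S I"]
    by (intro mspan_least FR submodule_preimage[OF FR module_restrict_scalars[OF FS] vec_map_hom]
        submodule_restrict_scalars FS H) blast
  then show "ext_span I (mspan R (free R I) X) \<subseteq> ext_span I X"
    by (intro mspan_subset_mspan) blast
  show "ext_span I X \<subseteq> ext_span I (mspan R (free R I) X)"
    by (intro mspan_mono image_mono mspan_superset)
qed

lemma fin_gen_vec_map:
  assumes "fin_gen R (free R I) W"
  shows "fin_gen S (free S I) (ext_span I W)"
proof -
  obtain X where X: "finite X" "X \<subseteq> carrier (free R I)" "W = mspan R (free R I) X"
    using assms by (auto simp: fin_gen_def)
  show ?thesis unfolding X(3) mspan_vec_map[OF X(2)]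
    by (intro fin_genI finite_imageI X(1) vec_map_image X(2))
qed

text \<open>A linear map between free modules and its extension of scalars are compared on unit vectors.\<close>

lemma vec_map_commute:
  assumes "finite I" and h: "h \<in> module_homs R (free R I) (free R J)"
    and h': "h' \<in> module_homs S (free S I) (free S J)"
    and u: "\<And>i. i \<in> I \<Longrightarrow> h' (unit_vec S I i) = vec_map J (h (unit_vec R I i))"
    and v: "v \<in> carrier (free R I)"
  shows "h' (vec_map I v) = vec_map J (h v)"
  by (rule free_hom_eqI[OF module_restrict_scalars[OF module_free_module[OF cring_S]] assms(1)
        module_homs_comp[OF vec_map_hom restrict_scalars_hom[OF h']] module_homs_comp[OF h vec_map_hom] _ v])
    (simp add: u vec_map_unit)

lemma extend_scalars:
  assumes "finite I" and h: "h \<in> module_homs R (free R I) (free R J)"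
  obtains h' where "h' \<in> module_homs S (free S I) (free S J)"
    "\<And>v. v \<in> carrier (free R I) \<Longrightarrow> h' (vec_map I v) = vec_map J (h v)"
proof -
  note l = lincomb[OF module_free_module[OF cring_S] assms(1), of "\<lambda>i. vec_map J (h (unit_vec R I i))" J,
      OF vec_map_homD(1)[OF module_homsD(1)[OF h unit_vec_closed[OF cring_R]]]]
  show ?thesis
    by (rule that[OF l(1)]) (rule vec_map_commute[OF assms l(1) l(2)])
qed

end

context scalar_extension
begin

lemma tens_one_hom: "tens \<one>\<^bsub>S\<^esub> \<in> module_homs R N (restrict_scalars \<phi> T)"
  by (rule module_homsI) (auto simp: tens_closed tens_add_right tens_balanced smult_tens)

text \<open>
  The universal property provides the map \<open>s \<otimes> x \<mapsto> s \<cdot> v\<close> from the tensor product to the quotient of \<open>S\<^sup>I\<close> by the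
  old relations, where \<open>v\<close> is any lift of \<open>x\<close>.  It is inverse to the map induced by \<open>f'\<close>, so \<open>f'\<close> has no
  further relations: a presentation of \<open>N\<close> and its base change have the same matrix.
\<close>

theorem base_change_presentation:
  assumes I: "finite I" and f: "f \<in> module_homs R (free R I) N" "f ` carrier (free R I) = carrier N"
  obtains f' where "f' \<in> module_homs S (free S I) T"
    "\<And>v. v \<in> carrier (free R I) \<Longrightarrow> f' (vec_map I v) = tens \<one>\<^bsub>S\<^esub> (f v)"
    "f' ` carrier (free S I) = carrier T"
    "a_kernel (free S I) T f' = ext_span I (a_kernel (free R I) N f)"
proof -
  let ?FR = "free R I" let ?FS = "free S I"
  note FR = module_free_module[OF cring_R, of I] note FS = module_free_module[OF cring_S, of I]
  interpret FS: Module.module S ?FS by (rule FS)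
  interpret FR: Module.module R ?FR by (rule FR)
  note f' = module_homsD[OF f(1)]
  note l = lincomb[OF module_T I, of "\<lambda>i. tens \<one>\<^bsub>S\<^esub> (f (unit_vec R I i))",
      OF tens_closed[OF S.one_closed f'(1)[OF unit_vec_closed[OF cring_R]]]]
  define g where "g = lincomb T I (\<lambda>i. tens \<one>\<^bsub>S\<^esub> (f (unit_vec R I i)))"
  note g = l(1,2)[folded g_def]
  have g_vec: "g (vec_map I v) = tens \<one>\<^bsub>S\<^esub> (f v)" if "v \<in> carrier ?FR" for v
    by (rule free_hom_eqI[OF module_restrict_scalars[OF module_T] I module_homs_comp[OF vec_map_hom restrict_scalars_hom[OF g(1)]]
          module_homs_comp[OF f(1) tens_one_hom] _ that]) (simp add: g(2) vec_map_unit)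
  have gI: "submodule (g ` carrier ?FS) S T"
    by (rule submodule_image[OF FS module_T g(1) FS.carrier_is_submodule])
  have surj: "g ` carrier ?FS = carrier T"
  proof (rule submodule_containing_tensors[OF gI])
    fix s x assume s: "s \<in> carrier S" and x: "x \<in> carrier N"
    obtain v where v: "v \<in> carrier ?FR" "x = f v" using x f(2) by blast
    have "tens s x = s \<odot>\<^bsub>T\<^esub> g (vec_map I v)" using s x v by (simp add: g_vec smult_tens)
    also have "\<dots> = g (s \<odot>\<^bsub>?FS\<^esub> vec_map I v)" using module_homsD(3)[OF g(1) s vec_map_homD(1)[OF v(1)]] by simp
    finally show "tens s x \<in> g ` carrier ?FS" by (simp only: imageI FS.smult_closed[OF s vec_map_homD(1)[OF v(1)]])
  qed
  let ?K = "a_kernel ?FR N f" let ?Z = "ext_span I ?K"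
  have Kc: "?K \<subseteq> carrier ?FR" unfolding a_kernel_eq by blast
  have Z: "submodule ?Z S ?FS" by (rule submodule_mspan[OF FS vec_map_image[OF Kc]])
  let ?P = "quotient_module ?FS ?Z" let ?p = "\<lambda>w. ?Z +>\<^bsub>?FS\<^esub> w"
  note P = quotient_module[OF FS Z]
  interpret P: Module.module S ?P by (rule P(1))
  note p = module_homsD[OF P(2)]
  define sec where "sec x = (SOME v. v \<in> carrier ?FR \<and> f v = x)" for x
  have sec: "sec x \<in> carrier ?FR" "f (sec x) = x" if x: "x \<in> carrier N" for x
  proof -
    obtain v where "v \<in> carrier ?FR" "x = f v" using x f(2) by blast
    then have "\<exists>v. v \<in> carrier ?FR \<and> f v = x" by (intro exI[of _ v]) simp
    from someI_ex[OF this] show "sec x \<in> carrier ?FR" "f (sec x) = x" unfolding sec_def by auto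
  qed
  define c where "c s x = s \<odot>\<^bsub>?P\<^esub> ?p (vec_map I (sec x))" for s x
  \<comment> \<open>The value does not depend on the lift, because two lifts differ by a relation.\<close>
  have c_eq: "c s (f v) = s \<odot>\<^bsub>?P\<^esub> ?p (vec_map I v)" if v: "v \<in> carrier ?FR" for s v
  proof -
    note fv = f'(1)[OF v]
    have ph: "(\<lambda>v. ?p (vec_map I v)) \<in> module_homs R ?FR (restrict_scalars \<phi> ?P)"
      by (rule module_homs_comp[OF vec_map_hom restrict_scalars_hom[OF P(2)]])
    have "sec (f v) \<ominus>\<^bsub>?FR\<^esub> v \<in> ?K"
      using sec[OF fv] v hom_image_eq_iff[OF FR module_N f(1), of "sec (f v)" v] by simp
    moreover have "?K \<subseteq> a_kernel ?FR (restrict_scalars \<phi> ?P) (\<lambda>v. ?p (vec_map I v))"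
    proof
      fix k assume k: "k \<in> ?K"
      have "vec_map I k \<in> ?Z" using k by (intro mspan.incl imageI)
      then show "k \<in> a_kernel ?FR (restrict_scalars \<phi> ?P) (\<lambda>v. ?p (vec_map I v))"
        using P(4) k Kc unfolding a_kernel_eq by auto
    qed
    ultimately have "?p (vec_map I (sec (f v))) = ?p (vec_map I v)"
      using hom_image_eq_iff[OF FR module_restrict_scalars[OF P(1)] ph sec(1)[OF fv] v] by blast
    then show ?thesis unfolding c_def by simp
  qed
  have pv: "?p (vec_map I v) \<in> carrier ?P" if "v \<in> carrier ?FR" for v by (rule p(1)[OF vec_map_homD(1)[OF that]])
  obtain h where h: "h \<in> module_homs S T ?P"
    "\<And>s x. s \<in> carrier S \<Longrightarrow> x \<in> carrier N \<Longrightarrow> h (tens s x) = c s x"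
  proof (rule tensor_universal[OF P(1), of c])
    fix s x assume s: "s \<in> carrier S" and x: "x \<in> carrier N"
    obtain v where v: "v \<in> carrier ?FR" "x = f v" using x f(2) by blast
    show "c s x \<in> carrier ?P" unfolding v(2) c_eq[OF v(1)] using s pv[OF v(1)] by simp
    { fix t assume t: "t \<in> carrier S"
      show "c (s \<oplus>\<^bsub>S\<^esub> t) x = c s x \<oplus>\<^bsub>?P\<^esub> c t x" "c (t \<otimes>\<^bsub>S\<^esub> s) x = t \<odot>\<^bsub>?P\<^esub> c s x"
        unfolding v(2) c_eq[OF v(1)] using s t pv[OF v(1)] by (simp_all add: P.smult_l_distr P.smult_assoc1) }
    { fix y assume y: "y \<in> carrier N"
      obtain w where w: "w \<in> carrier ?FR" "y = f w" using y f(2) by blast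
      have "x \<oplus>\<^bsub>N\<^esub> y = f (v \<oplus>\<^bsub>?FR\<^esub> w)" using v w f'(2) by simp
      then show "c s (x \<oplus>\<^bsub>N\<^esub> y) = c s x \<oplus>\<^bsub>?P\<^esub> c s y"
        unfolding v(2) w(2) c_eq[OF v(1)] c_eq[OF w(1)]
        using c_eq[OF FR.M.a_closed[OF v(1) w(1)], of s] s pv[OF v(1)] pv[OF w(1)]
          vec_map_homD(2)[OF v(1) w(1)] p(2)[OF vec_map_homD(1)[OF v(1)] vec_map_homD(1)[OF w(1)]]
        by (simp add: P.smult_r_distr) }
    { fix r assume r: "r \<in> carrier R"
      have "r \<odot>\<^bsub>N\<^esub> x = f (r \<odot>\<^bsub>?FR\<^esub> v)" using v r f'(3) by simp
      then show "c (s \<otimes>\<^bsub>S\<^esub> \<phi> r) x = c s (r \<odot>\<^bsub>N\<^esub> x)"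
        unfolding v(2) c_eq[OF v(1)]
        using c_eq[OF FR.smult_closed[OF r v(1)], of s] s r pv[OF v(1)]
          vec_map_homD(3)[OF r v(1)] p(3)[OF phi_closed[OF r] vec_map_homD(1)[OF v(1)]]
        by (simp add: P.smult_assoc1) }
  qed (rule that)
  \<comment> \<open>So \<open>h\<close> recovers a vector modulo the old relations from its image under \<open>g\<close>.\<close>
  have hg: "h (g w) = ?p w" if w: "w \<in> carrier ?FS" for w
  proof (rule free_hom_eqI[OF P(1) I module_homs_comp[OF g(1) h(1)] P(2) _ w])
    fix i assume i: "i \<in> I"
    note u = unit_vec_closed[OF cring_R, of I i]
    have "h (g (unit_vec S I i)) = c \<one>\<^bsub>S\<^esub> (f (unit_vec R I i))" using g(2)[OF i] h(2) f'(1)[OF u] by simp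
    also have "\<dots> = ?p (unit_vec S I i)" using c_eq[OF u, of "\<one>\<^bsub>S\<^esub>"] pv[OF u] by (simp add: vec_map_unit)
    finally show "h (g (unit_vec S I i)) = ?p (unit_vec S I i)" .
  qed
  have "a_kernel ?FS T g = ?Z"
  proof
    show "a_kernel ?FS T g \<subseteq> ?Z"
    proof
      fix w assume "w \<in> a_kernel ?FS T g"
      then have w: "w \<in> carrier ?FS" "g w = \<zero>\<^bsub>T\<^esub>" unfolding a_kernel_eq by auto
      then have "?p w = \<zero>\<^bsub>?P\<^esub>" using hg[OF w(1)] module_hom_zero[OF module_T P(1) h(1)] by simp
      then show "w \<in> ?Z" using P(4) w(1) unfolding a_kernel_eq by blast
    qed
    show "?Z \<subseteq> a_kernel ?FS T g"
    proof (rule mspan_least[OF FS submodule_kernel[OF FS module_T g(1)]], rule image_subsetI)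
      fix k assume "k \<in> ?K"
      then have k: "k \<in> carrier ?FR" "f k = \<zero>\<^bsub>N\<^esub>" unfolding a_kernel_eq by auto
      have "tens \<one>\<^bsub>S\<^esub> \<zero>\<^bsub>N\<^esub> = \<zero>\<^bsub>T\<^esub>"
        using module_hom_zero[OF module_N module_restrict_scalars[OF module_T] tens_one_hom] by simp
      then show "vec_map I k \<in> a_kernel ?FS T g"
        unfolding a_kernel_eq using k g_vec[OF k(1)] vec_map_homD(1)[OF k(1)] by simp
    qed
  qed
  with g(1) g_vec surj show ?thesis by (rule that)
qed

end

section \<open>Consequences of faithful flatness\<close>

text \<open>
  Faithful flatness speaks about modules of a fixed carrier type.  A free module on any finite index
  set is moved to that type by transporting its structure along an injection.
\<close>

definition copy_module :: "('a \<Rightarrow> 'b) \<Rightarrow> ('r, 'a) module \<Rightarrow> ('r, 'b) module" where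
  "copy_module j N =
     (let i = inv_into (carrier N) j in
      \<lparr>carrier = j ` carrier N, monoid.mult = undefined, monoid.one = undefined,
       ring.zero = j \<zero>\<^bsub>N\<^esub>, ring.add = (\<lambda>x y. j (i x \<oplus>\<^bsub>N\<^esub> i y)), smult = (\<lambda>r x. j (r \<odot>\<^bsub>N\<^esub> i x))\<rparr>)"

lemma copy_module:
  assumes N: "Module.module R N" and j: "inj_on j (carrier N)"
  shows "Module.module R (copy_module j N)" and "j \<in> module_homs R N (copy_module j N)"
    and "j ` carrier N = carrier (copy_module j N)"
    and "a_kernel N (copy_module j N) j = {\<zero>\<^bsub>N\<^esub>}"
proof -
  interpret N: Module.module R N by (rule N)
  let ?C = "copy_module j N"
  have inv: "inv_into (carrier N) j (j x) = x" if "x \<in> carrier N" for x by (rule inv_into_f_f[OF j that])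
  have car: "carrier ?C = j ` carrier N" and zero: "\<zero>\<^bsub>?C\<^esub> = j \<zero>\<^bsub>N\<^esub>"
    by (simp_all add: copy_module_def Let_def)
  have add: "j x \<oplus>\<^bsub>?C\<^esub> j y = j (x \<oplus>\<^bsub>N\<^esub> y)" if "x \<in> carrier N" "y \<in> carrier N" for x y
    using that by (simp add: copy_module_def Let_def inv)
  have smult: "r \<odot>\<^bsub>?C\<^esub> j x = j (r \<odot>\<^bsub>N\<^esub> x)" if "x \<in> carrier N" for r x
    using that by (simp add: copy_module_def Let_def inv)
  have "abelian_group ?C"
    by (rule abelian_groupI)
      (auto simp: car zero add N.M.a_ac N.M.r_neg intro!: bexI[of _ "\<ominus>\<^bsub>N\<^esub> x" for x])
  then show m: "Module.module R ?C"
    by (rule moduleI[OF N.R.is_cring])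
      (auto simp: car add smult N.smult_l_distr N.smult_r_distr N.smult_assoc1)
  show "j \<in> module_homs R N ?C" by (rule module_homsI) (auto simp: car add smult)
  show "j ` carrier N = carrier ?C" by (simp add: car)
  show "a_kernel N ?C j = {\<zero>\<^bsub>N\<^esub>}" unfolding a_kernel_eq zero using inj_on_eq_iff[OF j] by auto
qed

lemma free_module_copy:
  assumes R: "cring R" and I: "finite (I :: 'i set)"
  obtains P :: "('r, (nat \<Rightarrow> 'r) set) module" and j where "Module.module R P"
    "j \<in> module_homs R (free R I) P" "j ` carrier (free R I) = carrier P"
    "a_kernel (free R I) P j = {\<zero>\<^bsub>free R I\<^esub>}"
proof -
  obtain e where e: "bij_betw e {..<card I} I"
    using ex_bij_betw_nat_finite[OF I] by (auto simp: atLeast0LessThan)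
  define j :: "('i \<Rightarrow> 'r) \<Rightarrow> (nat \<Rightarrow> 'r) set" where "j v = {\<lambda>k. v (e k)}" for v
  have "inj_on j (carrier (free R I))"
  proof (rule inj_onI)
    fix v w assume v: "v \<in> carrier (free R I)" and w: "w \<in> carrier (free R I)" and eq: "j v = j w"
    show "v = w"
    proof (rule PiE_ext)
      show "v \<in> I \<rightarrow>\<^sub>E carrier R" "w \<in> I \<rightarrow>\<^sub>E carrier R" using v w by (simp_all add: product_module_simps)
      fix i assume "i \<in> I"
      then obtain k where "i = e k" using bij_betw_imp_surj_on[OF e] by blast
      moreover have "v (e k) = w (e k)" using eq unfolding j_def by (auto dest: fun_cong)
      ultimately show "v i = w i" by simp
    qed
  qed
  from copy_module[OF module_free_module[OF R] this] show ?thesis by (rule that)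
qed

context ring_change
begin

lemma scalar_extensionI: "Module.module R N \<Longrightarrow> scalar_extension R S \<phi> N"
  by (intro scalar_extension.intro ring_change_axioms scalar_extension_axioms.intro)

text \<open>
  Flatness keeps the inclusion of the kernel of \<open>h\<close>, followed by \<open>h\<close>, exact; the base changes of the free
  modules are identified with \<open>S\<^sup>A\<close> and \<open>S\<^sup>B\<close> by the presentations that have no relations.  In coordinates,
  solutions over \<open>S\<close> of a linear system with coefficients in \<open>R\<close> are \<open>S\<close>-combinations of solutions over \<open>R\<close>.
\<close>

lemma flat_kernel:
  fixes A :: "'i set" and B :: "'j set"
  assumes flat: "faithfully_flat R S \<phi>" and A: "finite A" and B: "finite B"
    and h: "h \<in> module_homs R (free R A) (free R B)"
    and h': "h' \<in> module_homs S (free S A) (free S B)"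
    and comm: "\<And>v. v \<in> carrier (free R A) \<Longrightarrow> h' (vec_map A v) = vec_map B (h v)"
  shows "a_kernel (free S A) (free S B) h' =
    ext_span A (a_kernel (free R A) (free R B) h)"
proof
  let ?RA = "free R A" let ?RB = "free R B" let ?SA = "free S A" let ?SB = "free S B"
  note RA = module_free_module[OF cring_R, of A] note RB = module_free_module[OF cring_R, of B]
  note SA = module_free_module[OF cring_S, of A] note SB = module_free_module[OF cring_S, of B]
  let ?K = "a_kernel ?RA ?RB h" let ?Z = "ext_span A ?K"
  have K: "submodule ?K R ?RA" by (rule submodule_kernel[OF RA RB h])
  have Kc: "?K \<subseteq> carrier ?RA" by (rule submoduleD(1)[OF RA K])
  show "?Z \<subseteq> a_kernel ?SA ?SB h'"
  proof (rule mspan_least[OF SA submodule_kernel[OF SA SB h']], rule image_subsetI)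
    fix k assume k: "k \<in> ?K"
    then have "h k = \<zero>\<^bsub>?RB\<^esub>" unfolding a_kernel_eq by simp
    then show "vec_map A k \<in> a_kernel ?SA ?SB h'"
      unfolding a_kernel_eq using comm[of k] vec_map_homD(1)[of k A] Kc k by (auto simp: vec_map_zero)
  qed
  obtain PA :: "('r, (nat \<Rightarrow> 'r) set) module" and jA where PA: "Module.module R PA"
    "jA \<in> module_homs R ?RA PA" "jA ` carrier ?RA = carrier PA" "a_kernel ?RA PA jA = {\<zero>\<^bsub>?RA\<^esub>}"
    by (rule free_module_copy[OF cring_R A])
  obtain PB :: "('r, (nat \<Rightarrow> 'r) set) module" and jB where PB: "Module.module R PB"
    "jB \<in> module_homs R ?RB PB" "jB ` carrier ?RB = carrier PB" "a_kernel ?RB PB jB = {\<zero>\<^bsub>?RB\<^esub>}"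
    by (rule free_module_copy[OF cring_R B])
  let ?U = "jA ` ?K" let ?P0 = "PA\<lparr>carrier := ?U\<rparr>"
  have U: "submodule ?U R PA" by (rule submodule_image[OF RA PA(1,2) K])
  have P0: "Module.module R ?P0" by (rule module_carrier_update[OF PA(1) U])
  note jh = module_homs_comp[OF h PB(2)]
  have "a_kernel ?RA PA jA \<subseteq> a_kernel ?RA PB (\<lambda>v. jB (h v))"
    unfolding PA(4) using submoduleD(3)[OF RA submodule_kernel[OF RA PB(1) jh]] by blast
  then obtain g where g: "g \<in> module_homs R PA PB" "\<And>v. v \<in> carrier ?RA \<Longrightarrow> g (jA v) = jB (h v)"
    by (rule hom_factor[OF RA PA(1) PB(1) PA(2,3) jh]) (rule that)
  have i: "(\<lambda>x. x) \<in> module_homs R ?P0 PA"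
    using submoduleD(2)[OF PA(1) U] by (intro module_homsI) auto
  have inj: "jB w = \<zero>\<^bsub>PB\<^esub> \<longleftrightarrow> w = \<zero>\<^bsub>?RB\<^esub>" if "w \<in> carrier ?RB" for w
    using PB(4) that unfolding a_kernel_eq by blast
  have ker_g: "a_kernel PA PB g = ?U"
  proof
    show "a_kernel PA PB g \<subseteq> ?U"
    proof
      fix x assume "x \<in> a_kernel PA PB g"
      then have x: "x \<in> carrier PA" "g x = \<zero>\<^bsub>PB\<^esub>" unfolding a_kernel_eq by auto
      obtain v where v: "v \<in> carrier ?RA" "x = jA v" using x(1) PA(3) by blast
      have "h v = \<zero>\<^bsub>?RB\<^esub>" using x(2) g(2)[OF v(1)] inj[OF module_homsD(1)[OF h v(1)]] v(2) by simp
      then show "x \<in> ?U" unfolding v(2) using v(1) by (intro imageI) (simp add: a_kernel_eq)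
    qed
    show "?U \<subseteq> a_kernel PA PB g"
    proof (rule image_subsetI)
      fix k assume "k \<in> ?K"
      then have k: "k \<in> carrier ?RA" "h k = \<zero>\<^bsub>?RB\<^esub>" unfolding a_kernel_eq by auto
      then show "jA k \<in> a_kernel PA PB g"
        unfolding a_kernel_eq using g(2)[OF k(1)] inj[OF module_homsD(1)[OF h k(1)]] module_homsD(1)[OF PA(2) k(1)]
        by simp
    qed
  qed
  have "exact_at ?P0 (\<lambda>x. x) PA g PB" unfolding exact_at_def ker_g by simp
  then have ex: "exact_at (base_change R S \<phi> ?P0) (base_change_map R S \<phi> PA (\<lambda>x. x)) (base_change R S \<phi> PA)
      (base_change_map R S \<phi> PB g) (base_change R S \<phi> PB)"
    using flat P0 PA(1) PB(1) i g(1) unfolding faithfully_flat_def by blast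
  interpret A: scalar_extension R S \<phi> PA by (rule scalar_extensionI[OF PA(1)])
  interpret B: scalar_extension R S \<phi> PB by (rule scalar_extensionI[OF PB(1)])
  interpret Z: scalar_extension R S \<phi> ?P0 by (rule scalar_extensionI[OF P0])
  let ?bi = "base_change_map R S \<phi> PA (\<lambda>x. x)" let ?bg = "base_change_map R S \<phi> PB g"
  note bi = base_change_map_tens[OF Z.scalar_extension_axioms A.scalar_extension_axioms i]
  note bg = base_change_map_tens[OF A.scalar_extension_axioms B.scalar_extension_axioms g(1)]
  obtain fA where fA: "fA \<in> module_homs S ?SA A.T"
    "\<And>v. v \<in> carrier ?RA \<Longrightarrow> fA (vec_map A v) = A.tens \<one>\<^bsub>S\<^esub> (jA v)"
    "a_kernel ?SA A.T fA = ext_span A (a_kernel ?RA PA jA)"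
    by (rule A.base_change_presentation[OF A PA(2,3)]) (rule that)
  obtain fB where fB: "fB \<in> module_homs S ?SB B.T"
    "\<And>v. v \<in> carrier ?RB \<Longrightarrow> fB (vec_map B v) = B.tens \<one>\<^bsub>S\<^esub> (jB v)"
    by (rule B.base_change_presentation[OF B PB(2,3)]) (rule that)
  have "mspan S ?SA {\<zero>\<^bsub>?SA\<^esub>} = {\<zero>\<^bsub>?SA\<^esub>}" by (rule mspan_submodule_eq[OF SA submodule_zero[OF SA]])
  then have kerA: "a_kernel ?SA A.T fA = {\<zero>\<^bsub>?SA\<^esub>}" unfolding fA(3) PA(4) by (simp add: vec_map_zero)
  \<comment> \<open>The base change of \<open>g\<close> is \<open>h'\<close> under these identifications.\<close>
  have square: "?bg (fA s) = fB (h' s)" if "s \<in> carrier ?SA" for s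
  proof (rule free_hom_eqI[OF B.module_T A module_homs_comp[OF fA(1) bg(1)] module_homs_comp[OF h' fB(1)] _ that])
    fix a assume "a \<in> A"
    note u = unit_vec_closed[OF cring_R, of A a]
    have "?bg (fA (vec_map A (unit_vec R A a))) = B.tens \<one>\<^bsub>S\<^esub> (g (jA (unit_vec R A a)))"
      using fA(2)[OF u] bg(2) by simp
    also have "\<dots> = fB (h' (vec_map A (unit_vec R A a)))"
      using fB(2)[OF module_homsD(1)[OF h u]] comm[OF u] g(2)[OF u] by simp
    finally show "?bg (fA (unit_vec S A a)) = fB (h' (unit_vec S A a))" by (simp add: vec_map_unit)
  qed
  have Zs: "submodule ?Z S ?SA" by (rule submodule_mspan[OF SA vec_map_image[OF Kc]])
  have fZ: "submodule (fA ` ?Z) S A.T" by (rule submodule_image[OF SA A.module_T fA(1) Zs])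
  \<comment> \<open>The base change of the kernel only reaches \<open>S\<close>-combinations of solutions over \<open>R\<close>.\<close>
  have "{z \<in> carrier Z.T. ?bi z \<in> fA ` ?Z} = carrier Z.T"
  proof (rule Z.submodule_containing_tensors[OF submodule_preimage[OF Z.module_T A.module_T bi(1) fZ]])
    fix s x assume s: "s \<in> carrier S" and x: "x \<in> carrier ?P0"
    then obtain k where k: "k \<in> ?K" "x = jA k" by auto
    have kc: "k \<in> carrier ?RA" using k(1) Kc by blast
    have "?bi (Z.tens s x) = A.tens s (jA k)" using bi(2) k(2) by simp
    also have "\<dots> = s \<odot>\<^bsub>A.T\<^esub> fA (vec_map A k)"
      using fA(2)[OF kc] A.smult_tens[OF s, of "\<one>\<^bsub>S\<^esub>"] s by simp
    finally have "?bi (Z.tens s x) = s \<odot>\<^bsub>A.T\<^esub> fA (vec_map A k)" .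
    moreover have "fA (vec_map A k) \<in> fA ` ?Z" by (intro imageI mspan.incl k(1))
    ultimately have "?bi (Z.tens s x) \<in> fA ` ?Z" using submoduleD(6)[OF A.module_T fZ s] by simp
    then show "Z.tens s x \<in> {z \<in> carrier Z.T. ?bi z \<in> fA ` ?Z}" using Z.tens_closed[OF s x] by simp
  qed
  then have im: "?bi ` carrier Z.T \<subseteq> fA ` ?Z" by blast
  show "a_kernel ?SA ?SB h' \<subseteq> ?Z"
  proof
    fix s assume "s \<in> a_kernel ?SA ?SB h'"
    then have s: "s \<in> carrier ?SA" "h' s = \<zero>\<^bsub>?SB\<^esub>" unfolding a_kernel_eq by auto
    have "?bg (fA s) = \<zero>\<^bsub>B.T\<^esub>" using square[OF s(1)] s(2) module_hom_zero[OF SB B.module_T fB(1)] by simp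
    then have "fA s \<in> a_kernel A.T B.T ?bg" unfolding a_kernel_eq using module_homsD(1)[OF fA(1) s(1)] by simp
    then have "fA s \<in> fA ` ?Z" using ex im unfolding exact_at_def by blast
    then obtain t where t: "t \<in> ?Z" "fA s = fA t" by blast
    have tc: "t \<in> carrier ?SA" by (rule submoduleD(2)[OF SA Zs t(1)])
    interpret SA: Module.module S ?SA by (rule SA)
    have "s \<ominus>\<^bsub>?SA\<^esub> t = \<zero>\<^bsub>?SA\<^esub>" using hom_image_eq_iff[OF SA A.module_T fA(1) s(1) tc] t(2) kerA by blast
    then show "s \<in> ?Z" using t(1) SA.M.minus_eq_zero_iff[OF s(1) tc] by simp
  qed
qed

text \<open>
  The quotient by \<open>K\<close> has a vanishing base change.  So the sequence \<open>0 \<rightarrow> L \<rightarrow> 0\<close> for this quotient \<open>L\<close> becomes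
  exact over \<open>S\<close>, and faithfulness makes it exact over \<open>R\<close>.
\<close>

lemma faithful_span:
  assumes flat: "faithfully_flat R S \<phi>" and K: "submodule K R (vecs R q)"
    and span: "ext_span {..<q} K = carrier (vecs S q)"
  shows "K = carrier (vecs R q)"
proof
  let ?F = "vecs R q" let ?L = "quotient_module ?F K" let ?p = "\<lambda>x. K +>\<^bsub>?F\<^esub> x"
  note F = module_free_module[OF cring_R, of "{..<q}"] note FS = module_free_module[OF cring_S, of "{..<q}"]
  show "K \<subseteq> carrier ?F" by (rule submoduleD(1)[OF F K])
  note L = quotient_module[OF F K]
  let ?Z = "?L\<lparr>carrier := {\<zero>\<^bsub>?L\<^esub>}\<rparr>"
  have mZ: "Module.module R ?Z" by (rule module_carrier_update[OF L(1) submodule_zero[OF L(1)]])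
  interpret Lm: Module.module R ?L by (rule L(1))
  interpret L: scalar_extension R S \<phi> ?L by (rule scalar_extensionI[OF L(1)])
  interpret Z: scalar_extension R S \<phi> ?Z by (rule scalar_extensionI[OF mZ])
  interpret LT: Module.module S L.T by (rule L.module_T)
  have i: "(\<lambda>x. x) \<in> module_homs R ?Z ?L" by (rule module_homsI) auto
  have c: "(\<lambda>x. \<zero>\<^bsub>?L\<^esub>) \<in> module_homs R ?L ?Z" by (rule module_homsI) auto
  note bi = base_change_map_tens[OF Z.scalar_extension_axioms L.scalar_extension_axioms i]
  note bc = base_change_map_tens[OF L.scalar_extension_axioms Z.scalar_extension_axioms c]
  obtain f where f: "f ` carrier (vecs S q) = carrier L.T"
    "a_kernel (vecs S q) L.T f = ext_span {..<q} (a_kernel ?F ?L ?p)"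
    by (rule L.base_change_presentation[OF finite_lessThan L(2,3)]) (rule that)
  have "carrier L.T \<subseteq> {\<zero>\<^bsub>L.T\<^esub>}"
    using f(1) f(2)[unfolded L(4) span] unfolding a_kernel_eq by blast
  then have zero: "carrier L.T = {\<zero>\<^bsub>L.T\<^esub>}" by auto
  have "base_change_map R S \<phi> ?L (\<lambda>x. x) ` carrier Z.T = {\<zero>\<^bsub>L.T\<^esub>}"
  proof
    show "base_change_map R S \<phi> ?L (\<lambda>x. x) ` carrier Z.T \<subseteq> {\<zero>\<^bsub>L.T\<^esub>}"
      using module_homsD(1)[OF bi(1)] zero by blast
    have "\<zero>\<^bsub>L.T\<^esub> = base_change_map R S \<phi> ?L (\<lambda>x. x) \<zero>\<^bsub>Z.T\<^esub>"
      using module_hom_zero[OF Z.module_T L.module_T bi(1)] by simp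
    then show "{\<zero>\<^bsub>L.T\<^esub>} \<subseteq> base_change_map R S \<phi> ?L (\<lambda>x. x) ` carrier Z.T"
      using submoduleD(3)[OF Z.module_T module.carrier_is_submodule[OF Z.module_T]] by blast
  qed
  moreover have "a_kernel L.T Z.T (base_change_map R S \<phi> ?Z (\<lambda>x. \<zero>\<^bsub>?L\<^esub>)) = {\<zero>\<^bsub>L.T\<^esub>}"
    unfolding a_kernel_eq zero using module_hom_zero[OF L.module_T Z.module_T bc(1)] by auto
  ultimately have "exact_at Z.T (base_change_map R S \<phi> ?L (\<lambda>x. x)) L.T (base_change_map R S \<phi> ?Z (\<lambda>x. \<zero>\<^bsub>?L\<^esub>)) Z.T"
    unfolding exact_at_def by simp
  then have "exact_at ?Z (\<lambda>x. x) ?L (\<lambda>x. \<zero>\<^bsub>?L\<^esub>) ?Z"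
    using flat mZ L(1) i c unfolding faithfully_flat_def by blast
  then have "carrier ?L \<subseteq> {\<zero>\<^bsub>?L\<^esub>}" unfolding exact_at_def a_kernel_eq by auto
  then have "a_kernel ?F ?L ?p = carrier ?F" using L(3) unfolding a_kernel_eq by blast
  then show "carrier ?F \<subseteq> K" unfolding L(4) by simp
qed

end

section \<open>Traces under base change\<close>

context ring_change
begin

lemma restrict_scalars_minus:
  assumes "Module.module S B" "x \<in> carrier B" "y \<in> carrier B"
  shows "x \<ominus>\<^bsub>restrict_scalars \<phi> B\<^esub> y = x \<ominus>\<^bsub>B\<^esub> y"
proof -
  interpret B: Module.module S B by (rule assms)
  interpret RB: Module.module R "restrict_scalars \<phi> B" by (rule module_restrict_scalars[OF assms(1)])
  have c: "x \<ominus>\<^bsub>restrict_scalars \<phi> B\<^esub> y \<in> carrier B" using RB.M.minus_closed[of x y] assms by simp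
  have "(x \<ominus>\<^bsub>restrict_scalars \<phi> B\<^esub> y) \<oplus>\<^bsub>restrict_scalars \<phi> B\<^esub> y = x"
    using assms RB.M.a_inv_closed[of y] RB.M.a_assoc[of x _ y] RB.M.l_neg[of y] RB.M.r_zero[of x]
    by (simp add: RB.M.minus_eq del: restrict_scalars_simps(2,3))
  then have "(x \<ominus>\<^bsub>restrict_scalars \<phi> B\<^esub> y) \<oplus>\<^bsub>B\<^esub> y = (x \<ominus>\<^bsub>B\<^esub> y) \<oplus>\<^bsub>B\<^esub> y"
    using assms by (simp add: B.M.minus_eq B.M.a_assoc B.M.l_neg)
  then show ?thesis using c assms by (simp add: B.M.add.right_cancel)
qed

lemma vec_map_minus:
  assumes "v \<in> carrier (free R I)" "w \<in> carrier (free R I)"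
  shows "vec_map I (v \<ominus>\<^bsub>free R I\<^esub> w) = vec_map I v \<ominus>\<^bsub>free S I\<^esub> vec_map I w"
  using module_hom_minus[OF module_free_module[OF cring_R] module_restrict_scalars[OF module_free_module[OF cring_S]] vec_map_hom assms]
    restrict_scalars_minus[OF module_free_module[OF cring_S] vec_map_homD(1)[OF assms(1)] vec_map_homD(1)[OF assms(2)]]
  by simp

text \<open>
  The extension of scalars of an admissible map is admissible.
\<close>

lemma trace_vec_map:
  assumes "vec_map {..<q} ` W \<subseteq> W'" "W \<subseteq> carrier (vecs R q)" "W' \<subseteq> carrier (vecs S q)"
    and B: "B \<subseteq> carrier (vecs R m)"
  shows "vec_map {..<q} ` trace_ext R m B (vecs R q) W \<subseteq>
         trace_ext S m (vec_map {..<m} ` B) (vecs S q) W'"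
proof -
  note FR = module_free_module[OF cring_R] note FS = module_free_module[OF cring_S]
  let ?T = "trace_ext S m (vec_map {..<m} ` B) (vecs S q) W'"
  have T: "submodule ?T S (vecs S q)" by (rule trace_ext_closed[OF FS assms(3)])
  have "trace_ext R m B (vecs R q) W \<subseteq> {v \<in> carrier (vecs R q). vec_map {..<q} v \<in> ?T}"
  proof (rule trace_ext_least[OF FR])
    show "submodule {v \<in> carrier (vecs R q). vec_map {..<q} v \<in> ?T} R (vecs R q)"
      by (rule submodule_preimage[OF FR module_restrict_scalars[OF FS] vec_map_hom submodule_restrict_scalars[OF FS T]])
    show "W \<subseteq> {v \<in> carrier (vecs R q). vec_map {..<q} v \<in> ?T}"
      using assms(1,2) trace_ext_superset[of W' S m "vec_map {..<m} ` B" "vecs S q"] by blast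
    fix h v assume h: "h \<in> module_homs R (vecs R m) (vecs R q)" "h ` B \<subseteq> W"
      and v: "v \<in> carrier (vecs R m)"
    obtain h' where h': "h' \<in> module_homs S (vecs S m) (vecs S q)"
      "\<And>v. v \<in> carrier (vecs R m) \<Longrightarrow> h' (vec_map {..<m} v) = vec_map {..<q} (h v)"
      by (rule extend_scalars[OF finite_lessThan h(1)]) (rule that)
    have "h' ` vec_map {..<m} ` B \<subseteq> W'"
    proof (clarify)
      fix b assume b: "b \<in> B"
      then have "h' (vec_map {..<m} b) = vec_map {..<q} (h b)" using B by (intro h'(2)) blast
      then show "h' (vec_map {..<m} b) \<in> W'" using b h(2) assms(1) by auto
    qed
    then have "h' (vec_map {..<m} v) \<in> ?T" by (rule trace_ext_hom[OF h'(1) _ vec_map_homD(1)[OF v]])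
    then show "h v \<in> {v \<in> carrier (vecs R q). vec_map {..<q} v \<in> ?T}"
      using h'(2)[OF v] module_homsD(1)[OF h(1) v] by simp
  qed
  then show ?thesis by blast
qed

lemma trace_iter_vec_map:
  assumes "vec_map {..<q} ` W \<subseteq> W'" "W \<subseteq> carrier (vecs R q)" "W' \<subseteq> carrier (vecs S q)"
    and B: "B \<subseteq> carrier (vecs R m)"
  shows "vec_map {..<q} ` (trace_ext R m B (vecs R q) ^^ n) W \<subseteq>
         (trace_ext S m (vec_map {..<m} ` B) (vecs S q) ^^ n) W'"
proof (induction n)
  case (Suc n)
  show ?case
    using trace_vec_map[OF Suc trace_iter_subset[OF module_free_module[OF cring_R] assms(2)]
        trace_iter_subset[OF module_free_module[OF cring_S] assms(3)] B] by simp
qed (simp add: assms)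

lemma trace_iter_full:
  assumes "vec_map {..<q} ` W \<subseteq> W'" "W \<subseteq> carrier (vecs R q)" "submodule W' S (vecs S q)"
    and B: "B \<subseteq> carrier (vecs R m)"
    and full: "(trace_ext R m B (vecs R q) ^^ n) W = carrier (vecs R q)"
  shows "(trace_ext S m (vec_map {..<m} ` B) (vecs S q) ^^ n) W' = carrier (vecs S q)"
proof
  note FS = module_free_module[OF cring_S, of "{..<q}"]
  let ?T = "(trace_ext S m (vec_map {..<m} ` B) (vecs S q) ^^ n) W'"
  have W': "W' \<subseteq> carrier (vecs S q)" by (rule submoduleD(1)[OF FS assms(3)])
  show "?T \<subseteq> carrier (vecs S q)" by (rule trace_iter_subset[OF FS W'])
  show "carrier (vecs S q) \<subseteq> ?T"
    unfolding free_module_span[OF cring_S finite_lessThan]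
  proof (rule mspan_least[OF FS trace_iter_submodule[OF FS assms(3)]], rule image_subsetI)
    fix i
    have "vec_map {..<q} (unit_vec R {..<q} i) \<in> ?T"
      using trace_iter_vec_map[OF assms(1,2) W' B, of n] unit_vec_closed[OF cring_R, of "{..<q}" i]
      unfolding full by blast
    then show "unit_vec S {..<q} i \<in> ?T" by (simp add: vec_map_unit)
  qed
qed

lemma image_extend_scalars:
  assumes I: "finite I" and h: "h \<in> module_homs R (free R I) (free R J)"
    and h': "h' \<in> module_homs S (free S I) (free S J)"
    and comm: "\<And>v. v \<in> carrier (free R I) \<Longrightarrow> h' (vec_map I v) = vec_map J (h v)"
    and X: "X \<subseteq> carrier (free R I)"
  shows "h' ` ext_span I X = ext_span J (h ` X)"
proof -
  have "h' ` vec_map I ` X = vec_map J ` h ` X"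
    using comm X by (force simp: image_image)
  then show ?thesis
    using hom_image_mspan[OF module_free_module[OF cring_S] module_free_module[OF cring_S] h' vec_map_image[OF X]] by simp
qed

lemma vec_map_span_carrier:
  assumes "finite I"
  shows "ext_span I (carrier (free R I)) = carrier (free S I)"
proof -
  have "vec_map I ` unit_vec R I ` I = unit_vec S I ` I" by (simp add: image_image vec_map_unit)
  then show ?thesis
    unfolding free_module_span[OF cring_R assms] free_module_span[OF cring_S assms]
    by (subst mspan_vec_map) (auto intro: unit_vec_closed cring_R)
qed

text \<open>
  The membership condition is turned into linear equations in more unknowns, to which flatness
  applies.
\<close>

lemma flat_preimage_single:
  fixes A :: "'i set"
  assumes flat: "faithfully_flat R S \<phi>" and A: "finite A"
    and L: "L \<in> module_homs R (free R A) (vecs R q)"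
    and L': "L' \<in> module_homs S (free S A) (vecs S q)"
    and comm: "\<And>v. v \<in> carrier (free R A) \<Longrightarrow> L' (vec_map A v) = vec_map {..<q} (L v)"
    and W: "fin_gen R (vecs R q) W"
  shows "{v \<in> carrier (free S A). L' v \<in> ext_span {..<q} W} =
    ext_span A ({v \<in> carrier (free R A). L v \<in> W})"
proof -
  note FR = module_free_module[OF cring_R] note FS = module_free_module[OF cring_S]
  obtain d :: nat and w where w: "w \<in> module_homs R (vecs R d) (vecs R q)"
    "w ` carrier (vecs R d) = W" by (rule fin_gen_cover[OF FR W])
  obtain w' where w': "w' \<in> module_homs S (vecs S d) (vecs S q)"
    "\<And>v. v \<in> carrier (vecs R d) \<Longrightarrow> w' (vec_map {..<d} v) = vec_map {..<q} (w v)"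
    by (rule extend_scalars[OF finite_lessThan w(1)]) (rule that)
  have imw': "w' ` carrier (vecs S d) = ext_span {..<q} W"
    using image_extend_scalars[OF finite_lessThan w(1) w' subset_refl]
    unfolding vec_map_span_carrier[OF finite_lessThan] w(2) by simp
  let ?I = "A <+> {..<d}"
  let ?h = "\<lambda>v. L (left_part A v) \<ominus>\<^bsub>vecs R q\<^esub> w (right_part {..<d} v)"
  let ?h' = "\<lambda>v. L' (left_part A v) \<ominus>\<^bsub>vecs S q\<^esub> w' (right_part {..<d} v)"
  note pR = preimage_eq_image_kernel[OF FR L w(1)] note pS = preimage_eq_image_kernel[OF FS L' w'(1)]
  have left: "left_part A (vec_map ?I v) = vec_map A (left_part A v)" for v :: "'i + nat \<Rightarrow> 'r"
    unfolding left_part_def vec_map_def by (auto intro!: restrict_ext)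
  have right: "right_part {..<d} (vec_map ?I v) = vec_map {..<d} (right_part {..<d} v)" for v :: "'i + nat \<Rightarrow> 'r"
    unfolding right_part_def vec_map_def by (auto intro!: restrict_ext)
  have comm': "?h' (vec_map ?I v) = vec_map {..<q} (?h v)" if v: "v \<in> carrier (free R ?I)" for v
  proof -
    note l = module_homsD(1)[OF part_homs(1) v] note r = module_homsD(1)[OF part_homs(2) v]
    show ?thesis
      unfolding left right comm[OF l] w'(2)[OF r]
      by (rule vec_map_minus[symmetric]) (rule module_homsD(1)[OF L l], rule module_homsD(1)[OF w(1) r])
  qed
  have I: "finite ?I" using A by simp
  have ker: "a_kernel (free S ?I) (vecs S q) ?h' =
      ext_span ?I (a_kernel (free R ?I) (vecs R q) ?h)"
    by (rule flat_kernel[OF flat I finite_lessThan pR(1) pS(1) comm'])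
  have "{v \<in> carrier (free S A). L' v \<in> ext_span {..<q} W} =
    left_part A ` ext_span ?I (a_kernel (free R ?I) (vecs R q) ?h)"
    unfolding imw'[symmetric] pS(2) ker ..
  also have "\<dots> = ext_span A (left_part A ` a_kernel (free R ?I) (vecs R q) ?h)"
    by (rule image_extend_scalars[OF I part_homs(1) part_homs(1) left]) (auto simp: a_kernel_eq)
  finally show ?thesis unfolding pR(2)[symmetric] w(2) .
qed

text \<open>
  The conditions are imposed one at a time, on the unknowns that parametrise the solutions of the
  previous ones; coherence keeps this parametrisation finite.
\<close>

lemma flat_preimage:
  assumes coh: "coherent_ring R" and flat: "faithfully_flat R S \<phi>" and A: "finite A" and J: "finite J"
    and L: "\<And>j. j \<in> J \<Longrightarrow> L j \<in> module_homs R (free R A) (vecs R q)"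
    and L': "\<And>j. j \<in> J \<Longrightarrow> L' j \<in> module_homs S (free S A) (vecs S q)"
    and comm: "\<And>j v. j \<in> J \<Longrightarrow> v \<in> carrier (free R A) \<Longrightarrow> L' j (vec_map A v) = vec_map {..<q} (L j v)"
    and W: "fin_gen R (vecs R q) W"
  shows "{v \<in> carrier (free S A). \<forall>j\<in>J. L' j v \<in> ext_span {..<q} W} =
    ext_span A ({v \<in> carrier (free R A). \<forall>j\<in>J. L j v \<in> W})"
  using J L L' comm
proof induction
  case empty
  then show ?case by (simp add: vec_map_span_carrier[OF A])
next
  case (insert j J)
  note FR = module_free_module[OF cring_R] note FS = module_free_module[OF cring_S]
  let ?RA = "free R A" let ?SA = "free S A"
  let ?W = "ext_span {..<q} W"
  let ?Z = "{v \<in> carrier ?RA. \<forall>j\<in>J. L j v \<in> W}" let ?Z' = "{v \<in> carrier ?SA. \<forall>j\<in>J. L' j v \<in> ?W}"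
  have IH: "?Z' = ext_span A ?Z" by (rule insert.IH) (simp_all add: insert.prems)
  have fgZ: "fin_gen R ?RA ?Z"
    by (rule coherent_preimage[OF coh A insert.hyps(1) _ W]) (simp add: insert.prems)
  obtain d :: nat and p where p: "p \<in> module_homs R (vecs R d) ?RA"
    "p ` carrier (vecs R d) = ?Z" by (rule fin_gen_cover[OF FR fgZ])
  obtain p' where p': "p' \<in> module_homs S (vecs S d) ?SA"
    "\<And>v. v \<in> carrier (vecs R d) \<Longrightarrow> p' (vec_map {..<d} v) = vec_map A (p v)"
    by (rule extend_scalars[OF finite_lessThan p(1)]) (rule that)
  have imp': "p' ` carrier (vecs S d) = ?Z'"
    using image_extend_scalars[OF finite_lessThan p(1) p' subset_refl]
    unfolding vec_map_span_carrier[OF finite_lessThan] p(2) IH by simp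
  have Lj: "L j \<in> module_homs R ?RA (vecs R q)" "L' j \<in> module_homs S ?SA (vecs S q)"
    by (simp_all add: insert.prems)
  let ?Y = "{v \<in> carrier (vecs R d). L j (p v) \<in> W}"
  have "{v \<in> carrier (vecs S d). L' j (p' v) \<in> ?W} = ext_span {..<d} ?Y"
  proof (rule flat_preimage_single[OF flat finite_lessThan module_homs_comp[OF p(1) Lj(1)] module_homs_comp[OF p'(1) Lj(2)] _ W])
    fix v assume v: "v \<in> carrier (vecs R d)"
    show "L' j (p' (vec_map {..<d} v)) = vec_map {..<q} (L j (p v))"
      using p'(2)[OF v] insert.prems(3)[OF insertI1 module_homsD(1)[OF p(1) v]] by simp
  qed
  then have "p' ` {v \<in> carrier (vecs S d). L' j (p' v) \<in> ?W} = ext_span A (p ` ?Y)"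
    using image_extend_scalars[OF finite_lessThan p(1) p', of ?Y] by auto
  moreover have "p' ` {v \<in> carrier (vecs S d). L' j (p' v) \<in> ?W} = {v \<in> ?Z'. L' j v \<in> ?W}"
    unfolding imp'[symmetric] by (rule image_Collect_comp)
  moreover have "p ` ?Y = {v \<in> ?Z. L j v \<in> W}"
    unfolding p(2)[symmetric] by (rule image_Collect_comp)
  moreover have "{v \<in> ?Z'. L' j v \<in> ?W} = {v \<in> carrier ?SA. \<forall>j\<in>insert j J. L' j v \<in> ?W}"
    "{v \<in> ?Z. L j v \<in> W} = {v \<in> carrier ?RA. \<forall>j\<in>insert j J. L j v \<in> W}"
    by (simp_all add: conj_ac cong: conj_cong)
  ultimately show ?case by (simp only:)
qed

lemma matrix_hom_vec_map:
  assumes y: "y \<in> carrier (free R ({..<m} \<times> {..<q}))" and b: "b \<in> carrier (vecs R m)"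
  shows "matrix_hom S m q (vec_map ({..<m} \<times> {..<q}) y) (vec_map {..<m} b) = vec_map {..<q} (matrix_hom R m q y b)"
proof (rule vec_map_commute[OF finite_lessThan matrix_hom(1)[OF cring_R y] matrix_hom(1)[OF cring_S vec_map_homD(1)[OF y]] _ b])
  fix c assume c: "c \<in> {..<m}"
  have "matrix_row q c (vec_map ({..<m} \<times> {..<q}) y) = vec_map {..<q} (matrix_row q c y)"
    using c by (auto simp: matrix_row_def vec_map_def intro!: restrict_ext)
  then show "matrix_hom S m q (vec_map ({..<m} \<times> {..<q}) y) (unit_vec S {..<m} c) =
      vec_map {..<q} (matrix_hom R m q y (unit_vec R {..<m} c))"
    using c matrix_hom(2)[OF cring_R y, of c] matrix_hom(2)[OF cring_S vec_map_homD(1)[OF y], of c] by simp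
qed

text \<open>
  An admissible matrix over \<open>S\<close> solves a linear system with coefficients in \<open>R\<close>, so it is an \<open>S\<close>-combination
  of admissible matrices over \<open>R\<close>.
\<close>

lemma flat_trace:
  assumes coh: "coherent_ring R" and flat: "faithfully_flat R S \<phi>" and B: "finite B" "B \<subseteq> carrier (vecs R m)"
    and W: "fin_gen R (vecs R q) W"
  shows "trace_ext S m (vec_map {..<m} ` B) (vecs S q) (ext_span {..<q} W)
    \<subseteq> ext_span {..<q} (trace_ext R m B (vecs R q) W)"
    (is "trace_ext S m ?B' ?SQ ?W' \<subseteq> ?H")
proof -
  note FR = module_free_module[OF cring_R] note FS = module_free_module[OF cring_S]
  let ?RQ = "vecs R q" let ?T = "trace_ext R m B ?RQ W"
  let ?A = "{..<m} \<times> {..<q}"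
  have T: "submodule ?T R ?RQ" by (rule trace_ext_closed[OF FR submoduleD(1)[OF FR fin_gen_submodule[OF FR W]]])
  have H: "submodule ?H S ?SQ" by (rule submodule_mspan[OF FS vec_map_image[OF submoduleD(1)[OF FR T]]])
  let ?Y = "{y \<in> carrier (free R ?A). \<forall>b\<in>B. matrix_hom R m q y b \<in> W}"
  have Y: "{y \<in> carrier (free S ?A). \<forall>b\<in>B. matrix_hom S m q y (vec_map {..<m} b) \<in> ?W'} =
      ext_span ?A ?Y"
  proof (rule flat_preimage[OF coh flat _ B(1) _ _ _ W])
    show "finite ?A" by simp
    fix b assume "b \<in> B"
    then have b: "b \<in> carrier (vecs R m)" using B(2) by blast
    show "(\<lambda>y. matrix_hom R m q y b) \<in> module_homs R (free R ?A) ?RQ" by (rule matrix_hom_in_matrix[OF cring_R b])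
    show "(\<lambda>y. matrix_hom S m q y (vec_map {..<m} b)) \<in> module_homs S (free S ?A) ?SQ"
      by (rule matrix_hom_in_matrix[OF cring_S vec_map_homD(1)[OF b]])
    fix y assume "y \<in> carrier (free R ?A)"
    then show "matrix_hom S m q (vec_map ?A y) (vec_map {..<m} b) = vec_map {..<q} (matrix_hom R m q y b)"
      by (rule matrix_hom_vec_map[OF _ b])
  qed
  have Yc: "?Y \<subseteq> carrier (free R ?A)" by blast
  \<comment> \<open>The rows of an admissible matrix over \<open>R\<close> lie in the trace.\<close>
  have sol: "matrix_hom S m q (vec_map ?A y) v \<in> ?H" if y: "y \<in> ?Y" and v: "v \<in> carrier (vecs S m)" for y v
  proof -
    have yc: "y \<in> carrier (free R ?A)" using y by blast
    note my = matrix_hom(1)[OF cring_S vec_map_homD(1)[OF yc]]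
    have "carrier (vecs S m) \<subseteq> {v \<in> carrier (vecs S m). matrix_hom S m q (vec_map ?A y) v \<in> ?H}"
    proof (rule ord_eq_le_trans[OF free_module_span[OF cring_S finite_lessThan]],
        rule mspan_least[OF FS submodule_preimage[OF FS FS my H]], rule image_subsetI)
      fix c
      note u = unit_vec_closed[OF cring_R, of "{..<m}" c]
      have "matrix_hom R m q y (unit_vec R {..<m} c) \<in> ?T"
        using y by (intro trace_ext_hom[OF matrix_hom(1)[OF cring_R yc] _ u]) blast
      then have "vec_map {..<q} (matrix_hom R m q y (unit_vec R {..<m} c)) \<in> ?H" by (intro mspan.incl imageI)
      then have "matrix_hom S m q (vec_map ?A y) (unit_vec S {..<m} c) \<in> ?H"
        using matrix_hom_vec_map[OF yc u] by (simp add: vec_map_unit)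
      then show "unit_vec S {..<m} c \<in> {v \<in> carrier (vecs S m). matrix_hom S m q (vec_map ?A y) v \<in> ?H}"
        using unit_vec_closed[OF cring_S, of "{..<m}" c] by blast
    qed
    then show ?thesis using v by blast
  qed
  show ?thesis
  proof (rule trace_ext_least[OF FS H])
    show "?W' \<subseteq> ?H" by (intro mspan_mono image_mono trace_ext_superset)
    fix h v assume h: "h \<in> module_homs S (vecs S m) ?SQ" "h ` ?B' \<subseteq> ?W'"
      and v: "v \<in> carrier (vecs S m)"
    obtain y where y: "y \<in> carrier (free S ?A)"
      "\<And>v. v \<in> carrier (vecs S m) \<Longrightarrow> matrix_hom S m q y v = h v"
      by (rule matrix_hom_surj[OF cring_S h(1)]) (rule that)
    have "matrix_hom S m q y (vec_map {..<m} b) \<in> ?W'" if b: "b \<in> B" for b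
      using y(2)[OF vec_map_homD(1)[of b]] h(2) B(2) b by auto
    then have "y \<in> ext_span ?A ?Y" unfolding Y[symmetric] using y(1) by blast
    then have "matrix_hom S m q y v \<in> (\<lambda>y. matrix_hom S m q y v) ` ext_span ?A ?Y"
      by (rule imageI)
    also have "\<dots> = mspan S ?SQ ((\<lambda>y. matrix_hom S m q y v) ` vec_map ?A ` ?Y)"
      by (rule hom_image_mspan[OF FS FS matrix_hom_in_matrix[OF cring_S v] vec_map_image[OF Yc]])
    also have "\<dots> \<subseteq> ?H" using sol[OF _ v] by (intro mspan_least[OF FS H]) blast
    finally show "h v \<in> ?H" using y(2)[OF v] by simp
  qed
qed

lemma flat_trace_iter:
  assumes coh: "coherent_ring R" and flat: "faithfully_flat R S \<phi>" and B: "finite B" "B \<subseteq> carrier (vecs R m)"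
    and W: "fin_gen R (vecs R q) W"
  shows "(trace_ext S m (vec_map {..<m} ` B) (vecs S q) ^^ n) (ext_span {..<q} W)
    \<subseteq> ext_span {..<q} ((trace_ext R m B (vecs R q) ^^ n) W)"
proof (induction n)
  case (Suc n)
  have fg: "fin_gen R (vecs R q) ((trace_ext R m B (vecs R q) ^^ n) W)"
    by (induction n) (simp_all add: W trace_ext_fin_gen[OF coh B])
  show ?case
    using subset_trans[OF trace_ext_mono[OF Suc] flat_trace[OF coh flat B fg]] by simp
qed simp

lemma flat_trace_iter_full:
  assumes coh: "coherent_ring R" and flat: "faithfully_flat R S \<phi>" and B: "finite B" "B \<subseteq> carrier (vecs R m)"
    and W: "fin_gen R (vecs R q) W"
    and full: "(trace_ext S m (vec_map {..<m} ` B) (vecs S q) ^^ n) (ext_span {..<q} W)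
      = carrier (vecs S q)"
  shows "(trace_ext R m B (vecs R q) ^^ n) W = carrier (vecs R q)"
proof (rule faithful_span[OF flat])
  note FR = module_free_module[OF cring_R, of "{..<q}"] note FS = module_free_module[OF cring_S, of "{..<q}"]
  let ?T = "(trace_ext R m B (vecs R q) ^^ n) W"
  show T: "submodule ?T R (vecs R q)" by (rule trace_iter_submodule[OF FR fin_gen_submodule[OF FR W]])
  show "ext_span {..<q} ?T = carrier (vecs S q)"
    using flat_trace_iter[OF coh flat B W, of n] mspan_subset_carrier[OF FS vec_map_image[OF submoduleD(1)[OF FR T]]]
    unfolding full by (rule equalityI[rotated])
qed

end

section \<open>The annihilator\<close>

text \<open>
  A scalar annihilates \<open>M\<close> as soon as it annihilates the generators.  Written in terms of a presentation
  of \<open>M\<close>, this is a membership condition of the kind studied above; it describes the relations of the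
  cyclic module \<open>R / Ann M\<close> with respect to its one generator.
\<close>

lemma annihilator_presentation:
  assumes M: "Module.module R M"
    and hM: "hM \<in> module_homs R (vecs R m) M" "hM ` carrier (vecs R m) = carrier M"
  defines "Q \<equiv> quotient_module (regular_module R) (annihilator R M)"
  obtains f where "Module.module R Q" "f \<in> module_homs R (vecs R 1) Q"
    "f ` carrier (vecs R 1) = carrier Q"
    "a_kernel (vecs R 1) Q f = {v \<in> carrier (vecs R 1).
       \<forall>c\<in>{..<m}. v 0 \<odot>\<^bsub>vecs R m\<^esub> unit_vec R {..<m} c \<in> a_kernel (vecs R m) M hM}"
proof -
  interpret M: Module.module R M by (rule M)
  have R: "cring R" by (rule M.R.is_cring)
  let ?F = "vecs R m"
  note F = module_free_module[OF R] note reg = module_regular_module[OF R]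
  interpret F: Module.module R ?F by (rule F)
  have ann: "submodule (annihilator R M) R (regular_module R)"
    by (rule submodule_if_closed[OF reg])
      (auto simp: annihilator_def M.smult_l_distr M.smult_assoc1)
  have ann_iff: "r \<in> annihilator R M \<longleftrightarrow> (\<forall>c\<in>{..<m}. r \<odot>\<^bsub>?F\<^esub> unit_vec R {..<m} c \<in> a_kernel ?F M hM)"
    if r: "r \<in> carrier R" for r
  proof
    assume "r \<in> annihilator R M"
    then show "\<forall>c\<in>{..<m}. r \<odot>\<^bsub>?F\<^esub> unit_vec R {..<m} c \<in> a_kernel ?F M hM"
      using module_homsD(1,3)[OF hM(1)] r unit_vec_closed[OF R, of "{..<m}"]
      by (simp add: annihilator_def a_kernel_eq)
  next
    assume *: "\<forall>c\<in>{..<m}. r \<odot>\<^bsub>?F\<^esub> unit_vec R {..<m} c \<in> a_kernel ?F M hM"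
    have scale: "(\<lambda>x. r \<odot>\<^bsub>M\<^esub> x) \<in> module_homs R M M"
      using r by (intro module_homsI) (auto simp: M.smult_r_distr M.smult_assoc1[symmetric] M.R.m_comm)
    note rh = module_homs_comp[OF hM(1) scale]
    have "carrier ?F \<subseteq> a_kernel ?F M (\<lambda>v. r \<odot>\<^bsub>M\<^esub> hM v)"
    proof (rule ord_eq_le_trans[OF free_module_span[OF R finite_lessThan]],
        rule mspan_least[OF F submodule_kernel[OF F M rh]], rule image_subsetI)
      fix c assume "c \<in> {..<m}"
      then have "hM (r \<odot>\<^bsub>?F\<^esub> unit_vec R {..<m} c) = \<zero>\<^bsub>M\<^esub>" using * unfolding a_kernel_eq by blast
      then show "unit_vec R {..<m} c \<in> a_kernel ?F M (\<lambda>v. r \<odot>\<^bsub>M\<^esub> hM v)"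
        using module_homsD(3)[OF hM(1) r unit_vec_closed[OF R]] unit_vec_closed[OF R, of "{..<m}" c] by (simp add: a_kernel_eq)
    qed
    then have kill: "r \<odot>\<^bsub>M\<^esub> hM v = \<zero>\<^bsub>M\<^esub>" if "v \<in> carrier ?F" for v
      using that unfolding a_kernel_eq by blast
    have "r \<odot>\<^bsub>M\<^esub> x = \<zero>\<^bsub>M\<^esub>" if x: "x \<in> carrier M" for x
    proof -
      obtain v where "v \<in> carrier ?F" "x = hM v" using x hM(2) by blast
      then show ?thesis using kill by simp
    qed
    then show "r \<in> annihilator R M" using r by (simp add: annihilator_def)
  qed
  note Q = quotient_module[OF reg ann, folded Q_def]
  let ?p = "\<lambda>x. annihilator R M +>\<^bsub>regular_module R\<^esub> x"
  have pr: "(\<lambda>v. v 0) \<in> module_homs R (vecs R 1) (regular_module R)"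
    by (rule proj_module_hom) simp
  have surj: "(\<lambda>v. v 0) ` carrier (vecs R 1) = carrier (regular_module R)"
  proof
    show "(\<lambda>v. v 0) ` carrier (vecs R 1) \<subseteq> carrier (regular_module R)"
      using module_homsD(1)[OF pr] by blast
    show "carrier (regular_module R) \<subseteq> (\<lambda>v. v 0) ` carrier (vecs R 1)"
    proof
      fix x assume "x \<in> carrier (regular_module R)"
      then show "x \<in> (\<lambda>v. v 0) ` carrier (vecs R 1)"
        by (intro image_eqI[of _ _ "\<lambda>i\<in>{..<1}. x"]) (auto simp: product_module_simps)
    qed
  qed
  show ?thesis
  proof (rule that[OF Q(1) module_homs_comp[OF pr Q(2)]])
    have "(\<lambda>v. ?p (v 0)) ` carrier (vecs R 1) = ?p ` (\<lambda>v. v 0) ` carrier (vecs R 1)"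
      by (simp only: image_image)
    then show "(\<lambda>v. ?p (v 0)) ` carrier (vecs R 1) = carrier Q" unfolding surj Q(3) .
    have "?p r = \<zero>\<^bsub>Q\<^esub> \<longleftrightarrow> (\<forall>c\<in>{..<m}. r \<odot>\<^bsub>?F\<^esub> unit_vec R {..<m} c \<in> a_kernel ?F M hM)" if "r \<in> carrier R" for r
      using Q(4) ann_iff[OF that] that unfolding a_kernel_eq[of _ Q] by auto
    then show "a_kernel (vecs R 1) Q (\<lambda>v. ?p (v 0)) = {v \<in> carrier (vecs R 1).
       \<forall>c\<in>{..<m}. v 0 \<odot>\<^bsub>?F\<^esub> unit_vec R {..<m} c \<in> a_kernel ?F M hM}"
      unfolding a_kernel_eq[of _ Q] using module_homsD(1)[OF pr] by auto
  qed
qed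

lemma scaled_unit_hom:
  assumes "cring R"
  shows "(\<lambda>v. v 0 \<odot>\<^bsub>vecs R m\<^esub> unit_vec R {..<m} c) \<in>
    module_homs R (vecs R 1) (vecs R m)"
  by (rule module_homs_comp[OF proj_module_hom[of 0] smult_module_hom[OF module_free_module[OF assms] unit_vec_closed[OF assms]]])
    simp

section \<open>Comparison of filtrations and of the invariant\<close>

text \<open>
  All modules are replaced by presentations: \<open>M\<close>, \<open>N\<close> and their base changes have the same matrices, while
  \<open>R / Ann M\<close> and \<open>S / Ann M'\<close> have one generator each and relations \<open>A\<close> and \<open>A'\<close> such that \<open>A\<close> maps into \<open>A'\<close>, and
  spans it in the flat case.  Comparing iterated traces then gives all four claims.
\<close>

theorem (in ring_change) Filt_gen_base_change:
  fixes M :: "('r, 'm) module" and N :: "('r, 'n) module"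
  assumes cohR: "coherent_ring R" and cohS: "coherent_ring S"
    and M: "finitely_presented R M" and N: "finitely_presented R N"
  defines "M' \<equiv> base_change R S \<phi> M" and "N' \<equiv> base_change R S \<phi> N"
  shows "N \<in> Filt R n (gen R M) \<Longrightarrow> N' \<in> Filt S n (gen S M')"
    and "faithfully_flat R S \<phi> \<Longrightarrow> N' \<in> Filt S n (gen S M') \<Longrightarrow> N \<in> Filt R n (gen R M)"
    and "b_inv S M' \<le> b_inv R M"
    and "faithfully_flat R S \<phi> \<Longrightarrow> b_inv S M' = b_inv R M"
proof -
  note FR = module_free_module[OF cring_R] note FS = module_free_module[OF cring_S]
  have mM: "Module.module R M" and mN: "Module.module R N" using M N by (simp_all add: finitely_presented_module)
  interpret M: scalar_extension R S \<phi> M by (rule scalar_extensionI[OF mM])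
  interpret N: scalar_extension R S \<phi> N by (rule scalar_extensionI[OF mN])
  have mM': "Module.module S M'" unfolding M'_def by (rule M.module_T)
  have mN': "Module.module S N'" unfolding N'_def by (rule N.module_T)
  obtain m h where h: "h \<in> module_homs R (vecs R m) M" "h ` carrier (vecs R m) = carrier M"
    and fgh: "fin_gen R (vecs R m) (a_kernel (vecs R m) M h)"
    by (rule finitely_presentedE[OF M])
  obtain B where B: "finite B" "B \<subseteq> carrier (vecs R m)"
    "a_kernel (vecs R m) M h = mspan R (vecs R m) B"
    using fgh unfolding fin_gen_def by blast
  let ?B = "vec_map {..<m} ` B"
  obtain h' where h': "h' \<in> module_homs S (vecs S m) M'"
    "h' ` carrier (vecs S m) = carrier M'"
    and kerh': "a_kernel (vecs S m) M' h' = mspan S (vecs S m) ?B"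
    by (rule M.base_change_presentation[OF finite_lessThan h, folded M'_def]) (rule that, simp_all add: B(3) mspan_vec_map[OF B(2)])
  have B': "finite ?B" "?B \<subseteq> carrier (vecs S m)" using B(1) vec_map_image[OF B(2)] by auto
  note FiltR = Filt_gen_iff_trace[OF cohR _ mM h B]
  note FiltS = Filt_gen_iff_trace[OF cohS _ mM' h' B' kerh']
  obtain q f where f: "f \<in> module_homs R (vecs R q) N" "f ` carrier (vecs R q) = carrier N"
    and K: "fin_gen R (vecs R q) (a_kernel (vecs R q) N f)"
    by (rule finitely_presentedE[OF N])
  let ?K = "a_kernel (vecs R q) N f"
  have Kc: "?K \<subseteq> carrier (vecs R q)" by (rule submoduleD(1)[OF FR fin_gen_submodule[OF FR K]])
  let ?K' = "ext_span {..<q} ?K"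
  obtain f' where f': "f' \<in> module_homs S (vecs S q) N'" "f' ` carrier (vecs S q) = carrier N'"
    and kerf': "a_kernel (vecs S q) N' f' = ?K'"
    by (rule N.base_change_presentation[OF finite_lessThan f, folded N'_def]) (rule that)
  have N': "finitely_presented S N'"
    by (rule finitely_presentedI[OF mN' f']) (simp add: kerf' fin_gen_vec_map[OF K])
  note iffR = FiltR[OF N f] note iffS = FiltS[OF N' f', unfolded kerf']
  have K': "submodule ?K' S (vecs S q)" by (rule submodule_mspan[OF FS vec_map_image[OF Kc]])
  show "N' \<in> Filt S n (gen S M')" if "N \<in> Filt R n (gen R M)"
    using trace_iter_full[OF mspan_superset Kc K' B(2)] that unfolding iffR iffS by blast
  show "N \<in> Filt R n (gen R M)" if "faithfully_flat R S \<phi>" "N' \<in> Filt S n (gen S M')"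
    using flat_trace_iter_full[OF cohR that(1) B(1,2) K] that(2) unfolding iffR iffS by blast

  let ?Q = "quotient_module (regular_module R) (annihilator R M)"
  let ?Q' = "quotient_module (regular_module S) (annihilator S M')"
  let ?L = "\<lambda>c v. v 0 \<odot>\<^bsub>vecs R m\<^esub> unit_vec R {..<m} c"
  let ?L' = "\<lambda>c v. v 0 \<odot>\<^bsub>vecs S m\<^esub> unit_vec S {..<m} c"
  let ?R1 = "vecs R 1" let ?S1 = "vecs S 1"
  let ?W = "mspan R (vecs R m) B" let ?W' = "mspan S (vecs S m) ?B"
  let ?A = "{v \<in> carrier ?R1. \<forall>c\<in>{..<m}. ?L c v \<in> ?W}" let ?A' = "{v \<in> carrier ?S1. \<forall>c\<in>{..<m}. ?L' c v \<in> ?W'}"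
  obtain u where mQ: "Module.module R ?Q" and u: "u \<in> module_homs R ?R1 ?Q" "u ` carrier ?R1 = carrier ?Q"
    and keru: "a_kernel ?R1 ?Q u = ?A"
    by (rule annihilator_presentation[OF mM h]) (rule that, simp_all only: B(3))
  obtain u' where mQ': "Module.module S ?Q'" and u': "u' \<in> module_homs S ?S1 ?Q'" "u' ` carrier ?S1 = carrier ?Q'"
    and keru': "a_kernel ?S1 ?Q' u' = ?A'"
    by (rule annihilator_presentation[OF mM' h']) (rule that, simp_all only: kerh')
  have W: "fin_gen R (vecs R m) ?W" by (rule fin_genI[OF B(1,2)])
  have W': "fin_gen S (vecs S m) ?W'" by (rule fin_genI[OF B'])
  have A: "fin_gen R ?R1 ?A"
    by (rule coherent_preimage[OF cohR finite_lessThan finite_lessThan scaled_unit_hom[OF cring_R] W])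
  have A': "fin_gen S ?S1 ?A'"
    by (rule coherent_preimage[OF cohS finite_lessThan finite_lessThan scaled_unit_hom[OF cring_S] W'])
  have Q: "finitely_presented R ?Q" by (rule finitely_presentedI[OF mQ u]) (simp only: keru A)
  have Q': "finitely_presented S ?Q'" by (rule finitely_presentedI[OF mQ' u']) (simp only: keru' A')
  have comm: "?L' c (vec_map {..<1} v) = vec_map {..<m} (?L c v)" if v: "v \<in> carrier ?R1" for c v
  proof -
    have "v 0 \<in> carrier R" using v by (auto simp: product_module_simps)
    moreover have "vec_map {..<1} v 0 = \<phi> (v 0)" by (simp add: vec_map_def)
    ultimately show ?thesis
      using vec_map_homD(3)[OF _ unit_vec_closed[OF cring_R], of "v 0" "{..<m}" c] by (simp add: vec_map_unit)
  qed
  have Ac: "?A \<subseteq> carrier ?R1" by blast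
  have A'sub: "submodule ?A' S ?S1" by (rule fin_gen_submodule[OF FS A'])
  have AA': "vec_map {..<1} ` ?A \<subseteq> ?A'"
  proof (rule image_subsetI)
    fix v assume v: "v \<in> ?A"
    then have vc: "v \<in> carrier ?R1" by blast
    have "?L' c (vec_map {..<1} v) \<in> ?W'" if "c \<in> {..<m}" for c
    proof -
      have "?L c v \<in> ?W" using v that by blast
      then have "vec_map {..<m} (?L c v) \<in> ext_span {..<m} ?W"
        by (rule mspan.incl[OF imageI])
      then show ?thesis unfolding comm[OF vc] mspan_vec_map[OF B(2)] .
    qed
    then show "vec_map {..<1} v \<in> ?A'" using vec_map_homD(1)[OF vc] by blast
  qed
  note QR = FiltR[OF Q u, unfolded keru] note QS = FiltS[OF Q' u', unfolded keru']
  have le: "?Q' \<in> Filt S k (gen S M')" if "?Q \<in> Filt R k (gen R M)" for k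
    using trace_iter_full[OF AA' Ac A'sub B(2)] that unfolding QR QS by blast
  then show "b_inv S M' \<le> b_inv R M"
    unfolding b_inv_def by (intro Inf_superset_mono) blast
  show "b_inv S M' = b_inv R M" if flat: "faithfully_flat R S \<phi>"
  proof -
    have "?A' = ext_span {..<1} ?A"
      using flat_preimage[OF cohR flat finite_lessThan finite_lessThan scaled_unit_hom[OF cring_R] scaled_unit_hom[OF cring_S] comm W]
      unfolding mspan_vec_map[OF B(2)] by simp
    then have "?Q \<in> Filt R k (gen R M)" if "?Q' \<in> Filt S k (gen S M')" for k
      using flat_trace_iter_full[OF cohR flat B(1,2) A, of k] that unfolding QR QS by simp
    with le have "?Q \<in> Filt R k (gen R M) \<longleftrightarrow> ?Q' \<in> Filt S k (gen S M')" for k by blast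
    then show ?thesis unfolding b_inv_def by simp
  qed
qed

theorem corollary4p6:
  fixes R :: "'r ring" and S :: "'s ring" and \<phi> :: "'r \<Rightarrow> 's"
    and M :: "('r, 'm) module" and N :: "('r, 'n) module" and n :: nat
  assumes "coherent_ring R" and "coherent_ring S"
    and "\<phi> \<in> ring_hom R S"
    and "finitely_presented R M" and "finitely_presented R N"
    and "n \<ge> 1"
  shows "(N \<in> Filt R n (gen R M) \<longrightarrow>
            base_change R S \<phi> N \<in> Filt S n (gen S (base_change R S \<phi> M))) \<and>
         b_inv S (base_change R S \<phi> M) \<le> b_inv R M \<and>
         (faithfully_flat R S \<phi> \<longrightarrow>
            (N \<in> Filt R n (gen R M) \<longleftrightarrow>
               base_change R S \<phi> N \<in> Filt S n (gen S (base_change R S \<phi> M))) \<and>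
            b_inv S (base_change R S \<phi> M) = b_inv R M)"
proof -
  interpret ring_change R S \<phi>
    by (intro ring_change.intro coherent_ring_cring assms(1-3))
  show ?thesis
    using Filt_gen_base_change[OF assms(1,2,4,5)] by blast
qed

end
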